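(* Let $\mathcal{A}\subset\mathbb{N}$ be a finite set with $|\mathcal{A}|\ge2$ such that $\mathrm{HD}(F_{\mathcal{A}})>1/2+\delta$, where $\delta>0$. Then there are an integer constant $C_{\mathcal{A}}(\delta)$ and a constant $K_{\mathcal{A}}$ (depending on $\mathcal{A}$ and $\delta$) such that for every prime $p$ there exist positive integers $q$ and $a$ with $0<a<q$, $\gcd(a,q)=1$, $q\le K_{\mathcal{A}}\,p^{C_{\mathcal{A}}(\delta)}$ and $q\equiv0\pmod p$, such that all partial quotients of $a/q$ belong to $\mathcal{A}$.
   Context: For coprime positive integers $0<a<q$, the regular continued fraction expansion is the unique representation $a/q=[0;b_1,\dots,b_s]=\cfrac{1}{b_1+\cfrac{1}{\cdots+\cfrac{1}{b_s}}}$ with positive integers $b_j$ and $b_s\ge2$; the $b_j$ are the partial quotients. $F_{\mathcal{A}}$ denotes the set of irrational numbers in $[0,1]$ all of whose continued fraction partial quotients belong to $\mathcal{A}$, and $\mathrm{HD}$ denotes Hausdorff dimension. *)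

theory Defs
  imports "HOL-Analysis.Analysis"
begin

text \<open>Partial quotients of a rational a/q (0 < a < q, coprime), via the Euclidean
algorithm: a/q = 1/(b1 + r/a) with b1 = q div a, r = q mod a.  This yields the
regular expansion [0; b1, ..., bs] with bs >= 2.\<close>

function cf_quotients :: "nat \<Rightarrow> nat \<Rightarrow> nat list" where
  "cf_quotients a q = (if a = 0 then [] else (q div a) # cf_quotients (q mod a) a)"
  by pat_completeness auto
termination by (relation "Wellfounded.measure fst") auto

declare cf_quotients.simps [simp del]

definition gauss_map :: "real \<Rightarrow> real" where
  "gauss_map x = frac (1 / x)"

definition cf_digit :: "real \<Rightarrow> nat \<Rightarrow> int" where
  "cf_digit x n = \<lfloor>1 / ((gauss_map ^^ n) x)\<rfloor>"

definition F_set :: "nat set \<Rightarrow> real set" where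
  "F_set A = {x \<in> {0..1}. x \<notin> \<rat> \<and> (\<forall>n. nat (cf_digit x n) \<in> A)}"

definition hausdorff_pre :: "real \<Rightarrow> real \<Rightarrow> real set \<Rightarrow> ereal" where
  "hausdorff_pre s d E =
     (INF U \<in> {U :: nat \<Rightarrow> real set. E \<subseteq> (\<Union>i. U i) \<and>
                 (\<forall>i. bounded (U i) \<and> diameter (U i) \<le> d)}.
        \<Sum>i. ereal (diameter (U i) powr s))"

definition hausdorff_measure :: "real \<Rightarrow> real set \<Rightarrow> ereal" where
  "hausdorff_measure s E = (SUP d \<in> {0<..}. hausdorff_pre s d E)"

definition hausdorff_dim :: "real set \<Rightarrow> ereal" where
  "hausdorff_dim E = Inf {ereal s | s. s > 0 \<and> hausdorff_measure s E = 0}"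

end

theory Submission
  imports Defs "HOL-Library.Set_Algebras"
begin

text \<open>
  The denominator of [0; b1, ..., bs] is the lower right entry of the product of the matrices
  (0 1; 1 b). If a < b are positive elements of the digit set, the products of even length over
  {a, b} with entries below p form a set of size a power of p in SL2(F_p), and a product of boundedly
  many of its elements maps a prescribed line to a prescribed line of F_p^2. Prescribing the lines
  spanned by (1, b) and (1, 0) makes the denominator of a word ending in b divisible by p.

  Transitivity of a bounded power comes from growth. If B has small tripling, then by Ruzsa's
  inequalities it lies in an approximate subgroup A. No proper linear subspace of the matrix algebra
  contains a large part of A, because the unipotents (1 t; 0 1) and (1 0; t 1), obtained from two
  words differing in one letter, normalize no nontrivial subalgebra; hence A meets every trace class
  in few elements, and, by counting orbits under conjugation, the centralizer of any nonscalar element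
  of A^2 in many. This richness propagates from one torus to its conjugates under A, hence to all
  p^2 of them up to a constant, and forces A to have more than p^2 elements by a power of p. Once B
  is that large, the second moment method for the doubly transitive action on the projective line
  shows that B expands every set of lines until it covers half of them.

  The small primes are handled by the words b, ..., b alone, whose denominators are periodic mod p.
  Hausdorff dimension only enters to exclude digit sets with a single positive element.
\<close>

text \<open>Uniformity in p decides the shape of the argument. Words of length proportional to log p
  keep their integer entries below p, so that no two of them collide mod p, and still there are p^c
  of them, where c depends only on the larger letter b. The growth factor k is itself a fixed power
  of p; so the number of triplings, and with it the power that acts transitively on lines, is
  bounded in terms of b. The total length is therefore O(log p), and a word of length l has
  denominator at most (b + 1)^l: this is where a bound polynomial in p comes from. All losses are
  powers of k with absolute exponents. Primality enters the passage from torus to torus: it makes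
  every element of the field a multiple of t, so that the two unipotents generate all of SL2 and no
  proper subfield can trap the growth. Ending every word in b >= 2 also makes it the regular
  expansion of its fraction.\<close>

section \<open>Fibers and overlaps of finite sets\<close>

lemma card_le_fibers:
  assumes "finite A" "finite B" "f ` A \<subseteq> B" "\<And>b. b \<in> B \<Longrightarrow> card {a\<in>A. f a = b} \<le> n"
  shows "card A \<le> n * card B"
proof -
  have "A = (\<Union>b\<in>B. {a\<in>A. f a = b})" using assms(3) by auto
  then have "card A \<le> (\<Sum>b\<in>B. card {a\<in>A. f a = b})"
    using card_UN_le[OF assms(2), of "\<lambda>b. {a\<in>A. f a = b}"] by simp
  also have "\<dots> \<le> (\<Sum>b\<in>B. n)" using assms(4) by (intro sum_mono)
  finally show ?thesis by (simp add: mult.commute)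
qed

text \<open>The Cauchy-Schwarz inequality for the multiplicity \<open>r\<close>, the number of sets
  through a point. If all overlaps of distinct sets were below \<open>t\<close>, the sum
  \<open>s\<close> of the sizes would satisfy s^2 <= \<omega> s + s^2 / 2, that is s <= 2 \<omega>,
  against the last hypothesis.\<close>

lemma overlapping_pair:
  fixes V :: "'i \<Rightarrow> 'b set" and v \<omega> :: real
  assumes "finite I" "finite \<Omega>" "\<And>i. i \<in> I \<Longrightarrow> V i \<subseteq> \<Omega>" "\<And>i. i \<in> I \<Longrightarrow> v \<le> card (V i)"
    and "card \<Omega> \<le> \<omega>" "\<omega> > 0" "v > 0" "card I * v > 2 * \<omega>"
  obtains i j where "i \<in> I" "j \<in> I" "i \<noteq> j" "card (V i \<inter> V j) \<ge> v\<^sup>2 / (2 * \<omega>)"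
proof -
  define t where "t = v\<^sup>2 / (2 * \<omega>)"
  define r where "r x = (\<Sum>i\<in>I. indicator (V i) x :: real)" for x
  define s where "s = (\<Sum>i\<in>I. real (card (V i)))"
  have ind: "(\<Sum>x\<in>\<Omega>. indicator S x) = real (card S)" if "S \<subseteq> \<Omega>" for S
    using assms(2) that by (simp add: indicator_def Int_absorb1 flip: sum.inter_filter)
  have sr: "(\<Sum>x\<in>\<Omega>. r x) = s"
    unfolding r_def s_def by (subst sum.swap) (intro sum.cong refl, simp add: ind assms(3))
  have r2: "(\<Sum>x\<in>\<Omega>. (r x)\<^sup>2) = (\<Sum>i\<in>I. \<Sum>j\<in>I. real (card (V i \<inter> V j)))"
  proof -
    have "(\<Sum>x\<in>\<Omega>. (r x)\<^sup>2) = (\<Sum>x\<in>\<Omega>. \<Sum>i\<in>I. \<Sum>j\<in>I. indicator (V i \<inter> V j) x)"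
      unfolding r_def power2_eq_square sum_product by (simp add: indicator_inter_arith)
    also have "\<dots> = (\<Sum>i\<in>I. \<Sum>j\<in>I. \<Sum>x\<in>\<Omega>. indicator (V i \<inter> V j) x)"
      by (subst sum.swap, intro sum.cong refl, subst sum.swap, simp)
    also have "\<dots> = (\<Sum>i\<in>I. \<Sum>j\<in>I. real (card (V i \<inter> V j)))"
      using assms(3) by (intro sum.cong refl ind) auto
    finally show ?thesis .
  qed
  have "\<exists>i\<in>I. \<exists>j\<in>I. i \<noteq> j \<and> card (V i \<inter> V j) \<ge> t"
  proof (rule ccontr)
    assume "\<not> ?thesis"
    then have small: "card (V i \<inter> V j) < t" if "i \<in> I" "j \<in> I" "i \<noteq> j" for i j using that by force
    have sI: "card I * v \<le> s" unfolding s_def using sum_mono[OF assms(4)] by simp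
    have "s\<^sup>2 \<le> (\<Sum>x\<in>\<Omega>. 1\<^sup>2) * (\<Sum>x\<in>\<Omega>. (r x)\<^sup>2)"
      using Cauchy_Schwarz_ineq_sum[of "\<lambda>_. 1" r \<Omega>] by (simp add: sr)
    also have "\<dots> \<le> \<omega> * (\<Sum>x\<in>\<Omega>. (r x)\<^sup>2)"
      using assms(5) by (intro mult_right_mono) (auto intro: sum_nonneg)
    also have "(\<Sum>x\<in>\<Omega>. (r x)\<^sup>2) \<le> (\<Sum>i\<in>I. \<Sum>j\<in>I. (if j = i then real (card (V i)) else 0) + t)"
      unfolding r2 using small assms(7,6) by (intro sum_mono) (force simp: t_def intro: less_imp_le)
    also have "\<dots> = s + (card I)\<^sup>2 * t"
      by (simp add: sum.distrib s_def assms(1) power2_eq_square)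
    finally have c: "s\<^sup>2 \<le> \<omega> * s + (card I * v)\<^sup>2 / 2"
      using assms(6) by (simp add: t_def distrib_left power_mult_distrib)
    have "(card I * v)\<^sup>2 \<le> s\<^sup>2" using sI assms(7) by (intro power_mono) auto
    then have "s\<^sup>2 \<le> \<omega> * s + s\<^sup>2 / 2" using c by linarith
    then have "s * s \<le> (2 * \<omega>) * s" by (simp add: power2_eq_square)
    moreover have "s > 2 * \<omega>" using sI assms(8) by linarith
    ultimately show False using assms(6) by (simp add: mult_le_cancel_right)
  qed
  then show ?thesis using that unfolding t_def by blast
qed

section \<open>Growth of product sets in a finite group\<close>

text \<open>Groups are written additively because the class group_add, although not commutative,
  is the only class of groups in the library.\<close>

lemma card_uminus [simp]: "card (uminus ` X) = card (X :: 'g::group_add set)"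
  by (intro card_image) (auto simp: inj_on_def)

lemma uminus_set_plus: "uminus ` (X + Y) = uminus ` Y + uminus ` (X :: 'g::group_add set)"
  by (force simp: set_plus_def minus_add image_iff)

lemma uminus_uminus_image [simp]: "uminus ` uminus ` X = (X :: 'g::group_add set)"
  by (auto simp: image_image)

text \<open>For every \<open>w\<close> in \<open>X + Z\<close> one decomposition
  \<open>x w + z w\<close> is fixed. The pair of \<open>x w + - y\<close> and \<open>y + z w\<close>
  then determines \<open>w\<close>, as the sum of its entries, and hence also
  \<open>y\<close>.\<close>

lemma ruzsa_triangle:
  fixes X Y Z :: "'g::{group_add,finite} set"
  shows "card (X + Z) * card Y \<le> card (X + uminus ` Y) * card (Y + Z)"
proof -
  have "\<forall>w\<in>X + Z. \<exists>x z. x \<in> X \<and> z \<in> Z \<and> w = x + z" by (auto simp: set_plus_def)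
  then obtain x z where xz: "\<And>w. w \<in> X + Z \<Longrightarrow> x w \<in> X \<and> z w \<in> Z \<and> w = x w + z w" by metis
  define f where "f = (\<lambda>(w, y). (x w + - y, y + z w))"
  have "inj_on f ((X + Z) \<times> Y)"
  proof (rule inj_onI, clarify)
    fix w y w' y' assume w: "w \<in> X + Z" "w' \<in> X + Z" and e: "f (w, y) = f (w', y')"
    have 1: "x w + - y = x w' + - y'" and 2: "y + z w = y' + z w'" using e by (auto simp: f_def)
    have "(x w + - y) + (y + z w) = (x w' + - y') + (y' + z w')" by (simp only: 1 2)
    then have "x w + z w = x w' + z w'" by (metis add.assoc minus_add_cancel)
    then have "w = w'" using xz[OF w(1)] xz[OF w(2)] by simp
    then show "w = w' \<and> y = y'" using 2 by simp
  qed
  moreover have "f ` ((X + Z) \<times> Y) \<subseteq> (X + uminus ` Y) \<times> (Y + Z)"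
    using xz by (auto simp: f_def simp del: add_uminus_conv_diff intro!: set_plus_intro)
  ultimately have "card ((X + Z) \<times> Y) \<le> card ((X + uminus ` Y) \<times> (Y + Z))"
    by (intro card_inj_on_le[of f]) auto
  then show ?thesis by (simp add: card_cartesian_product)
qed

lemma card_set_plus_left:
  fixes X Y :: "'g::{group_add,finite} set"
  assumes "Y \<noteq> {}"
  shows "card X \<le> card (X + Y)"
proof -
  obtain y where "y \<in> Y" using assms by auto
  then have "(\<lambda>x. x + y) ` X \<subseteq> X + Y" by auto
  then show ?thesis using card_inj_on_le[of "\<lambda>x. x + y" X "X + Y"] by (auto simp: inj_on_def)
qed

lemma set_plus_zero [simp]: "X + {0} = X" "{0} + X = (X :: 'g::monoid_add set)"
  by (simp_all flip: set_zero)

fun set_pow :: "'g::monoid_add set \<Rightarrow> nat \<Rightarrow> 'g set" where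
  "set_pow X 0 = {0}"
| "set_pow X (Suc n) = X + set_pow X n"

lemma set_pow_add: "set_pow X (m + n) = set_pow X m + set_pow X n"
  by (induction m) (simp_all add: add.assoc)

lemma set_pow_mult: "set_pow X (m * n) = set_pow (set_pow X m) n"
  by (induction n) (simp_all add: set_pow_add)

lemma set_pow_addI: "x \<in> set_pow X m \<Longrightarrow> y \<in> set_pow X n \<Longrightarrow> x + y \<in> set_pow X (m + n)"
  by (auto simp: set_pow_add)

lemma set_pow_mono_exp:
  assumes "0 \<in> X" "m \<le> n" shows "set_pow X m \<subseteq> set_pow X n"
proof -
  have "0 \<in> set_pow X k" for k using assms(1) by (induction k) (force simp: set_plus_def)+
  moreover have "set_pow X n = set_pow X m + set_pow X (n - m)" 
    using assms(2) set_pow_add[of X m "n - m"] by simp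
  ultimately show ?thesis by (force simp: set_plus_def)
qed

lemma set_pow_Suc2: "set_pow X (Suc n) = set_pow X n + X"
  using set_pow_add[of X n 1] by simp

lemma uminus_set_pow: "uminus ` set_pow X n = set_pow (uminus ` (X :: 'g::group_add set)) n"
proof (induction n)
  case (Suc n)
  have "uminus ` set_pow X (Suc n) = set_pow (uminus ` X) n + uminus ` X"
    by (simp add: uminus_set_plus Suc)
  then show ?case by (simp only: set_pow_Suc2)
qed auto

lemma set_pow_uminus:
  fixes X :: "'g::group_add set"
  assumes "uminus ` X = X" "x \<in> set_pow X n" shows "- x \<in> set_pow X n"
  using uminus_set_pow[of X n] assms by auto

text \<open>One more factor costs one more \<open>K\<close>: the triangle inequality with
  \<open>S\<close> in the middle gives |S^(n+4)| |S| <= |S^(n+3)| |S^3|, where symmetry turns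
  S^(n+2) S^-1 back into a power of \<open>S\<close>.\<close>

lemma card_set_pow_le:
  fixes S :: "'g::{group_add,finite} set" and K :: real
  assumes sym: "uminus ` S = S" and ne: "S \<noteq> {}" and K: "card (set_pow S 3) \<le> K * card S"
  shows "card (set_pow S (n + 3)) \<le> K ^ Suc n * card S"
proof (induction n)
  case (Suc n)
  have pos: "card S > 0" using ne by (simp add: card_gt_0_iff)
  have K0: "K \<ge> 0" using K pos by (smt (verit) mult_neg_pos of_nat_0_less_iff of_nat_0_le_iff)
  have e1: "set_pow S (Suc n + 3) = set_pow S (n + 2) + set_pow S 2"
    by (simp only: set_pow_add[symmetric]) (simp add: eval_nat_numeral)
  have e2: "set_pow S (n + 2) + uminus ` S = set_pow S (n + 3)"
    using set_pow_Suc2[of S "n + 2"] by (simp add: sym numeral_3_eq_3)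
  have e3: "S + set_pow S 2 = set_pow S 3" by (simp add: numeral_3_eq_3 numeral_2_eq_2)
  have "real (card (set_pow S (Suc n + 3))) * card S \<le> card (set_pow S (n + 3)) * real (card (set_pow S 3))"
    using ruzsa_triangle[of "set_pow S (n + 2)" "set_pow S 2" S]
    unfolding e1 e2 e3 by (metis of_nat_le_iff of_nat_mult)
  also have "\<dots> \<le> (K ^ Suc n * card S) * (K * card S)"
    using Suc K K0 by (intro mult_mono) auto
  finally show ?case using pos by (simp add: mult_ac)
qed (use K in simp)

text \<open>All eight products of three factors from \<open>B\<close> and its inverse
  \<open>M\<close> are bounded by the triangle inequality: each change between \<open>B\<close> and
  \<open>M\<close> costs a factor \<open>\<kappa>\<close>, so the alternating products
  \<open>B + M + B\<close> and \<open>M + B + M\<close> are the worst, with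
  \<open>\<kappa> ^ 3\<close>.\<close>

lemma tripling_symmetrization:
  fixes B :: "'g::{group_add,finite} set" and \<kappa> :: real
  assumes ne: "B \<noteq> {}" and k: "card (set_pow B 3) \<le> \<kappa> * card B"
  defines "S \<equiv> B \<union> uminus ` B \<union> {0}"
  shows "card (set_pow S 3) \<le> 32 * \<kappa> ^ 3 * card B"
proof -
  define b where "b = real (card B)"
  have b: "b > 0" using ne by (simp add: b_def card_gt_0_iff)
  define M where "M = uminus ` B"
  have Mne: "M \<noteq> {}" and cM: "card M = card B" using ne by (auto simp: M_def)
  have uM: "uminus ` M = B" "uminus ` B = M" by (auto simp: M_def)
  have p3: "set_pow B 3 = B + B + B" by (simp add: numeral_3_eq_3 add.assoc)
  have BBB: "card (B + B + B) \<le> \<kappa> * b" using k unfolding p3 b_def .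
  have BB: "card (B + B) \<le> \<kappa> * b"
    using card_set_plus_left[OF ne, of "B + B"] BBB by linarith
  have k1: "\<kappa> \<ge> 1"
  proof -
    have "b \<le> \<kappa> * b" using card_set_plus_left[OF ne, of "B"] BB by (simp add: b_def)
    then show ?thesis using b by simp
  qed
  have tri: "card (X + Z) \<le> c * d * b"
    if "card (X + uminus ` Y) \<le> c * b" "card (Y + Z) \<le> d * b" "card Y = card B" "c \<ge> 0"
    for X Y Z :: "'g set" and c d :: real
  proof -
    have "real (card (X + Z)) * b \<le> card (X + uminus ` Y) * real (card (Y + Z))"
      using ruzsa_triangle[of X Z Y] that(3) by (metis b_def of_nat_le_iff of_nat_mult)
    also have "\<dots> \<le> (c * b) * (d * b)" using that b by (intro mult_mono) auto
    finally show ?thesis using b by (simp add: mult_ac)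
  qed
  have neg: "card (X + Y + Z) = card (uminus ` Z + uminus ` Y + uminus ` X)" for X Y Z :: "'g set"
    by (metis card_uminus uminus_set_plus add.assoc)
  have MMM: "card (M + M + M) \<le> \<kappa> * b" using BBB neg[of M M M] by (simp add: uM)
  have MM: "card (M + M) \<le> \<kappa> * b"
    using card_set_plus_left[OF Mne, of "M + M"] MMM by linarith
  have BBM: "card (B + B + M) \<le> \<kappa> * \<kappa> * b"
    by (rule tri[of "B + B" M \<kappa> M \<kappa>]) (use BBB MM k1 cM in \<open>auto simp: uM\<close>)
  have MMB: "card (M + M + B) \<le> \<kappa> * \<kappa> * b"
    by (rule tri[of "M + M" B \<kappa> B \<kappa>]) (use MMM BB k1 in \<open>auto simp: uM\<close>)
  have MBB: "card (M + B + B) \<le> \<kappa> * \<kappa> * b" using MMB neg[of M B B] by (simp add: uM)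
  have BMM: "card (B + M + M) \<le> \<kappa> * \<kappa> * b" using BBM neg[of B M M] by (simp add: uM)
  have BMB: "card (B + M + B) \<le> \<kappa> * \<kappa> * \<kappa> * b"
    by (rule tri[of "B + M" B "\<kappa> * \<kappa>" B \<kappa>]) (use BMM BB k1 in \<open>auto simp: uM\<close>)
  have MBM: "card (M + B + M) \<le> \<kappa> * \<kappa> * \<kappa> * b"
    by (rule tri[of "M + B" M "\<kappa> * \<kappa>" M \<kappa>]) (use MBB MM k1 cM in \<open>auto simp: uM\<close>)
  have up: "\<kappa> * b \<le> \<kappa> ^ 3 * b" "\<kappa> * \<kappa> * b \<le> \<kappa> ^ 3 * b"
    using k1 b by (auto simp: power3_eq_cube mult_le_cancel_right1 mult_le_cancel_left1)
      (smt (verit) mult_left_mono mult_le_cancel_left1 mult_le_cancel_right1)+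
  have full: "card (X + Y + Z) \<le> \<kappa> ^ 3 * b" if "X \<in> {B, M}" "Y \<in> {B, M}" "Z \<in> {B, M}" for X Y Z
    using that BBB MMM BBM MMB MBB BMM BMB MBM up by (auto simp: power3_eq_cube)
  define Q where "Q = B \<union> M"
  have Qne: "Q \<noteq> {}" using ne by (auto simp: Q_def)
  have "Q + Q + Q = (\<Union>(X, Y, Z) \<in> {B, M} \<times> {B, M} \<times> {B, M}. X + Y + Z)"
    unfolding Q_def by (simp add: Un_set_plus set_plus_Un) blast
  then have "card (Q + Q + Q) \<le> (\<Sum>(X, Y, Z) \<in> {B, M} \<times> {B, M} \<times> {B, M}. card (X + Y + Z))"
    using card_UN_le[of "{B, M} \<times> {B, M} \<times> {B, M}" "\<lambda>(X, Y, Z). X + Y + Z"]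
    by (simp add: case_prod_unfold)
  then have "real (card (Q + Q + Q)) \<le> (\<Sum>(X, Y, Z) \<in> {B, M} \<times> {B, M} \<times> {B, M}. real (card (X + Y + Z)))"
    by (simp add: case_prod_unfold flip: of_nat_sum)
  also have "\<dots> \<le> (\<Sum>(X, Y, Z) \<in> {B, M} \<times> {B, M} \<times> {B, M}. \<kappa> ^ 3 * b)"
    using full by (intro sum_mono) auto
  also have "\<dots> = card ({B, M} \<times> {B, M} \<times> {B, M}) * (\<kappa> ^ 3 * b)" by simp
  also have "\<dots> \<le> 8 * (\<kappa> ^ 3 * b)"
  proof -
    have "card {B, M} \<le> 2" by (simp add: card_insert_if)
    then have "card {B, M} * (card {B, M} * card {B, M}) \<le> 2 * (2 * 2)" by (intro mult_le_mono)
    then have "card ({B, M} \<times> {B, M} \<times> {B, M}) \<le> 8" by (simp only: card_cartesian_product)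
    then show ?thesis using k1 b by (intro mult_right_mono) auto
  qed
  finally have Q3: "card (Q + Q + Q) \<le> 8 * (\<kappa> ^ 3 * b)" .
  have Q2: "card (Q + Q) \<le> card (Q + Q + Q)" "card Q \<le> card (Q + Q)" "1 \<le> card Q"
    using Qne by (auto intro!: card_set_plus_left simp: Suc_le_eq card_gt_0_iff)
  \<comment> \<open>Summands equal to 0 give shorter products. None of these four sets is larger
    than \<open>Q + Q + Q\<close>, so the constant is 4 * 8 = 32.\<close>
  have "set_pow S 3 \<subseteq> (Q + Q + Q) \<union> (Q + Q) \<union> Q \<union> {0}"
  proof
    fix x assume "x \<in> set_pow S 3"
    then obtain a c d where x: "x = a + c + d" "a \<in> S" "c \<in> S" "d \<in> S"
      by (auto simp: numeral_3_eq_3 set_plus_def add.assoc)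
    have S: "S = Q \<union> {0}" by (auto simp: S_def Q_def M_def)
    show "x \<in> (Q + Q + Q) \<union> (Q + Q) \<union> Q \<union> {0}"
      using x unfolding S by (cases "a = 0"; cases "c = 0"; cases "d = 0") auto
  qed
  then have "card (set_pow S 3) \<le> card (Q + Q + Q) + card (Q + Q) + card Q + card {0 :: 'g}"
    by (meson card_Un_le card_mono finite le_trans add_le_mono order_refl)
  then have "card (set_pow S 3) \<le> 4 * card (Q + Q + Q)" using Q2 by simp
  then show ?thesis using Q3 by (simp add: b_def)
qed

section \<open>Two by two matrices and SL2\<close>

datatype 'a m2 = M2 (e11: 'a) (e12: 'a) (e21: 'a) (e22: 'a)

lemma m2_eq_iff: "x = y \<longleftrightarrow> e11 x = e11 y \<and> e12 x = e12 y \<and> e21 x = e21 y \<and> e22 x = e22 y"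
  by (cases x; cases y) auto

instance m2 :: (finite) finite
proof
  have "(UNIV :: 'a m2 set) = (\<lambda>(a, b, c, d). M2 a b c d) ` UNIV"
    by (rule sym, rule surjI[of _ "\<lambda>x. (e11 x, e12 x, e21 x, e22 x)"]) simp
  then show "finite (UNIV :: 'a m2 set)" by (metis finite_imageI finite)
qed

lemma card_m2: "CARD('a m2) = CARD('a::finite) ^ 4"
proof -
  have "bij (\<lambda>(a :: 'a, b, c, d). M2 a b c d)"
    by (rule bijI, simp add: inj_def, rule surjI[of _ "\<lambda>x. (e11 x, e12 x, e21 x, e22 x)"]) simp
  then have "CARD('a m2) = CARD('a \<times> 'a \<times> 'a \<times> 'a)" by (rule bij_betw_same_card[symmetric])
  then show ?thesis by (simp add: power4_eq_xxxx mult.assoc)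
qed

instantiation m2 :: (comm_ring_1) ring_1
begin
definition "0 = M2 0 0 0 0"
definition "1 = M2 1 0 0 1"
definition "x + y = M2 (e11 x + e11 y) (e12 x + e12 y) (e21 x + e21 y) (e22 x + e22 y)"
definition "x - y = M2 (e11 x - e11 y) (e12 x - e12 y) (e21 x - e21 y) (e22 x - e22 y)"
definition "- x = M2 (- e11 x) (- e12 x) (- e21 x) (- e22 x)"
definition "x * y = M2 (e11 x * e11 y + e12 x * e21 y) (e11 x * e12 y + e12 x * e22 y)
                       (e21 x * e11 y + e22 x * e21 y) (e21 x * e12 y + e22 x * e22 y)"
instance
  by standard (auto simp: zero_m2_def one_m2_def plus_m2_def minus_m2_def uminus_m2_def times_m2_def
      m2_eq_iff algebra_simps)
end

lemma m2_entries [simp]: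
  "e11 (0 :: 'a::comm_ring_1 m2) = 0" "e12 (0 :: 'a m2) = 0" "e21 (0 :: 'a m2) = 0" "e22 (0 :: 'a m2) = 0"
  "e11 (1 :: 'a m2) = 1" "e12 (1 :: 'a m2) = 0" "e21 (1 :: 'a m2) = 0" "e22 (1 :: 'a m2) = 1"
  "e11 (x + y) = e11 x + e11 y" "e12 (x + y) = e12 x + e12 y"
  "e21 (x + y) = e21 x + e21 y" "e22 (x + y) = e22 x + e22 y"
  "e11 (x - y) = e11 x - e11 y" "e12 (x - y) = e12 x - e12 y"
  "e21 (x - y) = e21 x - e21 y" "e22 (x - y) = e22 x - e22 y"
  "e11 (- x) = - e11 x" "e12 (- x) = - e12 x" "e21 (- x) = - e21 x" "e22 (- x) = - e22 x"
  "e11 (x * y) = e11 x * e11 y + e12 x * e21 y" "e12 (x * y) = e11 x * e12 y + e12 x * e22 y"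
  "e21 (x * y) = e21 x * e11 y + e22 x * e21 y" "e22 (x * y) = e21 x * e12 y + e22 x * e22 y"
  for x y :: "'a::comm_ring_1 m2"
  by (auto simp: zero_m2_def one_m2_def plus_m2_def minus_m2_def uminus_m2_def times_m2_def)

definition smul :: "'a::comm_ring_1 \<Rightarrow> 'a m2 \<Rightarrow> 'a m2" where
  "smul c x = M2 (c * e11 x) (c * e12 x) (c * e21 x) (c * e22 x)"

definition det2 :: "'a::comm_ring_1 m2 \<Rightarrow> 'a" where
  "det2 x = e11 x * e22 x - e12 x * e21 x"

definition tr2 :: "'a::comm_ring_1 m2 \<Rightarrow> 'a" where
  "tr2 x = e11 x + e22 x"

text \<open>The adjugate is the inverse when the determinant is 1, yet it is linear in the matrix.
  This turns conditions on a quotient of group elements into linear ones.\<close>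

definition adj2 :: "'a::comm_ring_1 m2 \<Rightarrow> 'a m2" where
  "adj2 x = M2 (e22 x) (- e12 x) (- e21 x) (e11 x)"

lemma smul_entries [simp]:
  "e11 (smul c x) = c * e11 x" "e12 (smul c x) = c * e12 x"
  "e21 (smul c x) = c * e21 x" "e22 (smul c x) = c * e22 x"
  by (simp_all add: smul_def)

lemma adj2_entries [simp]:
  "e11 (adj2 x) = e22 x" "e12 (adj2 x) = - e12 x" "e21 (adj2 x) = - e21 x" "e22 (adj2 x) = e11 x"
  by (simp_all add: adj2_def)

lemma smul_mult [simp]: "smul c x * y = smul c (x * y)" "x * smul c y = smul c (x * y)"
  by (auto simp: m2_eq_iff algebra_simps)

lemma smul_add: "smul c (x + y) = smul c x + smul c y" "smul c (x - y) = smul c x - smul c y"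
  "smul (c + d) x = smul c x + smul d x" "smul (c - d) x = smul c x - smul d x"
  by (auto simp: m2_eq_iff algebra_simps)

lemma smul_smul [simp]: "smul c (smul d x) = smul (c * d) x" "smul 1 x = x" "smul 0 x = 0" "smul c 0 = 0"
  "smul (- 1) x = - x"
  by (auto simp: m2_eq_iff algebra_simps)

lemma det2_mult: "det2 (x * y) = det2 x * det2 y"
  by (simp add: det2_def algebra_simps)

lemma det2_one [simp]: "det2 1 = 1" "det2 0 = 0" "det2 (- x) = det2 x" "det2 (adj2 x) = det2 x"
  by (simp_all add: det2_def algebra_simps)

lemma adj2_mult: "adj2 (x * y) = adj2 y * adj2 x"
  by (simp add: m2_eq_iff algebra_simps)

lemma mult_adj2: "x * adj2 x = smul (det2 x) 1" "adj2 x * x = smul (det2 x) 1"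
  by (simp_all add: m2_eq_iff det2_def algebra_simps)

lemma adj2_conv: "adj2 x = smul (tr2 x) 1 - x"
  by (simp add: m2_eq_iff tr2_def)

lemma tr2_mult_comm: "tr2 (x * y) = tr2 (y * x)"
  by (simp add: tr2_def algebra_simps)

lemma tr2_linear: "tr2 (x + y) = tr2 x + tr2 y" "tr2 (x - y) = tr2 x - tr2 y" "tr2 (smul c x) = c * tr2 x"
  "tr2 (- x) = - tr2 x" "tr2 0 = 0" "tr2 1 = 2"
  by (simp_all add: tr2_def algebra_simps)

section \<open>The group SL2 and its order\<close>

typedef (overloaded) 'a sl2 = "{x :: 'a::comm_ring_1 m2. det2 x = 1}"
  morphisms mat Abs_sl2
  by (rule exI[of _ 1]) simp

instantiation sl2 :: (comm_ring_1) group_add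
begin
definition "0 = Abs_sl2 1"
definition "g + h = Abs_sl2 (mat g * mat h)"
definition "- g = Abs_sl2 (adj2 (mat g))"
definition "(g :: 'a sl2) - h = g + - h"

lemma det2_mat [simp]: "det2 (mat g) = 1"
  using mat[of g] by simp

lemma mat_simps [simp]: "mat 0 = 1" "mat (g + h) = mat g * mat h" "mat (- g) = adj2 (mat g)"
  by (simp_all add: zero_sl2_def plus_sl2_def uminus_sl2_def Abs_sl2_inverse det2_mult)

instance
proof
  fix a b c :: "'a sl2"
  show "a + b + c = a + (b + c)" "0 + a = a" "a + 0 = a" "- a + a = 0"
    by (simp_all add: mat_inject[symmetric] mult.assoc mult_adj2)
  show "a + - b = a - b" by (rule minus_sl2_def[symmetric])
qed
end

lemma mat_diff [simp]: "mat (g - h) = mat g * adj2 (mat h)"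
  by (simp only: minus_sl2_def mat_simps)

lemma mat_inv [simp]: "mat g * adj2 (mat g) = 1" "adj2 (mat g) * mat g = 1"
  by (simp_all add: mult_adj2)

lemma mat_inv_left [simp]: "mat g * (adj2 (mat g) * x) = x" "adj2 (mat g) * (mat g * x) = x"
  by (simp_all add: mult.assoc[symmetric])

lemma sl2_eq_iff: "g = h \<longleftrightarrow> mat g = mat h"
  by (simp add: mat_inject)

instance sl2 :: ("{finite, comm_ring_1}") finite
proof
  have "inj (mat :: 'a sl2 \<Rightarrow> _)" by (simp add: inj_def mat_inject)
  then show "finite (UNIV :: 'a sl2 set)" by (rule finite_imageD[rotated]) (rule finite)
qed

text \<open>Determinant 1 fixes \<open>e22\<close> if \<open>e11\<close> is nonzero, and
  \<open>e21\<close> otherwise. The Boolean records the case and accounts for the factor 2.\<close>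

lemma card_sl2_le: "CARD('a sl2) \<le> 2 * CARD('a::{finite,field}) ^ 3"
proof -
  define f :: "'a sl2 \<Rightarrow> 'a \<times> 'a \<times> 'a \<times> bool" where
    "f g = (let x = mat g in if e11 x = 0 then (0, e12 x, e22 x, True) else (e11 x, e12 x, e21 x, False))" for g
  have "inj f"
  proof (rule injI)
    fix g h assume f: "f g = f h"
    show "g = h"
    proof (cases "e11 (mat g) = 0")
      case True
      then have e: "e11 (mat h) = 0" "e12 (mat g) = e12 (mat h)" "e22 (mat g) = e22 (mat h)"
        using f by (auto simp: f_def Let_def split: if_splits)
      have "- (e12 (mat h) * e21 (mat g)) = 1" "- (e12 (mat h) * e21 (mat h)) = 1"
        using True e det2_mat[of g] det2_mat[of h] unfolding det2_def by simp_all
      then have "e12 (mat h) \<noteq> 0" "e12 (mat h) * e21 (mat g) = e12 (mat h) * e21 (mat h)"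
        by (force, metis minus_equation_iff)
      then have "e21 (mat g) = e21 (mat h)" using mult_left_cancel by blast
      then show ?thesis using True e by (simp add: sl2_eq_iff m2_eq_iff)
    next
      case False
      then have e: "e11 (mat h) = e11 (mat g)" "e12 (mat g) = e12 (mat h)" "e21 (mat g) = e21 (mat h)"
        using f by (auto simp: f_def Let_def split: if_splits)
      have "e11 (mat g) * e22 (mat g) = e11 (mat g) * e22 (mat h)"
        using e det2_mat[of g] det2_mat[of h] unfolding det2_def by (simp add: diff_eq_eq)
      then have "e22 (mat g) = e22 (mat h)" using mult_left_cancel[OF False] by blast
      then show ?thesis using e by (simp add: sl2_eq_iff m2_eq_iff)
    qed
  qed
  then have "CARD('a sl2) \<le> CARD('a \<times> 'a \<times> 'a \<times> bool)" by (rule card_inj_on_le) auto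
  then show ?thesis by (simp add: power3_eq_cube)
qed

lemma card_sl2_ge: "CARD('a sl2) \<ge> (CARD('a::{finite,field}) - 1) * CARD('a) ^ 2"
proof -
  define f :: "'a \<times> 'a \<times> 'a \<Rightarrow> 'a sl2" where
    "f = (\<lambda>(a, b, c). Abs_sl2 (M2 a b c ((1 + b * c) / a)))"
  have m: "mat (f (a, b, c)) = M2 a b c ((1 + b * c) / a)" if "a \<noteq> 0" for a b c
  proof -
    have "a * ((1 + b * c) / a) - b * c = 1" using that by (metis add_diff_cancel_right' nonzero_mult_div_cancel_left times_divide_eq_right)
    then have "M2 a b c ((1 + b * c) / a) \<in> {x. det2 x = 1}" by (simp only: mem_Collect_eq det2_def m2.sel)
    then show ?thesis unfolding f_def split by (rule Abs_sl2_inverse)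
  qed
  have "inj_on f ((UNIV - {0}) \<times> UNIV \<times> UNIV)"
  proof (rule inj_onI)
    fix x y assume xy: "x \<in> (UNIV - {0 :: 'a}) \<times> UNIV \<times> UNIV" "y \<in> (UNIV - {0 :: 'a}) \<times> UNIV \<times> UNIV" "f x = f y"
    obtain a b c a' b' c' where x: "x = (a, b, c)" "y = (a', b', c')" by (metis prod_cases3)
    have "a \<noteq> 0" "a' \<noteq> 0" using xy x by blast+
    then have "M2 a b c ((1 + b * c) / a) = M2 a' b' c' ((1 + b' * c') / a')" using m x xy(3) by metis
    then show "x = y" by (simp only: m2.inject x)
  qed
  then have "card ((UNIV - {0 :: 'a}) \<times> (UNIV :: 'a set) \<times> (UNIV :: 'a set)) \<le> CARD('a sl2)"
    by (rule card_inj_on_le) auto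
  moreover have "card (UNIV - {0 :: 'a}) = CARD('a) - 1" by (rule card_Diff_singleton) simp
  ultimately show ?thesis unfolding card_cartesian_product power2_eq_square by (simp only:)
qed

section \<open>Approximate subgroups of SL2 escape from subspaces and trace classes\<close>

definition subspace2 :: "'a::comm_ring_1 m2 set \<Rightarrow> bool" where
  "subspace2 W \<longleftrightarrow> 0 \<in> W \<and> (\<forall>x\<in>W. \<forall>y\<in>W. x + y \<in> W) \<and> (\<forall>c. \<forall>x\<in>W. smul c x \<in> W)"

definition subalgebra2 :: "'a::comm_ring_1 m2 set \<Rightarrow> bool" where
  "subalgebra2 R \<longleftrightarrow> subspace2 R \<and> 1 \<in> R \<and> (\<forall>x\<in>R. \<forall>y\<in>R. x * y \<in> R)"

lemma subspace2_diff: "subspace2 W \<Longrightarrow> x \<in> W \<Longrightarrow> y \<in> W \<Longrightarrow> x - y \<in> W"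
  unfolding subspace2_def by (metis smul_smul(5) diff_conv_add_uminus)

lemma subspace2_Int: "subspace2 W \<Longrightarrow> subspace2 W' \<Longrightarrow> subspace2 (W \<inter> W')"
  by (auto simp: subspace2_def)

lemma subalgebra2_Int: "subalgebra2 R \<Longrightarrow> subalgebra2 R' \<Longrightarrow> subalgebra2 (R \<inter> R')"
  by (auto simp: subalgebra2_def subspace2_Int)

text \<open>Cardinality stands in for dimension. With \<open>x\<close> in \<open>W\<close> but
  outside \<open>W'\<close>, the translates of \<open>W'\<close> by the multiples of
  \<open>x\<close> are disjoint.\<close>

lemma card_subspace2_psubset:
  fixes W W' :: "'a::{field,finite} m2 set"
  assumes "subspace2 W" "subspace2 W'" "W' \<subset> W"
  shows "CARD('a) * card W' \<le> card W"
proof -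
  obtain x where x: "x \<in> W" "x \<notin> W'" using assms(3) by auto
  have "inj_on (\<lambda>(c, w). smul c x + w) (UNIV \<times> W')"
  proof (rule inj_onI, clarify)
    fix c w d w' assume w: "w \<in> W'" "w' \<in> W'" and e: "smul c x + w = smul d x + w'"
    have "smul (c - d) x = w' - w" using e by (simp add: smul_add algebra_simps)
    then have "smul (c - d) x \<in> W'" using subspace2_diff[OF assms(2)] w by simp
    then have "smul (inverse (c - d)) (smul (c - d) x) \<in> W'" using assms(2) unfolding subspace2_def by blast
    then have "c = d" using x(2) by (cases "c = d") auto
    then show "c = d \<and> w = w'" using e by simp
  qed
  moreover have "(\<lambda>(c, w). smul c x + w) ` (UNIV \<times> W') \<subseteq> W"
    using assms x unfolding subspace2_def by auto
  ultimately have "card ((UNIV :: 'a set) \<times> W') \<le> card W" by (rule card_inj_on_le) simp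
  then show ?thesis by (simp add: card_cartesian_product)
qed

lemma card_field_ge_2: "CARD('a::{field,finite}) \<ge> 2"
proof -
  have "card {0, 1 :: 'a} \<le> CARD('a)" by (rule card_mono) auto
  then show ?thesis by simp
qed

lemma subspace2_UNIV: "subspace2 UNIV"
  by (simp add: subspace2_def)

text \<open>The left translate g W, written as a preimage under multiplication by the inverse of
  g.\<close>

definition lmul :: "'a::comm_ring_1 sl2 \<Rightarrow> 'a m2 set \<Rightarrow> 'a m2 set" where
  "lmul g W = {x. adj2 (mat g) * x \<in> W}"

lemma subspace2_lmul: "subspace2 W \<Longrightarrow> subspace2 (lmul g W)"
  by (auto simp: subspace2_def lmul_def distrib_left)

lemma lmul_lmul: "lmul g (lmul h W) = lmul (g + h) W"
  by (auto simp: lmul_def adj2_mult mult.assoc)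

lemma adj2_simps [simp]: "adj2 1 = 1" "adj2 (adj2 x) = x"
  by (simp_all add: m2_eq_iff)

lemma lmul_zero [simp]: "lmul 0 W = W"
  by (simp add: lmul_def)

lemma mat_mem_lmul: "mat (g + h) \<in> lmul g W \<longleftrightarrow> mat h \<in> W"
  by (simp add: lmul_def)

lemma popular_fiber:
  assumes "finite A" "A \<noteq> {}"
  obtains b where "b \<in> f ` A" "card A \<le> card {a\<in>A. f a = b} * card (f ` A)"
proof -
  define n where "n = Max ((\<lambda>b. card {a\<in>A. f a = b}) ` (f ` A))"
  have "n \<in> (\<lambda>b. card {a\<in>A. f a = b}) ` (f ` A)" unfolding n_def using assms by (intro Max_in) auto
  then obtain b where b: "b \<in> f ` A" "n = card {a\<in>A. f a = b}" by auto
  have "card A \<le> n * card (f ` A)"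
    using assms by (intro card_le_fibers[where f = f]) (auto simp: n_def)
  then show ?thesis using that b by blast
qed

lemma card_scalars: "card {g :: 'a::{field,finite} sl2. mat g \<in> range (\<lambda>c. smul c 1)} \<le> 2"
proof -
  have "{g :: 'a sl2. mat g \<in> range (\<lambda>c. smul c 1)} \<subseteq> {0, Abs_sl2 (- 1)}"
  proof
    fix g :: "'a sl2" assume "g \<in> {g. mat g \<in> range (\<lambda>c. smul c 1)}"
    then obtain c where c: "mat g = smul c 1" by blast
    then have "c * c = 1" using det2_mat[of g] by (simp add: det2_def)
    then have "c = 1 \<or> c = - 1" by (simp add: square_eq_1_iff)
    moreover have "mat (Abs_sl2 (- 1)) = (- 1 :: 'a m2)" by (simp add: Abs_sl2_inverse)
    ultimately show "g \<in> {0, Abs_sl2 (- 1)}" using c by (auto simp: sl2_eq_iff)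
  qed
  then have "card {g :: 'a sl2. mat g \<in> range (\<lambda>c. smul c 1)} \<le> card {0, Abs_sl2 (- 1 :: 'a m2)}"
    by (intro card_mono) auto
  also have "\<dots> \<le> 2" by (simp add: card_insert_if)
  finally show ?thesis .
qed

text \<open>Converts the outcome of \<open>overlapping_pair\<close>, for sets of size at least
  \<open>a / K ^ j\<close> inside a set of size at most \<open>K * a\<close>, into a density
  statement: the exponent \<open>j\<close> becomes \<open>2 * j + 1\<close>.\<close>

lemma overlap_bound:
  fixes a K c :: real
  assumes "a > 0" "K > 0" "(a / K ^ j)\<^sup>2 / (2 * (K * a)) \<le> c"
  shows "a \<le> 2 * K ^ (2 * j + 1) * c"
proof -
  have "a = 2 * K ^ (2 * j + 1) * ((a / K ^ j)\<^sup>2 / (2 * (K * a)))"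
  proof -
    have "K ^ (2 * j + 1) = K ^ j * K ^ j * K" by (simp add: power_add mult_2)
    moreover have "K ^ j > 0" using assms(2) by simp
    moreover have "a = 2 * (L * L * K) * ((a / L)\<^sup>2 / (2 * (K * a)))" if "L > 0" for L
      using that assms(1,2) by (simp add: power2_eq_square)
    ultimately show ?thesis by (simp only:)
  qed
  also have "\<dots> \<le> 2 * K ^ (2 * j + 1) * c" using assms by (intro mult_left_mono) auto
  finally show ?thesis .
qed

section \<open>Escape from subspaces, subalgebras and trace classes\<close>

text \<open>Ten factors are enough: the last descent of subspaces takes place in
  \<open>set_pow A 10\<close>, and the last one of subalgebras uses products of 4 + 1 + 4 + 1
  factors. \<open>K\<close> is at least 3 so that one power of it absorbs the numerical factor
  2.\<close>

locale approximate_subgroup =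
  fixes A :: "'a::{field,finite} sl2 set" and K :: real and t :: 'a and u v :: "'a sl2"
  assumes sym: "uminus ` A = A" and zero: "0 \<in> A"
    and K: "K \<ge> 3" and growth: "card (set_pow A 10) \<le> K * card A"
    and u: "u \<in> A" "mat u = M2 1 t 0 1" and v: "v \<in> A" "mat v = M2 1 0 t 1"
    and t: "t \<noteq> 0" "(2 :: 'a) \<noteq> 0"
begin

lemma card_A: "card A > 0"
  using zero by (auto simp: card_gt_0_iff)

lemma card_pow_le: "n \<le> 10 \<Longrightarrow> card (set_pow A n) \<le> K * card A"
  using growth card_mono[OF finite set_pow_mono_exp[OF zero, of n 10]] by simp

lemma uminus_mem: "g \<in> A \<Longrightarrow> - g \<in> A"
  using sym by blast

definition meet :: "nat \<Rightarrow> 'a m2 set \<Rightarrow> 'a sl2 set" where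
  "meet k W = {g \<in> set_pow A k. mat g \<in> W}"

text \<open>The two parameters record what a descent loses: \<open>j\<close> counts powers of
  \<open>K\<close> in the density, \<open>k\<close> the factors that elements of \<open>W\<close>
  may use.\<close>

definition heavy :: "nat \<Rightarrow> nat \<Rightarrow> 'a m2 set \<Rightarrow> bool" where
  "heavy j k W \<longleftrightarrow> card A \<le> K ^ j * card (meet k W)"

lemma heavy_mono:
  assumes "heavy j k W" "j \<le> j'" shows "heavy j' k W"
proof -
  have "K ^ j * card (meet k W) \<le> K ^ j' * card (meet k W)"
    using assms(2) K by (intro mult_right_mono power_increasing) auto
  then show ?thesis using assms(1) by (simp add: heavy_def)
qed

lemma heavy_meet_nonempty: "heavy j k W \<Longrightarrow> \<exists>g. g \<in> set_pow A k \<and> mat g \<in> W"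
  using card_A by (cases "meet k W = {}") (force simp: heavy_def, force simp: meet_def)

lemma heavyI:
  assumes "card A \<le> 2 * K ^ j * real c" "c \<le> card (meet k W)"
  shows "heavy (Suc j) k W"
proof -
  have "2 * K ^ j * real c \<le> K * K ^ j * real (card (meet k W))"
    using assms(2) K by (intro mult_mono) auto
  then show ?thesis using assms(1) by (simp add: heavy_def)
qed

text \<open>The alternatives are many or few distinct translates of \<open>W\<close> by
  \<open>A\<close>. Many cannot fit into \<open>set_pow A (Suc k)\<close> without two of them
  overlapping heavily, and moving the overlap back gives a heavy proper subspace of
  \<open>W\<close>. If there are few, some translate is shared by many elements, whose quotients
  multiply \<open>W\<close> into itself and so lie in its left stabilizer algebra.\<close>

lemma heavy_subspace_descends:
  assumes W: "subspace2 W" "W \<noteq> UNIV" and h: "heavy j k W" and k: "k \<le> 9"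
  shows "(\<exists>W'. subspace2 W' \<and> W' \<subset> W \<and> heavy (2 * j + 2) (k + 2) W') \<or>
         (\<exists>R. subalgebra2 R \<and> R \<noteq> UNIV \<and> heavy (j + 2) 2 R)"
proof -
  define a where "a = real (card A)"
  have a: "a > 0" using card_A by (simp add: a_def)
  have K0: "K > 0" using K by simp
  define I where "I = (\<lambda>g. lmul g W) ` A"
  define v' where "v' = a / K ^ j"
  have v': "v' > 0" using a K0 by (simp add: v'_def)
  show ?thesis
  proof (cases "card I * v' > 2 * (K * a)")
    case True
    have big: "v' \<le> card {h \<in> set_pow A (Suc k). mat h \<in> i}" if "i \<in> I" for i
    proof -
      obtain g where g: "g \<in> A" "i = lmul g W" using \<open>i \<in> I\<close> by (auto simp: I_def)
      have "(+) g ` meet k W \<subseteq> {h \<in> set_pow A (Suc k). mat h \<in> i}"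
        using g by (auto simp: meet_def mat_mem_lmul simp del: mat_simps)
      then have "card ((+) g ` meet k W) \<le> card {h \<in> set_pow A (Suc k). mat h \<in> i}"
        by (intro card_mono) auto
      then have "card (meet k W) \<le> card {h \<in> set_pow A (Suc k). mat h \<in> i}"
        by (simp add: card_image)
      moreover have "v' \<le> card (meet k W)"
        using h K0 by (simp add: heavy_def v'_def a_def divide_le_eq mult.commute)
      ultimately show ?thesis by linarith
    qed
    obtain i i' where ii: "i \<in> I" "i' \<in> I" "i \<noteq> i'"
      and c: "card ({h \<in> set_pow A (Suc k). mat h \<in> i} \<inter> {h \<in> set_pow A (Suc k). mat h \<in> i'}) \<ge> v'\<^sup>2 / (2 * (K * a))"
    proof (rule overlapping_pair[of I "set_pow A (Suc k)" "\<lambda>i. {h \<in> set_pow A (Suc k). mat h \<in> i}" v' "K * a"])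
      show "card (set_pow A (Suc k)) \<le> K * a" unfolding a_def using k by (intro card_pow_le) simp
    qed (use big True v' a K0 in auto)
    obtain g g' where g: "g \<in> A" "i = lmul g W" and g': "g' \<in> A" "i' = lmul g' W"
      using ii by (auto simp: I_def)
    define W' where "W' = W \<inter> lmul (- g + g') W"
    have lm: "lmul (- g) i = W" "lmul (- g) i' = lmul (- g + g') W"
      unfolding g g' lmul_lmul by simp_all
    have "(+) (- g) ` ({h \<in> set_pow A (Suc k). mat h \<in> i} \<inter> {h \<in> set_pow A (Suc k). mat h \<in> i'}) \<subseteq> meet (k + 2) W'"
    proof safe
      fix h assume h: "h \<in> set_pow A (Suc k)" "mat h \<in> i" "mat h \<in> i'"
      have "- g + h \<in> set_pow A (1 + Suc k)" using h(1) uminus_mem[OF g(1)] by (intro set_pow_addI) simp_all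
      moreover have "mat (- g + h) \<in> W" "mat (- g + h) \<in> lmul (- g + g') W"
        using h(2,3) mat_mem_lmul[of "- g" h i] mat_mem_lmul[of "- g" h i'] unfolding lm by blast+
      ultimately show "- g + h \<in> meet (k + 2) W'" by (simp add: meet_def W'_def del: set_pow.simps)
    qed
    then have "card ((+) (- g) ` ({h \<in> set_pow A (Suc k). mat h \<in> i} \<inter> {h \<in> set_pow A (Suc k). mat h \<in> i'})) \<le> card (meet (k + 2) W')"
      by (intro card_mono) auto
    then have c': "card ({h \<in> set_pow A (Suc k). mat h \<in> i} \<inter> {h \<in> set_pow A (Suc k). mat h \<in> i'}) \<le> card (meet (k + 2) W')"
      by (subst (asm) card_image) auto
    have "v'\<^sup>2 / (2 * (K * a)) \<le> card (meet (k + 2) W')" using c c' by linarith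
    then have "heavy (Suc (2 * j + 1)) (k + 2) W'"
      using overlap_bound[OF a K0, of j] by (intro heavyI[OF _ order_refl]) (simp add: v'_def a_def)
    moreover have "subspace2 W'" unfolding W'_def by (intro subspace2_Int subspace2_lmul W)
    moreover have "W' \<noteq> W"
    proof
      assume "W' = W"
      \<comment> \<open>A translate is no larger than \<open>W\<close>, so this inclusion is an
        equality and the two translates coincide.\<close>
      then have sub: "W \<subseteq> lmul (- g + g') W" by (auto simp: W'_def)
      have "(\<lambda>x. adj2 (mat (- g + g')) * x) ` lmul (- g + g') W \<subseteq> W" by (auto simp: lmul_def)
      moreover have "inj_on (\<lambda>x. adj2 (mat (- g + g')) * x) (lmul (- g + g') W)"
        by (rule inj_onI) (metis mat_inv_left(1))
      ultimately have "card (lmul (- g + g') W) \<le> card W" by (intro card_inj_on_le) auto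
      then have "W = lmul (- g + g') W" using sub by (intro card_seteq) auto
      then have "lmul g W = lmul g (lmul (- g + g') W)" by simp
      then have "i = i'" unfolding lmul_lmul g g' by (simp flip: add.assoc)
      then show False using ii by simp
    qed
    ultimately show ?thesis by (auto simp: W'_def)
  next
    case False
    obtain b where b: "b \<in> (\<lambda>g. lmul g W) ` A" "card A \<le> card {g\<in>A. lmul g W = b} * card I"
      unfolding I_def by (rule popular_fiber[of A "\<lambda>g. lmul g W"]) (use card_A in auto)
    obtain g0 where g0: "g0 \<in> A" "b = lmul g0 W" using b by auto
    define R where "R = {r. \<forall>w\<in>W. r * w \<in> W}"
    have alg: "subalgebra2 R"
      using W(1) by (auto simp: R_def subalgebra2_def subspace2_def distrib_right mult.assoc)
    have "R \<noteq> UNIV"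
    proof
      assume R: "R = UNIV"
      \<comment> \<open>A heavy space contains an invertible matrix; multiplied from the left by
        everything, it yields everything.\<close>
      obtain g where g: "mat g \<in> W" using heavy_meet_nonempty[OF h] by auto
      have "x \<in> W" for x
      proof -
        have "x * adj2 (mat g) \<in> R" using R by simp
        then have "x * adj2 (mat g) * mat g \<in> W" using g unfolding R_def by blast
        then show ?thesis by (simp add: mult.assoc)
      qed
      then show False using W(2) by auto
    qed
    moreover have "heavy (Suc (Suc j)) 2 R"
    proof (rule heavyI)
      have "(\<lambda>g. - g + g0) ` {g\<in>A. lmul g W = b} \<subseteq> meet 2 R"
      proof safe
        fix g assume g: "g \<in> A" "b = lmul g W"
        have "- g + g0 \<in> set_pow A (1 + 1)" using uminus_mem[OF g(1)] g0(1) by (intro set_pow_addI) simp_all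
        moreover have "mat (- g + g0) * w \<in> W" if "w \<in> W" for w
        proof -
          have "mat g0 * w \<in> lmul g0 W" using that by (simp add: lmul_def)
          then have "mat g0 * w \<in> lmul g W" using g g0 by simp
          then show ?thesis by (simp add: lmul_def mult.assoc)
        qed
        ultimately show "- g + g0 \<in> meet 2 R" by (simp add: meet_def R_def numeral_2_eq_2)
      qed
      then have "card ((\<lambda>g. - g + g0) ` {g\<in>A. lmul g W = b}) \<le> card (meet 2 R)" by (intro card_mono) auto
      then show "card {g\<in>A. lmul g W = b} \<le> card (meet 2 R)"
        by (subst (asm) card_image) (auto simp: inj_on_def)
      have I: "card I \<le> 2 * K ^ Suc j"
      proof -
        have "card I * a / K ^ j \<le> 2 * (K * a)" using False by (simp add: v'_def)
        then have "card I * a \<le> 2 * (K * a) * K ^ j" by (simp only: pos_divide_le_eq[OF zero_less_power[OF K0]])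
        then have "card I * a \<le> (2 * K ^ Suc j) * a" by (simp add: mult_ac)
        then show ?thesis using a by simp
      qed
      have "card A \<le> real (card {g\<in>A. lmul g W = b}) * card I" using of_nat_mono[OF b(2)] by simp
      also have "\<dots> \<le> real (card {g\<in>A. lmul g W = b}) * (2 * K ^ Suc j)" using I by (intro mult_left_mono) auto
      finally show "card A \<le> 2 * K ^ Suc j * real (card {g\<in>A. lmul g W = b})" by (simp add: mult_ac)
    qed
    ultimately show ?thesis using alg by auto
  qed
qed

text \<open>Conjugating by u twice isolates the lower left entry, by v the upper right one.\<close>

lemma normalized_subalgebra:
  assumes R: "subalgebra2 R"
    and nu: "\<And>x. x \<in> R \<Longrightarrow> adj2 (mat u) * x * mat u \<in> R" and nv: "\<And>x. x \<in> R \<Longrightarrow> adj2 (mat v) * x * mat v \<in> R"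
  shows "R = UNIV \<or> R \<subseteq> range (\<lambda>c. smul c 1)"
proof -
  have sub: "subspace2 R" and one: "1 \<in> R" and mul: "\<And>x y. x \<in> R \<Longrightarrow> y \<in> R \<Longrightarrow> x * y \<in> R"
    using R by (auto simp: subalgebra2_def)
  have sm: "smul c x \<in> R" if "x \<in> R" for c x using sub that by (auto simp: subspace2_def)
  have ad: "x + y \<in> R" if "x \<in> R" "y \<in> R" for x y using sub that by (auto simp: subspace2_def)
  define E F where "E = M2 0 (1 :: 'a) 0 0" and "F = M2 0 0 (1 :: 'a) 0"
  have du: "adj2 (mat u) * x * mat u - x
      = M2 (- t * e21 x) (t * (e11 x - e22 x) - t * t * e21 x) 0 (t * e21 x)" for x
    by (simp add: m2_eq_iff u algebra_simps)
  have dv: "adj2 (mat v) * x * mat v - x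
      = M2 (t * e12 x) 0 (t * (e22 x - e11 x) - t * t * e12 x) (- t * e12 x)" for x
    by (simp add: m2_eq_iff v algebra_simps)
  have du_mem: "M2 (- t * e21 x) (t * (e11 x - e22 x) - t * t * e21 x) 0 (t * e21 x) \<in> R" if "x \<in> R" for x
    using subspace2_diff[OF sub nu[OF that] that] unfolding du .
  have dv_mem: "M2 (t * e12 x) 0 (t * (e22 x - e11 x) - t * t * e12 x) (- t * e12 x) \<in> R" if "x \<in> R" for x
    using subspace2_diff[OF sub nv[OF that] that] unfolding dv .
  have E: "E \<in> R" if x: "x \<in> R" "e21 x \<noteq> 0" for x
  proof -
    \<comment> \<open>The second difference is a multiple of \<open>E\<close>; its factor 2 is where
      odd characteristic enters.\<close>
    have "M2 0 (- (2 * t * t * e21 x)) 0 0 \<in> R"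
      using du_mem[OF du_mem[OF x(1)]] by (simp add: algebra_simps)
    then have "smul (inverse (- (2 * t * t * e21 x))) (M2 0 (- (2 * t * t * e21 x)) 0 0) \<in> R" by (rule sm)
    moreover have "- (2 * t * t * e21 x) \<noteq> 0" using t x(2) by simp
    ultimately show ?thesis by (simp only: smul_def E_def m2.sel mult_zero_right left_inverse not_False_eq_True)
  qed
  have F: "F \<in> R" if x: "x \<in> R" "e12 x \<noteq> 0" for x
  proof -
    have "M2 0 0 (- (2 * t * t * e12 x)) 0 \<in> R"
      using dv_mem[OF dv_mem[OF x(1)]] by (simp add: algebra_simps)
    then have "smul (inverse (- (2 * t * t * e12 x))) (M2 0 0 (- (2 * t * t * e12 x)) 0) \<in> R" by (rule sm)
    moreover have "- (2 * t * t * e12 x) \<noteq> 0" using t x(2) by simp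
    ultimately show ?thesis by (simp only: smul_def F_def m2.sel mult_zero_right left_inverse not_False_eq_True)
  qed
  have univ: "R = UNIV" if EF: "E \<in> R" "F \<in> R"
  proof -
    have "x \<in> R" for x
    proof -
      have "smul (e11 x) (E * F) + smul (e12 x) E + smul (e21 x) F + smul (e22 x) (F * E) \<in> R"
        using EF by (intro ad sm mul)
      moreover have "smul (e11 x) (E * F) + smul (e12 x) E + smul (e21 x) F + smul (e22 x) (F * E) = x"
        by (simp add: m2_eq_iff E_def F_def)
      ultimately show ?thesis by simp
    qed
    then show ?thesis by auto
  qed
  have EF: "E \<in> R \<longleftrightarrow> F \<in> R" using E[of F] F[of E] by (auto simp: E_def F_def)
  show ?thesis
  proof (cases "E \<in> R")
    case True
    then show ?thesis using univ EF by auto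
  next
    case False
    have "x \<in> range (\<lambda>c. smul c 1)" if x: "x \<in> R" for x
    proof -
      have z: "e12 x = 0" "e21 x = 0" using E F EF False x by blast+
      have "smul (inverse (t * (e11 x - e22 x))) (M2 0 (t * (e11 x - e22 x)) 0 0) \<in> R"
        using du_mem[OF x] z by (intro sm) simp
      then have "t * (e11 x - e22 x) = 0"
        using False left_inverse[of "t * (e11 x - e22 x)"] unfolding smul_def E_def m2.sel mult_zero_right
        by metis
      then have "x = smul (e11 x) 1" using t z by (simp add: m2_eq_iff)
      then show ?thesis by auto
    qed
    then show ?thesis by auto
  qed
qed

text \<open>One of the two unipotents, \<open>h\<close>, moves \<open>R\<close>, and
  \<open>R'\<close> is the intersection of \<open>R\<close> with its conjugate by \<open>h\<close>.
  The map from (x, y) to x h y h^-1 on pairs from the part of A^k in \<open>R\<close> has at most K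
  |A| values, while two pairs with the same value satisfy x0^-1 x = h y0 y^-1 h^-1, an element of
  \<open>R'\<close>. So large fibers make \<open>R'\<close> heavy.\<close>

lemma heavy_subalgebra_descends:
  assumes R: "subalgebra2 R" "R \<noteq> UNIV" "\<not> R \<subseteq> range (\<lambda>c. smul c 1)"
    and hv: "heavy j k R" and k: "k \<le> 4"
  shows "\<exists>R'. subalgebra2 R' \<and> R' \<subset> R \<and> heavy (2 * j + 1) (2 * k) R'"
proof -
  obtain h where h: "h \<in> A" "\<exists>x\<in>R. adj2 (mat h) * x * mat h \<notin> R"
    using normalized_subalgebra[OF R(1)] R(2,3) u(1) v(1) by metis
  define R' where "R' = R \<inter> {x. adj2 (mat h) * x * mat h \<in> R}"
  have "subalgebra2 {x. adj2 (mat h) * x * mat h \<in> R}"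
  proof -
    have "adj2 (mat h) * (x * y) * mat h = (adj2 (mat h) * x * mat h) * (adj2 (mat h) * y * mat h)" for x y
      by (simp add: mult.assoc)
    then show ?thesis using R(1)
      by (auto simp: subalgebra2_def subspace2_def distrib_left distrib_right)
  qed
  then have alg: "subalgebra2 R'" unfolding R'_def by (intro subalgebra2_Int R(1))
  have ss: "R' \<subset> R" using h(2) by (auto simp: R'_def)
  have inv: "adj2 x \<in> R" if "x \<in> R" for x
    unfolding adj2_conv using R(1) that by (intro subspace2_diff) (auto simp: subalgebra2_def subspace2_def)
  have mul: "x * y \<in> R" if "x \<in> R" "y \<in> R" for x y using R(1) that by (auto simp: subalgebra2_def)
  define P where "P = meet k R"
  define f where "f = (\<lambda>(x, y). x + (h + y + - h))"
  have "card (P \<times> P) \<le> card (meet (2 * k) R') * card (set_pow A 10)"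
  proof (rule card_le_fibers)
    show "f ` (P \<times> P) \<subseteq> set_pow A 10"
    proof safe
      fix x y assume "x \<in> P" "y \<in> P"
      then have "x + (h + y + - h) \<in> set_pow A (k + (1 + k + 1))"
        using h(1) uminus_mem[OF h(1)] unfolding P_def meet_def
        by (intro set_pow_addI) (simp_all del: add_uminus_conv_diff)
      then show "f (x, y) \<in> set_pow A 10"
        using set_pow_mono_exp[OF zero, of "k + (1 + k + 1)" 10] k by (auto simp: f_def)
    qed
  next
    fix z
    show "card {p \<in> P \<times> P. f p = z} \<le> card (meet (2 * k) R')"
    proof (cases "{p \<in> P \<times> P. f p = z} = {}")
      case False
      then obtain x0 y0 where p0: "x0 \<in> P" "y0 \<in> P" "f (x0, y0) = z" by blast
      have "inj_on (\<lambda>(x, y). - x0 + x) {p \<in> P \<times> P. f p = z}"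
        by (rule inj_onI) (auto simp: f_def, metis add_left_cancel diff_add_cancel)
      moreover have "(\<lambda>(x, y). - x0 + x) ` {p \<in> P \<times> P. f p = z} \<subseteq> meet (2 * k) R'"
      proof safe
        fix x y assume p: "x \<in> P" "y \<in> P" "z = f (x, y)"
        have e: "- x0 + x = h + (y0 + - y) + - h"
        proof -
          have "x + (h + y + - h) = x0 + (h + y0 + - h)" using p p0 by (simp add: f_def)
          then have "- x0 + (x + (h + y + - h)) + (h + - y + - h) = - x0 + (x0 + (h + y0 + - h)) + (h + - y + - h)" by simp
          then show ?thesis by (simp add: add.assoc del: add_uminus_conv_diff)
        qed
        have "mat (- x0 + x) \<in> R" using p(1) p0(1) inv mul by (simp add: P_def meet_def)
        moreover have "adj2 (mat h) * mat (- x0 + x) * mat h = mat y0 * adj2 (mat y)"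
          unfolding e by (simp add: mult.assoc)
        then have "adj2 (mat h) * mat (- x0 + x) * mat h \<in> R"
          using p(2) p0(2) inv mul by (simp add: P_def meet_def)
        moreover have "- x0 + x \<in> set_pow A (k + k)"
          using p(1) p0(1) set_pow_uminus[OF sym] by (intro set_pow_addI) (auto simp: P_def meet_def)
        ultimately show "- x0 + x \<in> meet (2 * k) R'" by (simp add: meet_def R'_def mult_2)
      qed
      ultimately show ?thesis by (rule card_inj_on_le) simp
    next
      case True
      then show ?thesis by (simp only: card.empty)
    qed
  qed simp_all
  then have "real (card P * card P) \<le> real (card (meet (2 * k) R')) * card (set_pow A 10)"
    unfolding card_cartesian_product by (metis of_nat_le_iff of_nat_mult)
  also have "\<dots> \<le> real (card (meet (2 * k) R')) * (K * card A)"
    using growth by (intro mult_left_mono) auto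
  finally have PP: "real (card P) * card P \<le> real (card (meet (2 * k) R')) * (K * card A)" by simp
  have "real (card A) * card A \<le> (K ^ j * card P) * (K ^ j * card P)"
    using hv K by (intro mult_mono) (auto simp: heavy_def P_def)
  also have "\<dots> = K ^ (2 * j) * (real (card P) * card P)" by (simp add: power_add mult_2)
  also have "\<dots> \<le> K ^ (2 * j) * (real (card (meet (2 * k) R')) * (K * card A))"
    using K by (intro mult_left_mono PP) auto
  finally have "real (card A) * card A \<le> (K ^ (2 * j + 1) * card (meet (2 * k) R')) * card A"
    by (simp add: mult_ac)
  then have "heavy (2 * j + 1) (2 * k) R'" using card_A by (simp add: heavy_def)
  then show ?thesis using alg ss by blast
qed

lemma heavy_scalars:
  assumes "heavy j k R" "R \<subseteq> range (\<lambda>c. smul c 1)"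
  shows "card A \<le> 2 * K ^ j"
proof -
  have "card (meet k R) \<le> card {g :: 'a sl2. mat g \<in> range (\<lambda>c. smul c 1)}"
    using assms(2) by (intro card_mono) (auto simp: meet_def)
  also have "\<dots> \<le> 2" by (rule card_scalars)
  finally have "K ^ j * card (meet k R) \<le> K ^ j * 2" using K by (intro mult_left_mono) auto
  then show ?thesis using assms(1) by (simp add: heavy_def)
qed

text \<open>A descent turns the exponent j into 2 j + 1 for subalgebras (32, 65, 131) and into 2 j + 2
  for subspaces (6, 14, 30, 62); three descents exhaust the four dimensions of the matrix algebra.\<close>

lemma heavy_proper_subalgebra:
  assumes R: "subalgebra2 R" "R \<noteq> UNIV" and hv: "heavy 32 2 R"
  shows "card A \<le> 2 * K ^ 131"
proof -
  have p2: "CARD('a) \<ge> 2" by (rule card_field_ge_2)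
  have mono: "2 * K ^ j \<le> 2 * K ^ 131" if "j \<le> 131" for j
    using K that by (intro mult_left_mono power_increasing) auto
  have fin: ?thesis if "heavy j k S" "S \<subseteq> range (\<lambda>c. smul c 1)" "j \<le> 131" for j k S
    using heavy_scalars[OF that(1,2)] mono[OF that(3)] by linarith
  define p where "p = CARD('a)"
  have p: "p \<ge> 2" using p2 by (simp add: p_def)
  have "p * card R \<le> p ^ 4"
    using card_subspace2_psubset[OF subspace2_UNIV, of R] R card_m2[where 'a = 'a]
    by (auto simp: subalgebra2_def p_def)
  then have R3: "card R \<le> p ^ 3" using p by (simp add: eval_nat_numeral)
  show ?thesis
  proof (cases "R \<subseteq> range (\<lambda>c. smul c 1)")
    case True
    then show ?thesis by (rule fin[OF hv]) simp
  next
    case False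
    obtain R1 where R1: "subalgebra2 R1" "R1 \<subset> R" "heavy 65 4 R1"
      using heavy_subalgebra_descends[OF R False hv] by auto
    have "p * card R1 \<le> card R"
      using card_subspace2_psubset[of R R1] R R1 by (auto simp: subalgebra2_def p_def)
    then have "p * card R1 \<le> p ^ 3" using R3 by linarith
    then have R12: "card R1 \<le> p ^ 2" using p by (simp add: eval_nat_numeral)
    show ?thesis
    proof (cases "R1 \<subseteq> range (\<lambda>c. smul c 1)")
      case True
      then show ?thesis by (rule fin[OF R1(3)]) simp
    next
      case False
      have "R1 \<noteq> UNIV" using R1(2) by auto
      then obtain R2 where R2: "subalgebra2 R2" "R2 \<subset> R1" "heavy 131 8 R2"
        using heavy_subalgebra_descends[OF R1(1) _ False R1(3)] by auto
      have "p * card R2 \<le> card R1"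
        using card_subspace2_psubset[of R1 R2] R1 R2 by (auto simp: subalgebra2_def p_def)
      then have "p * card R2 \<le> p ^ 2" using R12 by linarith
      then have "card R2 \<le> p" using p by (simp add: eval_nat_numeral)
      \<comment> \<open>Every subalgebra contains the scalars, so two strict descents from dimension
        at most 3 leave nothing else.\<close>
      moreover have "range (\<lambda>c. smul c 1) \<subseteq> R2" using R2(1) by (auto simp: subalgebra2_def subspace2_def)
      moreover have "card (range (\<lambda>c :: 'a. smul c 1)) = p"
        unfolding p_def by (rule card_image) (auto simp: inj_def m2_eq_iff)
      ultimately have "R2 \<subseteq> range (\<lambda>c. smul c 1)" using card_seteq[of R2 "range (\<lambda>c :: 'a. smul c 1)"] by auto
      then show ?thesis by (rule fin[OF R2(3)]) simp
    qed
  qed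
qed

lemma heavy_proper_subspace:
  assumes W: "subspace2 W" "W \<noteq> UNIV" and hv: "heavy 6 5 W"
  shows "card A \<le> 2 * K ^ 131"
proof -
  have p2: "CARD('a) \<ge> 2" by (rule card_field_ge_2)
  define p where "p = CARD('a)"
  have p: "p \<ge> 2" using p2 by (simp add: p_def)
  have alg: ?thesis if "subalgebra2 R" "R \<noteq> UNIV" "heavy j 2 R" "j \<le> 32" for R j
    using heavy_proper_subalgebra[OF that(1,2) heavy_mono[OF that(3,4)]] .
  have drop: "card W2 \<le> p ^ n" if "subspace2 W1" "subspace2 W2" "W2 \<subset> W1" "card W1 \<le> p ^ Suc n" for W1 W2 :: "'a m2 set" and n
  proof -
    have "p * card W2 \<le> p * p ^ n" using order.trans[OF card_subspace2_psubset[OF that(1-3)] that(4)] by (simp only: p_def power_Suc)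
    then show ?thesis using p by simp
  qed
  have c0: "card W \<le> p ^ 3"
    using drop[OF subspace2_UNIV W(1), of 3] W(2) card_m2[where 'a = 'a] by (auto simp: p_def)
  show ?thesis
  proof (rule ccontr)
    assume no: "\<not> ?thesis"
    \<comment> \<open>In the three descents the other alternative is a heavy stabilizer algebra with
      exponent 8, 16 or 32. The last of these is why \<open>heavy_proper_subalgebra\<close> starts
      at 32.\<close>
    obtain W1 where W1: "subspace2 W1" "W1 \<subset> W" "heavy 14 7 W1"
      using heavy_subspace_descends[OF W hv] alg[of _ 8] no by auto
    obtain W2 where W2: "subspace2 W2" "W2 \<subset> W1" "heavy 30 9 W2"
      using heavy_subspace_descends[OF W1(1) _ W1(3)] W1(2) alg[of _ 16] no by auto
    obtain W3 where W3: "subspace2 W3" "W3 \<subset> W2" "heavy 62 11 W3"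
      using heavy_subspace_descends[OF W2(1) _ W2(3)] W2(2) alg[of _ 32] no by auto
    have "card W1 \<le> p ^ 2" using drop[OF W(1) W1(1,2), of 2] c0 by simp
    then have "card W2 \<le> p ^ 1" using drop[OF W1(1) W2(1,2), of 1] by (simp add: numeral_2_eq_2)
    \<comment> \<open>Only the zero matrix is left, although a heavy space contains a matrix of
      determinant 1.\<close>
    then have "card W3 \<le> 1" using drop[OF W2(1) W3(1,2), of 0] by simp
    moreover obtain g where "mat g \<in> W3" using heavy_meet_nonempty[OF W3(3)] by auto
    moreover have "0 \<in> W3" using W3(1) by (simp add: subspace2_def)
    ultimately have "mat g = 0" using card_le_Suc0_iff_eq[of W3] by auto
    then show False using det2_mat[of g] by simp
  qed
qed

text \<open>A trace class is given by an affine condition, not by a linear one. If it were dense,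
  two of its translates by elements of \<open>A\<close> would overlap heavily, and the difference of
  their conditions is linear: the overlap lies in the hyperplane \<open>W\<close>. Four factors are
  what the conjugates a y a^-1 with y in A^2 need.\<close>

lemma trace_class_small:
  assumes big: "2 * K ^ 131 < card A"
  shows "K\<^sup>2 * card {g \<in> set_pow A 4. tr2 (mat g) = \<tau>} < card A"
proof (rule ccontr)
  assume "\<not> ?thesis"
  then have hv: "card A \<le> K\<^sup>2 * card {g \<in> set_pow A 4. tr2 (mat g) = \<tau>}" by simp
  define a where "a = real (card A)"
  have a: "a > 0" using card_A by (simp add: a_def)
  have K0: "K > 0" using K by simp
  define V where "V g = {h \<in> set_pow A 5. tr2 (mat (- g + h)) = \<tau>}" for g
  have big': "a / K\<^sup>2 \<le> card (V g)" if g: "g \<in> A" for g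
  proof -
    have "(+) g ` {g \<in> set_pow A 4. tr2 (mat g) = \<tau>} \<subseteq> V g"
    proof safe
      fix h assume h: "h \<in> set_pow A 4" "\<tau> = tr2 (mat h)"
      have "g + h \<in> set_pow A (1 + 4)" using h(1) g by (intro set_pow_addI) simp_all
      then show "g + h \<in> V g" by (simp add: V_def h(2))
    qed
    then have "card ((+) g ` {g \<in> set_pow A 4. tr2 (mat g) = \<tau>}) \<le> card (V g)" by (intro card_mono) auto
    then have "card {g \<in> set_pow A 4. tr2 (mat g) = \<tau>} \<le> card (V g)" by (simp add: card_image)
    moreover have "a / K\<^sup>2 \<le> card {g \<in> set_pow A 4. tr2 (mat g) = \<tau>}"
      using hv K0 by (simp add: a_def divide_le_eq mult.commute)
    ultimately show ?thesis by linarith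
  qed
  obtain g g' where g: "g \<in> A" "g' \<in> A" "g \<noteq> g'" "card (V g \<inter> V g') \<ge> (a / K\<^sup>2)\<^sup>2 / (2 * (K * a))"
  proof (rule overlapping_pair[of A "set_pow A 5" V "a / K\<^sup>2" "K * a"])
    show "card (set_pow A 5) \<le> K * a" unfolding a_def by (rule card_pow_le) simp
    have "2 * K ^ 3 \<le> 2 * K ^ 131" using K by (intro mult_left_mono power_increasing) auto
    then have "a > 2 * K ^ 3" using big by (simp add: a_def)
    then have "a * a > (2 * K ^ 3) * a" using a by simp
    then show "card A * (a / K\<^sup>2) > 2 * (K * a)"
      using K0 by (simp add: a_def[symmetric] less_divide_eq power2_eq_square power3_eq_cube mult_ac)
  qed (use big' a K0 in \<open>auto simp: V_def\<close>)
  define m where "m = adj2 (mat g) - adj2 (mat g')"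
  define W where "W = {x. tr2 (m * x) = 0}"
  have "m \<noteq> 0"
  proof
    assume "m = 0"
    then have "adj2 (adj2 (mat g)) = adj2 (adj2 (mat g'))" by (simp add: m_def)
    then show False using g(3) by (simp add: sl2_eq_iff)
  qed
  have "W \<noteq> UNIV"
  proof
    assume "W = UNIV"
    then have z: "tr2 (m * x) = 0" for x by (auto simp: W_def)
    have "m = 0"
      using z[of "M2 1 0 0 0"] z[of "M2 0 1 0 0"] z[of "M2 0 0 1 0"] z[of "M2 0 0 0 1"]
      by (simp add: tr2_def m2_eq_iff)
    then show False using \<open>m \<noteq> 0\<close> by simp
  qed
  moreover have "subspace2 W" by (auto simp: W_def subspace2_def distrib_left tr2_linear)
  moreover have "heavy (Suc 5) 5 W"
  proof (rule heavyI)
    show "card (V g \<inter> V g') \<le> card (meet 5 W)"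
      by (intro card_mono) (auto simp: V_def meet_def W_def m_def left_diff_distrib tr2_linear)
    show "real (card A) \<le> 2 * K ^ 5 * card (V g \<inter> V g')"
      using g(4) overlap_bound[OF a K0, of 2] by (simp add: a_def)
  qed
  ultimately have "card A \<le> 2 * K ^ 131" using heavy_proper_subspace[of W] by simp
  then show False using big by linarith
qed

end

section \<open>Centralizers and growth\<close>

definition nonscalar :: "'a::comm_ring_1 m2 \<Rightarrow> bool" where
  "nonscalar x \<longleftrightarrow> e12 x \<noteq> 0 \<or> e21 x \<noteq> 0 \<or> e11 x \<noteq> e22 x"

lemma scalar_iff: "\<not> nonscalar x \<longleftrightarrow> (\<exists>c. x = smul c 1)"
  by (auto simp: nonscalar_def m2_eq_iff)

lemma card_not_nonscalar: "card {g :: 'a::{field,finite} sl2. \<not> nonscalar (mat g)} \<le> 2"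
proof -
  have "{g :: 'a sl2. \<not> nonscalar (mat g)} = {g. mat g \<in> range (\<lambda>c. smul c 1)}"
    by (auto simp: scalar_iff)
  then show ?thesis using card_scalars[where 'a = 'a] by simp
qed

lemma nonscalar_conj: "nonscalar (adj2 (mat g) * x * mat g) \<longleftrightarrow> nonscalar x"
proof -
  have "\<not> nonscalar (adj2 (mat h) * x * mat h)" if sc: "\<not> nonscalar x" for h :: "'a sl2" and x
  proof -
    obtain c where "x = smul c 1" using sc scalar_iff by blast
    then have "adj2 (mat h) * x * mat h = smul c 1" by simp
    then show ?thesis using scalar_iff by blast
  qed
  from this[of x g] this[of "adj2 (mat g) * x * mat g" "- g"] show ?thesis by (auto simp: mult.assoc)
qed

text \<open>The vector of \<open>e12\<close>, \<open>e21\<close> and \<open>e11 - e22\<close>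
  forgets scalar matrices. The equations \<open>e\<close> say that the cross product of the vectors
  of \<open>x\<close> and \<open>y\<close> vanishes, so these vectors are proportional.\<close>

lemma commuting_combination:
  fixes x y :: "'a::field m2"
  assumes "nonscalar x" "x * y = y * x"
  obtains \<alpha> \<beta> where "y = smul \<alpha> 1 + smul \<beta> x"
proof -
  have e: "e12 x * e21 y = e12 y * e21 x" "(e11 x - e22 x) * e12 y = (e11 y - e22 y) * e12 x"
    "(e11 x - e22 x) * e21 y = (e11 y - e22 y) * e21 x"
  proof -
    have "e11 (x * y) = e11 (y * x)" "e12 (x * y) = e12 (y * x)" "e21 (x * y) = e21 (y * x)"
      by (simp_all only: assms(2))
    then have "e11 x * e11 y + e12 x * e21 y = e11 y * e11 x + e12 y * e21 x"
      "e11 x * e12 y + e12 x * e22 y = e11 y * e12 x + e12 y * e22 x"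
      "e21 x * e11 y + e22 x * e21 y = e21 y * e11 x + e22 y * e21 x"
      by (simp_all only: m2_entries)
    then show "e12 x * e21 y = e12 y * e21 x" "(e11 x - e22 x) * e12 y = (e11 y - e22 y) * e12 x"
      "(e11 x - e22 x) * e21 y = (e11 y - e22 y) * e21 x" by algebra+
  qed
  have main: "\<exists>\<beta>. e12 y = \<beta> * e12 x \<and> e21 y = \<beta> * e21 x \<and> e11 y - e22 y = \<beta> * (e11 x - e22 x)"
  proof -
    consider "e12 x \<noteq> 0" | "e21 x \<noteq> 0" | "e11 x - e22 x \<noteq> 0" using assms(1) by (auto simp: nonscalar_def)
    then show ?thesis
    proof cases
      case 1
      define \<beta> where "\<beta> = e12 y / e12 x"
      have "e12 y = \<beta> * e12 x" using 1 by (simp add: \<beta>_def)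
      moreover from this have "e21 y = \<beta> * e21 x" "e11 y - e22 y = \<beta> * (e11 x - e22 x)" using e 1 by algebra+
      ultimately show ?thesis by blast
    next
      case 2
      define \<beta> where "\<beta> = e21 y / e21 x"
      have "e21 y = \<beta> * e21 x" using 2 by (simp add: \<beta>_def)
      moreover from this have "e12 y = \<beta> * e12 x" "e11 y - e22 y = \<beta> * (e11 x - e22 x)" using e 2 by algebra+
      ultimately show ?thesis by blast
    next
      case 3
      define \<beta> where "\<beta> = (e11 y - e22 y) / (e11 x - e22 x)"
      have "e11 y - e22 y = \<beta> * (e11 x - e22 x)" using 3 by (simp add: \<beta>_def)
      moreover from this have "e12 y = \<beta> * e12 x" "e21 y = \<beta> * e21 x" using e 3 by algebra+
      ultimately show ?thesis by blast
    qed
  qed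
  then obtain \<beta> where b: "e12 y = \<beta> * e12 x" "e21 y = \<beta> * e21 x" "e11 y - e22 y = \<beta> * (e11 x - e22 x)" by blast
  have "e22 y = e11 y - \<beta> * (e11 x - e22 x)" using b(3) by (simp add: algebra_simps)
  then have "y = smul (e11 y - \<beta> * e11 x) 1 + smul \<beta> x" using b by (simp add: m2_eq_iff algebra_simps)
  then show ?thesis by (rule that)
qed

lemma tr2_conj: "tr2 (adj2 (mat g) * x * mat g) = tr2 x"
  by (subst tr2_mult_comm) simp

definition centralizer :: "'a::comm_ring_1 sl2 \<Rightarrow> 'a sl2 set" where
  "centralizer x = {y. mat x * mat y = mat y * mat x}"

text \<open>Commuting is transitive through a nonscalar element, since everything that commutes with
  it is a combination of it and 1. So two different centralizers of nonscalar elements share only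
  scalars.\<close>

lemma centralizer_eq:
  fixes x y :: "'a::field sl2"
  assumes "nonscalar (mat x)" "nonscalar (mat y)" "y \<in> centralizer x"
  shows "centralizer y = centralizer x"
proof -
  have sub: "centralizer y \<subseteq> centralizer x" if y: "nonscalar (mat y)" "y \<in> centralizer x" for x y :: "'a sl2"
  proof
    fix z assume "z \<in> centralizer y"
    then have "mat y * mat z = mat z * mat y" by (simp add: centralizer_def)
    then obtain \<alpha> \<beta> where z: "mat z = smul \<alpha> 1 + smul \<beta> (mat y)" using commuting_combination[OF y(1)] by metis
    then show "z \<in> centralizer x" using y(2) by (simp add: centralizer_def distrib_left distrib_right)
  qed
  have "x \<in> centralizer y" using assms(3) by (simp add: centralizer_def)
  then show ?thesis using sub[OF assms(2,3)] sub[OF assms(1)] by auto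
qed

text \<open>For z = \<alpha> + \<beta> x, trace \<open>\<sigma>\<close> and determinant 1 give
  \<beta>^2 (4 - \<tau>^2) = 4 - \<sigma>^2, which fixes \<beta> up to sign. The condition on the
  trace of \<open>x\<close> excludes unipotents and their negatives, whose centralizers consist of
  elements of trace 2 or -2 only.\<close>

lemma card_centralizer_trace:
  fixes x :: "'a::{field,finite} sl2"
  assumes x: "nonscalar (mat x)" and tr: "tr2 (mat x) * tr2 (mat x) \<noteq> 4" and two: "(2 :: 'a) \<noteq> 0"
  shows "card {z \<in> centralizer x. tr2 (mat z) = \<sigma>} \<le> 2"
proof (cases "{z \<in> centralizer x. tr2 (mat z) = \<sigma>} = {}")
  case False
  define \<tau> where "\<tau> = tr2 (mat x)"
  define f where "f \<beta> = smul ((\<sigma> - \<beta> * \<tau>) / 2) 1 + smul \<beta> (mat x)" for \<beta>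
  have param: "\<exists>\<beta>. mat z = f \<beta> \<and> \<beta> * \<beta> * (4 - \<tau> * \<tau>) = 4 - \<sigma> * \<sigma>"
    if z: "z \<in> centralizer x" "tr2 (mat z) = \<sigma>" for z
  proof -
    obtain \<alpha> \<beta> where ab: "mat z = smul \<alpha> 1 + smul \<beta> (mat x)"
      using commuting_combination[OF x] z(1) by (metis (mono_tags) centralizer_def mem_Collect_eq)
    have s: "\<sigma> = 2 * \<alpha> + \<beta> * \<tau>" using z(2) ab by (simp add: tr2_linear \<tau>_def mult.commute)
    have "det2 (smul \<alpha> 1 + smul \<beta> (mat x)) = \<alpha> * \<alpha> + \<alpha> * \<beta> * \<tau> + \<beta> * \<beta> * det2 (mat x)"
      by (simp add: det2_def \<tau>_def tr2_def algebra_simps)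
    then have "\<alpha> * \<alpha> + \<alpha> * \<beta> * \<tau> + \<beta> * \<beta> = 1" using ab det2_mat[of z] by simp
    then have "4 * (\<alpha> * \<alpha> + \<alpha> * \<beta> * \<tau> + \<beta> * \<beta>) = 4" by simp
    then have "\<beta> * \<beta> * (4 - \<tau> * \<tau>) = 4 - \<sigma> * \<sigma>" unfolding s by (simp add: algebra_simps)
    moreover have "\<alpha> = (\<sigma> - \<beta> * \<tau>) / 2" using s two by (simp add: nonzero_eq_divide_eq)
    ultimately show ?thesis using ab f_def by metis
  qed
  obtain z0 where "z0 \<in> centralizer x" "tr2 (mat z0) = \<sigma>" using False by blast
  then obtain \<beta>0 where b0: "mat z0 = f \<beta>0" "\<beta>0 * \<beta>0 * (4 - \<tau> * \<tau>) = 4 - \<sigma> * \<sigma>" using param by blast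
  have "mat ` {z \<in> centralizer x. tr2 (mat z) = \<sigma>} \<subseteq> {f \<beta>0, f (- \<beta>0)}"
  proof (rule image_subsetI)
    fix z assume "z \<in> {z \<in> centralizer x. tr2 (mat z) = \<sigma>}"
    then obtain \<beta> where b: "mat z = f \<beta>" "\<beta> * \<beta> * (4 - \<tau> * \<tau>) = 4 - \<sigma> * \<sigma>" using param by blast
    have "4 - \<tau> * \<tau> \<noteq> 0" using tr by (simp add: \<tau>_def)
    then have "\<beta> * \<beta> = \<beta>0 * \<beta>0" using b(2) b0(2) by (metis mult_right_cancel)
    then have "\<beta> = \<beta>0 \<or> \<beta> = - \<beta>0" by (simp add: square_eq_iff)
    then show "mat z \<in> {f \<beta>0, f (- \<beta>0)}" using b by auto
  qed
  then have "card (mat ` {z \<in> centralizer x. tr2 (mat z) = \<sigma>}) \<le> card {f \<beta>0, f (- \<beta>0)}" by (intro card_mono) auto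
  also have "\<dots> \<le> 2" by (simp add: card_insert_if)
  finally show ?thesis by (subst (asm) card_image) (auto simp: inj_on_def sl2_eq_iff)
next
  case True
  then show ?thesis by (simp only: card.empty)
qed

lemma card_centralizer:
  fixes x :: "'a::{field,finite} sl2"
  assumes "nonscalar (mat x)" "tr2 (mat x) * tr2 (mat x) \<noteq> 4" "(2 :: 'a) \<noteq> 0"
  shows "card (centralizer x) \<le> 2 * CARD('a)"
  by (rule card_le_fibers[where f = "\<lambda>z. tr2 (mat z)"]) (use card_centralizer_trace[OF assms] in auto)

text \<open>Every element of a prime field is a natural multiple of \<open>t\<close>, so adding
  \<open>u\<close> repeatedly reaches all upper unipotents without inverses; likewise for
  \<open>v\<close> and the lower ones. A matrix with nonzero lower left entry is upper times lower
  times upper unipotent, and a lower unipotent leads from the remaining matrices to these.\<close>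

lemma sl2_generated:
  fixes t :: "'a::field"
  assumes prime_field: "range (of_nat :: nat \<Rightarrow> 'a) = UNIV" and t: "t \<noteq> 0"
    and u: "mat u = M2 1 t 0 1" and v: "mat v = M2 1 0 t 1"
    and H: "0 \<in> H" "\<And>g. g \<in> H \<Longrightarrow> u + g \<in> H" "\<And>g. g \<in> H \<Longrightarrow> v + g \<in> H"
  shows "g \<in> H"
proof -
  define U L :: "'a \<Rightarrow> 'a sl2" where "U s = Abs_sl2 (M2 1 s 0 1)" and "L s = Abs_sl2 (M2 1 0 s 1)" for s
  have m: "mat (U s) = M2 1 s 0 1" "mat (L s) = M2 1 0 s 1" for s
    by (simp_all add: U_def L_def Abs_sl2_inverse det2_def)
  have coeff: "\<exists>n. s = of_nat n * t" for s
  proof -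
    have "s / t \<in> range (of_nat :: nat \<Rightarrow> 'a)" using prime_field by simp
    then obtain n where "s / t = of_nat n" by blast
    then show ?thesis using t by (metis nonzero_divide_eq_eq)
  qed
  have HU: "U s + g \<in> H" if g: "g \<in> H" for s g
  proof -
    have "U (of_nat n * t) + g \<in> H" for n
    proof (induction n)
      case 0
      have "U 0 + g = g" by (simp add: sl2_eq_iff m2_eq_iff m)
      then show ?case using g by simp
    next
      case (Suc n)
      have "U (of_nat (Suc n) * t) + g = u + (U (of_nat n * t) + g)"
        by (simp add: sl2_eq_iff m2_eq_iff m u algebra_simps)
      then show ?case using H(2)[OF Suc] by simp
    qed
    then show ?thesis using coeff[of s] by auto
  qed
  have HL: "L s + g \<in> H" if g: "g \<in> H" for s g
  proof -
    have "L (of_nat n * t) + g \<in> H" for n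
    proof (induction n)
      case 0
      have "L 0 + g = g" by (simp add: sl2_eq_iff m2_eq_iff m)
      then show ?case using g by simp
    next
      case (Suc n)
      have "L (of_nat (Suc n) * t) + g = v + (L (of_nat n * t) + g)"
        by (simp add: sl2_eq_iff m2_eq_iff m v algebra_simps)
      then show ?case using H(3)[OF Suc] by simp
    qed
    then show ?thesis using coeff[of s] by auto
  qed
  have main: "g \<in> H" if c: "e21 (mat g) \<noteq> 0" for g
  proof -
    define a b c d where "a = e11 (mat g)" and "b = e12 (mat g)" and "c = e21 (mat g)" and "d = e22 (mat g)"
    have det: "a * d - b * c = 1" using det2_mat[of g] by (simp add: det2_def a_def b_def c_def d_def)
    have c0: "c \<noteq> 0" using c by (simp add: c_def)
    have b': "b = (a * d - 1) / c" using det c0 by (simp add: nonzero_eq_divide_eq algebra_simps)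
    have mg: "mat g = M2 a b c d" by (simp add: a_def b_def c_def d_def)
    have "U ((a - 1) / c) + (L c + (U ((d - 1) / c) + 0)) \<in> H" by (intro HU HL H(1))
    moreover have "U ((a - 1) / c) + (L c + (U ((d - 1) / c) + 0)) = g"
    proof -
      have "(d - 1) / c + (a - 1) / c * (c * ((d - 1) / c) + 1) = b"
        unfolding b' using c0 by (simp add: add_divide_distrib diff_divide_distrib algebra_simps)
      then show ?thesis using c0 by (simp add: sl2_eq_iff m2_eq_iff m mg)
    qed
    ultimately show ?thesis by simp
  qed
  show ?thesis
  proof (cases "e21 (mat g) = 0")
    case True
    then have "e11 (mat g) \<noteq> 0" using det2_mat[of g] by (auto simp: det2_def)
    then have "L 1 + g \<in> H" using True by (intro main) (simp add: m)
    then have "L (- 1) + (L 1 + g) \<in> H" by (rule HL)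
    moreover have "L (- 1) + (L 1 + g) = g" by (simp add: sl2_eq_iff m2_eq_iff m)
    ultimately show ?thesis by simp
  qed (use main in simp)
qed


section \<open>Tori and the size of an approximate subgroup\<close>

context approximate_subgroup
begin

text \<open>Conjugation a y a^-1 sends \<open>A\<close> into the trace class of \<open>y\<close> in
  A^4, which has fewer than |A| / K^2 elements, so its fibers cannot all be small. Quotients of
  elements of one fiber commute with \<open>y\<close>.\<close>

lemma centralizer_rich:
  assumes big: "2 * K ^ 131 < card A" and y: "y \<in> set_pow A 2"
  shows "K\<^sup>2 < card (set_pow A 2 \<inter> centralizer y)"
proof -
  define T where "T = {g \<in> set_pow A 4. tr2 (mat g) = tr2 (mat y)}"
  define N where "N = card (set_pow A 2 \<inter> centralizer y)"
  have "card A \<le> N * card T"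
  proof (rule card_le_fibers[where f = "\<lambda>a. a + y + - a"])
    show "(\<lambda>a. a + y + - a) ` A \<subseteq> T"
    proof (rule image_subsetI)
      fix a assume a: "a \<in> A"
      have "a + y + - a \<in> set_pow A (1 + 2 + 1)"
        using a y uminus_mem[OF a] by (intro set_pow_addI) simp_all
      moreover have "tr2 (mat (a + y + - a)) = tr2 (mat y)"
        by (simp add: tr2_mult_comm[of _ "adj2 (mat a)"] mult.assoc[symmetric] del: add_uminus_conv_diff mat_diff)
      ultimately show "a + y + - a \<in> T" by (simp add: T_def eval_nat_numeral)
    qed
  next
    fix z
    show "card {a \<in> A. a + y + - a = z} \<le> N"
    proof (cases "{a \<in> A. a + y + - a = z} = {}")
      case True
      then show ?thesis by (simp only: card.empty)
    next
      case False
      then obtain a0 where a0: "a0 \<in> A" "a0 + y + - a0 = z" by blast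
      have "(+) (- a0) ` {a \<in> A. a + y + - a = z} \<subseteq> set_pow A 2 \<inter> centralizer y"
      proof (rule image_subsetI)
        fix a assume "a \<in> {a \<in> A. a + y + - a = z}"
        then have a: "a \<in> A" "a + y + - a = a0 + y + - a0" using a0 by auto
        have "- a0 + a \<in> set_pow A (1 + 1)" using a uminus_mem[OF a0(1)] by (intro set_pow_addI) simp_all
        moreover have "- a0 + (a + y + - a) + a = - a0 + (a0 + y + - a0) + a" by (simp only: a(2))
        then have "(- a0 + a) + y = y + (- a0 + a)" by (simp add: add.assoc del: add_uminus_conv_diff)
        then have "mat ((- a0 + a) + y) = mat (y + (- a0 + a))" by (simp only:)
        then have "- a0 + a \<in> centralizer y" by (simp add: centralizer_def)
        ultimately show "- a0 + a \<in> set_pow A 2 \<inter> centralizer y" by (simp add: numeral_2_eq_2)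
      qed
      then have "card ((+) (- a0) ` {a \<in> A. a + y + - a = z}) \<le> N" unfolding N_def by (intro card_mono) auto
      then show ?thesis by (simp add: card_image)
    qed
  qed simp_all
  then have "real (card A) \<le> real N * card T" by (metis of_nat_le_iff of_nat_mult)
  then have "K\<^sup>2 * card A \<le> K\<^sup>2 * (real N * card T)" by (intro mult_left_mono) auto
  also have "\<dots> = N * (K\<^sup>2 * card T)" by simp
  finally have le: "K\<^sup>2 * card A \<le> N * (K\<^sup>2 * card T)" .
  have tc: "K\<^sup>2 * card T < card A" unfolding T_def by (rule trace_class_small[OF big])
  have "N > 0" using \<open>card A \<le> N * card T\<close> card_A by (cases N) auto
  then have "N * (K\<^sup>2 * card T) < N * real (card A)" using tc by (intro mult_strict_left_mono) auto
  then have "K\<^sup>2 * card A < N * real (card A)" using le by linarith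
  then show ?thesis using card_A by (simp add: N_def)
qed

text \<open>The reference element. Its trace satisfies tr^2 - 4 = t^2 (t^2 + 4), so it is regular
  semisimple once t and t^2 + 4 are nonzero.\<close>

definition g0 where "g0 = u + v"

lemma g0: "g0 \<in> set_pow A 2" "nonscalar (mat g0)" "tr2 (mat g0) = 2 + t * t"
proof -
  have "u + v \<in> set_pow A (1 + 1)" using u v by (intro set_pow_addI) simp_all
  then show "g0 \<in> set_pow A 2" by (simp add: g0_def numeral_2_eq_2)
qed (use t in \<open>simp_all add: g0_def u v nonscalar_def tr2_def\<close>)

text \<open>The conjugates of one torus are indexed by the conjugating element and not by the
  subgroup, so that the final count can run over the whole group and needs no normalizer.\<close>

definition torus :: "'a sl2 \<Rightarrow> 'a sl2 set" where
  "torus g = {y. - g + y + g \<in> centralizer g0}"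

lemma torus_centralizer:
  assumes "y \<in> torus g" "nonscalar (mat y)"
  shows "torus g = centralizer y"
proof -
  have "nonscalar (mat (- g + y + g))" using nonscalar_conj[of g "mat y"] assms(2) by simp
  then have "centralizer (- g + y + g) = centralizer g0"
    using assms(1) g0(2) by (intro centralizer_eq) (auto simp: torus_def)
  then have "torus g = {z. - g + z + g \<in> centralizer (- g + y + g)}" by (simp add: torus_def)
  also have "\<dots> = centralizer y"
  proof (rule set_eqI)
    fix z
    have "- g + z + g \<in> centralizer (- g + y + g) \<longleftrightarrow> adj2 (mat g) * (mat y * mat z) * mat g = adj2 (mat g) * (mat z * mat y) * mat g"
      by (simp add: centralizer_def mult.assoc)
    also have "\<dots> \<longleftrightarrow> mat y * mat z = mat z * mat y"
    proof
      assume "adj2 (mat g) * (mat y * mat z) * mat g = adj2 (mat g) * (mat z * mat y) * mat g"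
      then have "mat g * (adj2 (mat g) * (mat y * mat z) * mat g) * adj2 (mat g)
          = mat g * (adj2 (mat g) * (mat z * mat y) * mat g) * adj2 (mat g)" by (simp only:)
      then show "mat y * mat z = mat z * mat y" by (simp add: mult.assoc)
    qed simp
    finally show "z \<in> {z. - g + z + g \<in> centralizer (- g + y + g)} \<longleftrightarrow> z \<in> centralizer y"
      by (simp add: centralizer_def)
  qed
  finally show ?thesis .
qed

text \<open>Among the pairs from \<open>D\<close> and \<open>A\<close>, more than K^2 |A| in number,
  the product (a d a^-1) b takes at most K |A| values. Two pairs with the same value give a d0^-1 d
  a^-1 = b0 b^-1: the left side lies in the torus conjugated by \<open>a\<close>, the right side
  shows that it needs only two factors from \<open>A\<close>.\<close>

lemma torus_propagates:
  assumes big: "2 * K ^ 131 < card A" and a: "a \<in> A"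
    and y: "y \<in> set_pow A 2" "y \<in> torus g" "nonscalar (mat y)"
  shows "\<exists>y'. y' \<in> set_pow A 2 \<and> y' \<in> torus (a + g) \<and> nonscalar (mat y')"
proof -
  define D where "D = set_pow A 2 \<inter> centralizer y"
  have D: "K\<^sup>2 < card D" unfolding D_def by (rule centralizer_rich[OF big y(1)])
  define f where "f = (\<lambda>(d, b). (a + d + - a) + b)"
  have im: "f ` (D \<times> A) \<subseteq> set_pow A 5"
  proof (rule image_subsetI, clarify)
    fix d b assume "d \<in> D" "b \<in> A"
    then have "(a + d + - a) + b \<in> set_pow A (1 + 2 + 1 + 1)"
      using a uminus_mem[OF a] by (intro set_pow_addI) (simp_all add: D_def)
    then show "f (d, b) \<in> set_pow A 5" by (simp add: f_def eval_nat_numeral)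
  qed
  have "\<not> card (D \<times> A) \<le> 2 * card (set_pow A 5)"
  proof
    assume "card (D \<times> A) \<le> 2 * card (set_pow A 5)"
    then have "real (card D) * card A \<le> 2 * real (card (set_pow A 5))"
      unfolding card_cartesian_product by (metis of_nat_le_iff of_nat_mult of_nat_numeral)
    also have "\<dots> \<le> 2 * (K * card A)" using card_pow_le[of 5] by simp
    finally have "real (card D) \<le> 2 * K" using card_A by simp
    also have "2 * K \<le> K * K" using K by (intro mult_right_mono) auto
    finally show False using D by (simp add: power2_eq_square)
  qed
  \<comment> \<open>More than two pairs are needed because SL2 may contain two scalars: one of the
    quotients is then nonscalar.\<close>
  then obtain z where z: "z \<in> set_pow A 5" "\<not> card {p \<in> D \<times> A. f p = z} \<le> 2"
    using card_le_fibers[OF _ _ im, of 2] by auto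
  define P where "P = {p \<in> D \<times> A. f p = z}"
  have P: "card P > 2" using z by (simp add: P_def)
  then obtain d0 b0 where p0: "(d0, b0) \<in> P" by (metis card.empty not_less_zero equals0I surj_pair)
  have inj: "inj_on (\<lambda>(d, b). a + (- d0 + d) + - a) P"
  proof (rule inj_onI, clarify)
    fix d b d' b' assume p: "(d, b) \<in> P" "(d', b') \<in> P"
      and e: "a + (- d0 + d) + - a = a + (- d0 + d') + - a"
    have "d = d'" using e by (simp add: add.assoc del: add_uminus_conv_diff)
    then show "d = d' \<and> b = b'" using p by (auto simp: P_def f_def)
  qed
  have "\<not> (\<lambda>(d, b). a + (- d0 + d) + - a) ` P \<subseteq> {g. \<not> nonscalar (mat g)}"
  proof
    assume "(\<lambda>(d, b). a + (- d0 + d) + - a) ` P \<subseteq> {g. \<not> nonscalar (mat g)}"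
    then have "card ((\<lambda>(d, b). a + (- d0 + d) + - a) ` P) \<le> 2"
      using card_not_nonscalar[where 'a = 'a] card_mono[OF finite] by (metis (no_types, lifting) le_trans)
    then show False using P card_image[OF inj] by simp
  qed
  then obtain d b where p: "(d, b) \<in> P" and ns: "nonscalar (mat (a + (- d0 + d) + - a))" by auto
  define y' where "y' = a + (- d0 + d) + - a"
  have y'b: "y' = b0 + - b"
  proof -
    have "(a + d + - a) + b = (a + d0 + - a) + b0" using p p0 by (simp add: P_def f_def)
    then have "a + - d0 + - a + ((a + d + - a) + b) + - b = a + - d0 + - a + ((a + d0 + - a) + b0) + - b" by simp
    then show ?thesis by (simp add: y'_def add.assoc del: add_uminus_conv_diff)
  qed
  have "b0 + - b \<in> set_pow A (1 + 1)"
    using p p0 uminus_mem[of b] by (intro set_pow_addI) (auto simp: P_def)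
  then have "y' \<in> set_pow A 2" by (simp add: y'b numeral_2_eq_2)
  moreover have "y' \<in> torus (a + g)"
  proof -
    have inv: "- d0 + d \<in> centralizer y"
    proof -
      have c: "mat y * mat d0 = mat d0 * mat y" "mat y * mat d = mat d * mat y"
        using p p0 by (auto simp: P_def D_def centralizer_def)
      have "adj2 (mat d0) * (mat d0 * mat y) * adj2 (mat d0) = adj2 (mat d0) * (mat y * mat d0) * adj2 (mat d0)"
        by (simp only: c)
      then have c': "mat y * adj2 (mat d0) = adj2 (mat d0) * mat y" by (simp add: mult.assoc)
      have "mat y * (adj2 (mat d0) * mat d) = adj2 (mat d0) * (mat y * mat d)"
        by (simp only: mult.assoc[symmetric] c')
      also have "\<dots> = (adj2 (mat d0) * mat d) * mat y" by (simp only: c(2) mult.assoc)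
      finally have "mat y * (adj2 (mat d0) * mat d) = (adj2 (mat d0) * mat d) * mat y" .
      then show ?thesis by (simp only: centralizer_def mem_Collect_eq mat_simps)
    qed
    then have "- d0 + d \<in> torus g" using torus_centralizer[OF y(2,3)] by simp
    moreover have "- (a + g) + y' + (a + g) = - g + (- d0 + d) + g"
      by (simp add: y'_def minus_add add.assoc del: add_uminus_conv_diff)
    ultimately show ?thesis by (simp add: torus_def)
  qed
  ultimately show ?thesis using ns unfolding y'_def by blast
qed

text \<open>Every \<open>g\<close> has at least K^2 - 2 elements in \<open>S g\<close>, and a fixed
  element lies in \<open>S g\<close> for at most 4 p of the \<open>g\<close>. Hence |SL2| (K^2 - 2)
  <= 4 p K |A|, where |SL2| is about p^3.\<close>

lemma approximate_subgroup_large: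
  assumes big: "2 * K ^ 131 < card A" and t4: "t * t + 4 \<noteq> 0"
    and prime_field: "range (of_nat :: nat \<Rightarrow> 'a) = UNIV"
  shows "real CARD('a) ^ 2 * K \<le> 16 * card A"
proof -
  define p where "p = CARD('a)"
  have p: "p \<ge> 2" unfolding p_def by (rule card_field_ge_2)
  define H where "H = {g. \<exists>y. y \<in> set_pow A 2 \<and> y \<in> torus g \<and> nonscalar (mat y)}"
  have "g \<in> H" for g
  proof (rule sl2_generated[OF prime_field t(1) u(2) v(2)])
    show "0 \<in> H" using g0 by (auto simp: H_def torus_def centralizer_def intro!: exI[of _ g0])
    show "u + g \<in> H" "v + g \<in> H" if "g \<in> H" for g
      using torus_propagates[OF big] u(1) v(1) that unfolding H_def by blast+
  qed
  define S where "S g = {y \<in> set_pow A 2. y \<in> torus g \<and> nonscalar (mat y)}" for g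
  have S: "K\<^sup>2 - 2 \<le> card (S g)" for g
  proof -
    obtain y where y: "y \<in> set_pow A 2" "y \<in> torus g" "nonscalar (mat y)" using \<open>g \<in> H\<close> by (auto simp: H_def)
    have "set_pow A 2 \<inter> centralizer y \<subseteq> S g \<union> {g. \<not> nonscalar (mat g)}"
      using torus_centralizer[OF y(2,3)] by (auto simp: S_def)
    then have "card (set_pow A 2 \<inter> centralizer y) \<le> card (S g) + card {g :: 'a sl2. \<not> nonscalar (mat g)}"
      by (meson card_Un_le card_mono finite le_trans)
    then have "card (set_pow A 2 \<inter> centralizer y) \<le> card (S g) + 2" using card_not_nonscalar[where 'a = 'a] by linarith
    then show ?thesis using centralizer_rich[OF big y(1)] by linarith
  qed
  have tr4: "tr2 (mat g0) * tr2 (mat g0) \<noteq> 4"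
  proof
    assume "tr2 (mat g0) * tr2 (mat g0) = 4"
    then have "t * t * (t * t + 4) = 0" unfolding g0(3) by (simp add: algebra_simps)
    then show False using t t4 by simp
  qed
  have cardC: "card (centralizer g0) \<le> 2 * p" unfolding p_def
    by (rule card_centralizer[OF g0(2) tr4 t(2)])
  have fib: "card {g. x \<in> S g} \<le> 4 * p" for x
  proof -
    \<comment> \<open>The conjugate of \<open>x\<close> by \<open>g\<close> is one of at most two
      elements of the base torus with the trace of \<open>x\<close>. Given this conjugate,
      \<open>g\<close> varies in a coset of the centralizer, which has at most 2 p elements.\<close>
    have "card {g. x \<in> S g} \<le> (2 * p) * card {c \<in> centralizer g0. tr2 (mat c) = tr2 (mat x)}"
    proof (rule card_le_fibers[where f = "\<lambda>g. - g + x + g"])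
      show "(\<lambda>g. - g + x + g) ` {g. x \<in> S g} \<subseteq> {c \<in> centralizer g0. tr2 (mat c) = tr2 (mat x)}"
        by (auto simp: S_def torus_def tr2_conj)
    next
      fix c
      show "card {g \<in> {g. x \<in> S g}. - g + x + g = c} \<le> 2 * p"
      proof (cases "{g \<in> {g. x \<in> S g}. - g + x + g = c} = {}")
        case True
        then show ?thesis by (simp only: card.empty)
      next
        case False
        then obtain g1 where g1: "x \<in> S g1" "- g1 + x + g1 = c" by blast
        have "nonscalar (mat c)" using g1 nonscalar_conj[of g1 "mat x"] by (auto simp: S_def)
        then have cc: "centralizer c = centralizer g0"
          using g1 g0(2) by (intro centralizer_eq) (auto simp: S_def torus_def)
        have "(+) (- g1) ` {g \<in> {g. x \<in> S g}. - g + x + g = c} \<subseteq> centralizer g0"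
        proof (rule image_subsetI)
          fix g assume "g \<in> {g \<in> {g. x \<in> S g}. - g + x + g = c}"
          then have e: "- g + x + g = c" by simp
          have "c + (- g1 + g) = - g1 + x + g" using g1(2)[symmetric] by (simp add: add.assoc)
          moreover have "(- g1 + g) + c = - g1 + x + g" using e[symmetric] by (simp add: add.assoc)
          ultimately have "mat (c + (- g1 + g)) = mat ((- g1 + g) + c)" by (simp only:)
          then have "- g1 + g \<in> centralizer c" by (simp add: centralizer_def)
          then show "- g1 + g \<in> centralizer g0" by (simp only: cc)
        qed
        then have "card ((+) (- g1) ` {g \<in> {g. x \<in> S g}. - g + x + g = c}) \<le> card (centralizer g0)"
          by (intro card_mono) auto
        then show ?thesis using cardC by (simp add: card_image)
      qed
    qed simp_all
    also have "\<dots> \<le> (2 * p) * 2" using card_centralizer_trace[OF g0(2) tr4 t(2)] by (intro mult_left_mono) auto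
    finally show ?thesis by simp
  qed
  have "(\<Sum>g\<in>UNIV. card (S g)) = card (SIGMA g:UNIV. S g)" by simp
  also have "\<dots> \<le> (4 * p) * card (set_pow A 2)"
  proof (rule card_le_fibers[where f = snd])
    fix x
    have "card {q \<in> (SIGMA g:UNIV. S g). snd q = x} = card ((\<lambda>g. (g, x)) ` {g. x \<in> S g})"
      by (rule arg_cong[where f = card]) auto
    also have "\<dots> = card {g. x \<in> S g}" by (rule card_image) (auto simp: inj_on_def)
    finally show "card {q \<in> (SIGMA g:UNIV. S g). snd q = x} \<le> 4 * p" using fib by simp
  qed (auto simp: S_def)
  finally have up: "(\<Sum>g\<in>UNIV. card (S g)) \<le> (4 * p) * card (set_pow A 2)" .
  have "real CARD('a sl2) * (K\<^sup>2 - 2) = (\<Sum>g\<in>(UNIV :: 'a sl2 set). K\<^sup>2 - 2)" by simp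
  also have "\<dots> \<le> (\<Sum>g\<in>(UNIV :: 'a sl2 set). real (card (S g)))" using S by (intro sum_mono) auto
  also have "\<dots> \<le> real ((4 * p) * card (set_pow A 2))" using of_nat_mono[OF up] by simp
  also have "\<dots> \<le> 4 * p * (K * card A)" using card_pow_le[of 2] by (simp add: mult_left_mono)
  finally have 1: "real CARD('a sl2) * (K\<^sup>2 - 2) \<le> 4 * p * (K * card A)" .
  have K9: "K\<^sup>2 \<ge> 9" using power_mono[of 3 K 2] K by simp
  have "real (p ^ 2 * p) \<le> real (2 * ((p - 1) * p ^ 2))"
  proof -
    have "p ^ 2 * p \<le> p ^ 2 * (2 * (p - 1))" using p by (intro mult_left_mono) auto
    then show ?thesis by (simp only: of_nat_le_iff mult_ac)
  qed
  also have "\<dots> \<le> 2 * real CARD('a sl2)"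
  proof -
    have "2 * ((p - 1) * p ^ 2) \<le> 2 * CARD('a sl2)"
      unfolding p_def by (intro mult_left_mono card_sl2_ge) simp
    then have "real (2 * ((p - 1) * p ^ 2)) \<le> real (2 * CARD('a sl2))" by (simp only: of_nat_le_iff)
    then show ?thesis by (simp only: of_nat_mult of_nat_numeral)
  qed
  finally have "real (p ^ 2 * p) / 2 \<le> real CARD('a sl2)" by simp
  then have "(real (p ^ 2 * p) / 2) * (K\<^sup>2 / 2) \<le> real CARD('a sl2) * (K\<^sup>2 - 2)"
    using K9 by (intro mult_mono) auto
  then have 2: "(real (p ^ 2 * p) / 2) * (K\<^sup>2 / 2) \<le> 4 * p * (K * card A)" using 1 by linarith
  have "(real p ^ 2 * K) * (p * K) = 4 * ((real (p ^ 2 * p) / 2) * (K\<^sup>2 / 2))"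
    by (simp add: power2_eq_square)
  also have "\<dots> \<le> 4 * (4 * p * (K * card A))" using 2 by simp
  also have "\<dots> = (16 * card A) * (p * K)" by simp
  finally have "(real p ^ 2 * K) * (p * K) \<le> (16 * card A) * (p * K)" .
  then show ?thesis using p K by (simp add: p_def)
qed

end

text \<open>Small tripling of B makes the square of its symmetrization an approximate subgroup with
  parameter k ^ 72 (72 = 4 * 18), and 9433 = 72 * 131 + 1.\<close>

lemma tripling_or_large:
  fixes B :: "'a::{field,finite} sl2 set" and k :: real
  assumes k: "k \<ge> 32" and B: "k ^ 9433 \<le> card B"
    and u: "mat u = M2 1 t 0 1" "x \<in> B" "y \<in> B" "u = - x + y"
    and v: "mat v = M2 1 0 t 1" "x' \<in> B" "y' \<in> B" "v = x' + - y'"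
    and ne: "t \<noteq> 0" "t * t + 4 \<noteq> 0" "(2 :: 'a) \<noteq> 0"
    and prime_field: "range (of_nat :: nat \<Rightarrow> 'a) = UNIV"
  shows "k * card B \<le> card (set_pow B 3) \<or> real CARD('a) ^ 2 * k \<le> card B"
proof (rule ccontr)
  assume "\<not> ?thesis"
  then have small: "card (set_pow B 3) \<le> k * card B" and not_large: "card B < real CARD('a) ^ 2 * k" by auto
  define S where "S = B \<union> uminus ` B \<union> {0}"
  define A where "A = set_pow S 2"
  define b where "b = real (card B)"
  have "B \<noteq> {}" using u by auto
  then have b: "b > 0" by (simp add: b_def card_gt_0_iff)
  have k4: "k ^ 3 * 32 \<le> k ^ 4" using k by (simp add: eval_nat_numeral)
  have S: "uminus ` S = S" "0 \<in> S" by (auto simp: S_def image_Un image_image)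
  have bS: "card B \<le> card S" by (intro card_mono) (auto simp: S_def)
  have S3: "card (set_pow S 3) \<le> 32 * k ^ 3 * b"
    unfolding S_def b_def using tripling_symmetrization[OF \<open>B \<noteq> {}\<close> small] by simp
  also have "\<dots> \<le> k ^ 4 * card S" using k4 bS b k by (intro mult_mono) (auto simp: b_def)
  finally have "card (set_pow S (17 + 3)) \<le> (k ^ 4) ^ Suc 17 * card S"
    using S by (intro card_set_pow_le) auto
  then have S20: "card (set_pow S 20) \<le> k ^ 72 * card S" by (simp flip: power_mult)
  have "S \<subseteq> A" using set_pow_mono_exp[OF S(2), of 1 2] by (simp add: A_def)
  then have SA: "card S \<le> card A" by (intro card_mono) auto
  interpret approximate_subgroup A "k ^ 72" t u v
  proof
    show "uminus ` A = A" unfolding A_def uminus_set_pow S(1) ..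
    show "0 \<in> A" using S(2) \<open>S \<subseteq> A\<close> by auto
    show "3 \<le> k ^ 72" using k power_increasing[of 1 72 k] by simp
    have "set_pow A 10 = set_pow S 20" by (simp add: A_def flip: set_pow_mult)
    moreover have "k ^ 72 * card S \<le> k ^ 72 * card A" using SA k by (intro mult_left_mono) auto
    ultimately show "card (set_pow A 10) \<le> k ^ 72 * card A" using S20 by simp
    \<comment> \<open>As quotients of two elements of \<open>B\<close>, \<open>u\<close> and
      \<open>v\<close> need not lie in \<open>S\<close>. This is why \<open>A\<close> is its
      square.\<close>
    have "- x + y \<in> set_pow S (1 + 1)" "x' + - y' \<in> set_pow S (1 + 1)"
      using u v by (intro set_pow_addI; simp add: S_def)+
    then show "u \<in> A" "v \<in> A" by (simp_all add: A_def u(4) v(4) numeral_2_eq_2 del: add_uminus_conv_diff)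
  qed (use u v ne in auto)
  have "2 * (k ^ 72) ^ 131 < k * (k ^ 72) ^ 131" using k by (intro mult_strict_right_mono) auto
  also have "\<dots> = k ^ 9433" by (simp flip: power_mult power_Suc)
  also have "\<dots> \<le> card A" using B bS SA by linarith
  finally have "real CARD('a) ^ 2 * k ^ 72 \<le> 16 * card A"
    by (rule approximate_subgroup_large[OF _ ne(2) prime_field])
  \<comment> \<open>From above, |A| is at most a constant times k^3 |B|, and |B| < p^2 k. The total
    loss of \<open>k ^ 6\<close> falls short of \<open>k ^ 72\<close>.\<close>
  also have "\<dots> \<le> 16 * card (set_pow S 3)"
    using card_mono[OF finite set_pow_mono_exp[OF S(2), of 2 3]] by (simp add: A_def)
  also have "\<dots> \<le> 16 * (32 * k ^ 3 * b)" using S3 by linarith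
  also have "\<dots> = 512 * (k ^ 3 * b)" by simp
  also have "\<dots> \<le> k ^ 2 * (k ^ 3 * b)"
    using k b power_mono[of 32 k 2] by (intro mult_right_mono) auto
  also have "\<dots> = k ^ 5 * b" by (simp flip: power_add mult.assoc)
  also have "\<dots> \<le> k ^ 5 * (real CARD('a) ^ 2 * k)" using not_large k by (intro mult_left_mono) (auto simp: b_def)
  also have "\<dots> = real CARD('a) ^ 2 * k ^ 6" by (simp add: eval_nat_numeral)
  finally have "real CARD('a) ^ 2 * k ^ 72 \<le> real CARD('a) ^ 2 * k ^ 6" .
  then have "k ^ 72 \<le> k ^ 6" by simp
  moreover have "k ^ 6 < k ^ 72" using k by (intro power_strict_increasing) auto
  ultimately show False by simp
qed

section \<open>Mixing for doubly transitive actions\<close>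

locale doubly_transitive =
  fixes act :: "'g::{group_add,finite} \<Rightarrow> 'x \<Rightarrow> 'x" and \<Omega> :: "'x set"
  assumes finite_points [simp]: "finite \<Omega>" and two_points: "card \<Omega> \<ge> 2"
    and act_zero: "x \<in> \<Omega> \<Longrightarrow> act 0 x = x"
    and act_add: "x \<in> \<Omega> \<Longrightarrow> act (g + h) x = act g (act h x)"
    and act_closed: "x \<in> \<Omega> \<Longrightarrow> act g x \<in> \<Omega>"
    and transitive2: "x \<in> \<Omega> \<Longrightarrow> x' \<in> \<Omega> \<Longrightarrow> x \<noteq> x' \<Longrightarrow> y \<in> \<Omega> \<Longrightarrow> y' \<in> \<Omega> \<Longrightarrow> y \<noteq> y' \<Longrightarrow>
      \<exists>g. act g x = y \<and> act g x' = y'"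
begin

lemma act_minus: "x \<in> \<Omega> \<Longrightarrow> act (- g) (act g x) = x"
  by (metis act_add act_zero left_minus)

lemma act_inj: "x \<in> \<Omega> \<Longrightarrow> x' \<in> \<Omega> \<Longrightarrow> act g x = act g x' \<longleftrightarrow> x = x'"
  by (metis act_minus)

lemma other_point: "x \<in> \<Omega> \<Longrightarrow> \<exists>x'\<in>\<Omega>. x' \<noteq> x"
proof (rule ccontr)
  assume "x \<in> \<Omega>" "\<not> (\<exists>x'\<in>\<Omega>. x' \<noteq> x)"
  then have "\<Omega> \<subseteq> {x}" by blast
  then have "card \<Omega> \<le> card {x}" by (rule card_mono[rotated]) simp
  then show False using two_points by simp
qed

lemma transitive: "x \<in> \<Omega> \<Longrightarrow> y \<in> \<Omega> \<Longrightarrow> \<exists>g. act g x = y"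
proof -
  assume "x \<in> \<Omega>" "y \<in> \<Omega>"
  moreover from this obtain x' y' where "x' \<in> \<Omega>" "x' \<noteq> x" "y' \<in> \<Omega>" "y' \<noteq> y" using other_point by meson
  ultimately show ?thesis using transitive2[of x x' y y'] by blast
qed

definition n where "n = real (card \<Omega>)"

lemma n: "n \<ge> 2" using two_points by (simp add: n_def)

text \<open>The sets of \<open>g\<close> that send \<open>x\<close> to a given point partition the
  group, and left translation carries any of them into any other.\<close>

lemma card_one_point:
  assumes "x \<in> \<Omega>" "y \<in> \<Omega>"
  shows "n * card {g. act g x = y} = CARD('g)"
proof -
  have eq: "card {g. act g x = y'} = card {g. act g x = y}" if "y' \<in> \<Omega>" for y'
  proof -
    have le: "card {g. act g x = a} \<le> card {g. act g x = b}" if ab: "a \<in> \<Omega>" "b \<in> \<Omega>" for a b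
    proof -
      obtain h where "act h a = b" using transitive[OF ab] by blast
      then have "(+) h ` {g. act g x = a} \<subseteq> {g. act g x = b}" using assms(1) by (auto simp: act_add)
      then have "card ((+) h ` {g. act g x = a}) \<le> card {g. act g x = b}" by (intro card_mono) auto
      then show ?thesis by (simp add: card_image)
    qed
    show ?thesis using le[OF that assms(2)] le[OF assms(2) that] by simp
  qed
  have "(UNIV :: 'g set) = (\<Union>y'\<in>\<Omega>. {g. act g x = y'})" using act_closed[OF assms(1)] by auto
  then have "CARD('g) = card (\<Union>y'\<in>\<Omega>. {g. act g x = y'})" by (simp only:)
  also have "\<dots> = (\<Sum>y'\<in>\<Omega>. card {g. act g x = y'})" by (rule card_UN_disjoint) auto
  also have "\<dots> = card \<Omega> * card {g. act g x = y}" using eq by simp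
  finally show ?thesis by (simp add: n_def)
qed

lemma card_two_points:
  assumes "x \<in> \<Omega>" "x' \<in> \<Omega>" "x \<noteq> x'" "y \<in> \<Omega>" "y' \<in> \<Omega>" "y \<noteq> y'"
  shows "n * (n - 1) * card {g. act g x = y \<and> act g x' = y'} = CARD('g)"
proof -
  define P where "P = Sigma \<Omega> (\<lambda>z. \<Omega> - {z})"
  define F where "F = (\<lambda>(z, z'). {g. act g x = z \<and> act g x' = z'})"
  have eq: "card (F q) = card (F (y, y'))" if "q \<in> P" for q
  proof -
    have le: "card (F a) \<le> card (F b)" if ab: "a \<in> P" "b \<in> P" for a b
    proof -
      obtain a1 a2 b1 b2 where c: "a = (a1, a2)" "b = (b1, b2)" by (metis surj_pair)
      obtain h where "act h a1 = b1" "act h a2 = b2" using transitive2[of a1 a2 b1 b2] ab c by (auto simp: P_def)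
      then have "(+) h ` F a \<subseteq> F b" using assms(1,2) by (auto simp: act_add F_def c)
      then have "card ((+) h ` F a) \<le> card (F b)" by (intro card_mono) auto
      then show ?thesis by (simp add: card_image)
    qed
    have "(y, y') \<in> P" using assms by (auto simp: P_def)
    then show ?thesis using le that by (meson le_antisym)
  qed
  have "(UNIV :: 'g set) = (\<Union>q\<in>P. F q)"
    using act_closed[OF assms(1)] act_closed[OF assms(2)] act_inj[OF assms(1,2)] act_inj[OF assms(2,1)] assms(3)
    by (auto simp: P_def F_def)
  then have "CARD('g) = card (\<Union>q\<in>P. F q)" by (simp only:)
  also have "\<dots> = (\<Sum>q\<in>P. card (F q))" by (rule card_UN_disjoint) (auto simp: P_def F_def)
  also have "\<dots> = card P * card (F (y, y'))" using eq by simp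
  finally have "real CARD('g) = real (card P) * card {g. act g x = y \<and> act g x' = y'}" by (simp add: F_def)
  moreover have "card P = card \<Omega> * (card \<Omega> - 1)" by (simp add: P_def card_Diff_singleton)
  moreover have "real (card \<Omega> * (card \<Omega> - 1)) = n * (n - 1)"
    using two_points by (simp add: n_def of_nat_diff)
  ultimately show ?thesis by (simp only:)
qed

text \<open>Chebyshev's inequality for \<open>N g\<close>, the number of pairs from \<open>X\<close>
  and \<open>Y\<close> matched by \<open>g\<close>. Double transitivity gives its first two moments
  over the group exactly, and on \<open>B\<close> it deviates from its mean \<open>m\<close> by all
  of \<open>m\<close>.\<close>

lemma avoiding_bound:
  assumes X: "X \<subseteq> \<Omega>" and Y: "Y \<subseteq> \<Omega>" and avoid: "\<And>g x. g \<in> B \<Longrightarrow> x \<in> X \<Longrightarrow> act g x \<notin> Y"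
  shows "real (card B) * card X * card Y * (n - 1) \<le> CARD('g) * (n - card X) * (n - card Y)"
proof -
  define a b G where "a = real (card X)" and "b = real (card Y)" and "G = real CARD('g)"
  have fin: "finite X" "finite Y" using X Y finite_points finite_subset by blast+
  have an: "a \<le> n" "b \<le> n" using X Y card_mono[OF finite_points] by (auto simp: a_def b_def n_def)
  define N where "N g = (\<Sum>x\<in>X. \<Sum>y\<in>Y. if act g x = y then 1 else 0 :: real)" for g
  have ind: "(\<Sum>g\<in>UNIV. if P g then 1 else 0) = real (card {g. P g})" for P :: "'g \<Rightarrow> bool"
    by (simp flip: sum.inter_filter)
  have "(\<Sum>g\<in>UNIV. N g) = (\<Sum>x\<in>X. \<Sum>g\<in>UNIV. \<Sum>y\<in>Y. if act g x = y then 1 else 0)"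
    unfolding N_def by (rule sum.swap)
  also have "\<dots> = (\<Sum>x\<in>X. \<Sum>y\<in>Y. real (card {g. act g x = y}))"
    by (intro sum.cong refl, subst sum.swap, simp add: ind)
  also have "\<dots> = (\<Sum>x\<in>X. \<Sum>y\<in>Y. G / n)"
  proof (intro sum.cong refl)
    fix x y assume "x \<in> X" "y \<in> Y"
    then show "real (card {g. act g x = y}) = G / n"
      using card_one_point[of x y] X Y n by (auto simp: G_def nonzero_eq_divide_eq mult.commute)
  qed
  finally have N1: "(\<Sum>g\<in>UNIV. N g) = a * b * (G / n)" by (simp add: a_def b_def)
  \<comment> \<open>The number of \<open>g\<close> that match both pairs. The mixed cases are empty
    because each \<open>g\<close> acts as an injective function.\<close>
  define c where "c x x' y y' = (if x = x' then (if y = y' then G / n else 0) else (if y = y' then 0 else G / (n * (n - 1))))"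
    for x x' y y' :: 'x
  have "(N g)\<^sup>2 = (\<Sum>x\<in>X. \<Sum>y\<in>Y. \<Sum>x'\<in>X. \<Sum>y'\<in>Y. if act g x = y \<and> act g x' = y' then 1 else 0)" for g
    unfolding N_def power2_eq_square sum_distrib_right sum_distrib_left by (intro sum.cong refl) auto
  then have "(\<Sum>g\<in>UNIV. (N g)\<^sup>2) = (\<Sum>g\<in>UNIV. \<Sum>x\<in>X. \<Sum>y\<in>Y. \<Sum>x'\<in>X. \<Sum>y'\<in>Y. if act g x = y \<and> act g x' = y' then 1 else 0)"
    by simp
  also have "\<dots> = (\<Sum>x\<in>X. \<Sum>y\<in>Y. \<Sum>x'\<in>X. \<Sum>y'\<in>Y. \<Sum>g\<in>UNIV. if act g x = y \<and> act g x' = y' then 1 else 0)"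
    by (subst sum.swap, intro sum.cong refl, subst sum.swap, intro sum.cong refl,
        subst sum.swap, intro sum.cong refl, subst sum.swap, rule refl)
  also have "\<dots> = (\<Sum>x\<in>X. \<Sum>y\<in>Y. \<Sum>x'\<in>X. \<Sum>y'\<in>Y. c x x' y y')"
  proof (intro sum.cong refl)
    fix x y x' y' assume "x \<in> X" "y \<in> Y" "x' \<in> X" "y' \<in> Y"
    then have m: "x \<in> \<Omega>" "y \<in> \<Omega>" "x' \<in> \<Omega>" "y' \<in> \<Omega>" using X Y by auto
    have "real (card {g. act g x = y \<and> act g x' = y'}) = c x x' y y'"
    proof (cases "x = x'"; cases "y = y'")
      assume "x = x'" "y = y'"
      then show ?thesis using card_one_point[OF m(1,2)] n by (simp add: c_def G_def nonzero_eq_divide_eq mult.commute)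
    next
      assume "x = x'" "y \<noteq> y'"
      then have "{g. act g x = y \<and> act g x' = y'} = {}" by auto
      then show ?thesis using \<open>x = x'\<close> \<open>y \<noteq> y'\<close> by (simp add: c_def)
    next
      assume "x \<noteq> x'" "y = y'"
      then have "{g. act g x = y \<and> act g x' = y'} = {}" using act_inj[OF m(1,3)] act_inj[OF m(3,1)] by auto
      then show ?thesis using \<open>x \<noteq> x'\<close> \<open>y = y'\<close> by (simp add: c_def)
    next
      assume "x \<noteq> x'" "y \<noteq> y'"
      then show ?thesis using card_two_points[OF m(1,3) _ m(2,4)] n
        by (simp add: c_def G_def nonzero_eq_divide_eq mult.commute)
    qed
    then show "(\<Sum>g\<in>UNIV. if act g x = y \<and> act g x' = y' then 1 else 0) = c x x' y y'" by (simp add: ind)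
  qed
  also have "\<dots> = (\<Sum>x\<in>X. \<Sum>y\<in>Y. G / n + (a - 1) * ((b - 1) * (G / (n * (n - 1)))))"
  proof (intro sum.cong refl)
    fix x y assume xy: "x \<in> X" "y \<in> Y"
    have "card X > 0" "card Y > 0" using xy fin by (auto simp: card_gt_0_iff)
    then have cd: "real (card (X - {x})) = a - 1" "real (card (Y - {y})) = b - 1"
      using xy by (simp_all add: a_def b_def of_nat_diff)
    have inner: "(\<Sum>y'\<in>Y. c x x' y y') = (if x = x' then G / n else (b - 1) * (G / (n * (n - 1))))" for x'
    proof -
      have "(\<Sum>y'\<in>Y. c x x' y y') = c x x' y y + (\<Sum>y'\<in>Y - {y}. c x x' y y')"
        using fin xy by (intro sum.remove) auto
      also have "(\<Sum>y'\<in>Y - {y}. c x x' y y') = (\<Sum>y'\<in>Y - {y}. if x = x' then 0 else G / (n * (n - 1)))"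
        by (intro sum.cong refl) (auto simp: c_def)
      also have "\<dots> = (b - 1) * (if x = x' then 0 else G / (n * (n - 1)))"
        by (simp add: cd)
      finally show ?thesis by (auto simp: c_def)
    qed
    have "(\<Sum>x'\<in>X. \<Sum>y'\<in>Y. c x x' y y') = G / n + (\<Sum>x'\<in>X - {x}. \<Sum>y'\<in>Y. c x x' y y')"
      using fin xy by (subst sum.remove[of _ x]) (auto simp: inner)
    also have "(\<Sum>x'\<in>X - {x}. \<Sum>y'\<in>Y. c x x' y y') = (\<Sum>x'\<in>X - {x}. (b - 1) * (G / (n * (n - 1))))"
      by (intro sum.cong refl) (auto simp: inner)
    also have "\<dots> = (a - 1) * ((b - 1) * (G / (n * (n - 1))))"
      by (simp add: cd)
    finally show "(\<Sum>x'\<in>X. \<Sum>y'\<in>Y. c x x' y y') = G / n + (a - 1) * ((b - 1) * (G / (n * (n - 1))))" .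
  qed
  finally have N2: "(\<Sum>g\<in>UNIV. (N g)\<^sup>2) = a * b * (G / n + (a - 1) * ((b - 1) * (G / (n * (n - 1)))))"
    by (simp add: a_def b_def)
  define m where "m = a * b / n"
  have "real (card B) * m\<^sup>2 = (\<Sum>g\<in>B. (N g - m)\<^sup>2)"
  proof -
    have "N g = 0" if "g \<in> B" for g
      unfolding N_def using avoid[OF that] by (intro sum.neutral ballI) auto
    then show ?thesis by simp
  qed
  also have "\<dots> \<le> (\<Sum>g\<in>UNIV. (N g - m)\<^sup>2)" by (intro sum_mono2) auto
  also have "\<dots> = (\<Sum>g\<in>UNIV. (N g)\<^sup>2) - 2 * m * (\<Sum>g\<in>UNIV. N g) + G * m\<^sup>2"
  proof -
    have "(N g - m)\<^sup>2 = (N g)\<^sup>2 - 2 * m * N g + m\<^sup>2" for g by (simp add: power2_diff)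
    then show ?thesis by (simp only: sum.distrib sum_subtractf sum_distrib_left[symmetric]) (simp add: G_def)
  qed
  also have "\<dots> = G * (a * b) * (n - a) * (n - b) / (n\<^sup>2 * (n - 1))"
  proof -
    define r where "r = G / (n * (n - 1))"
    have e: "G = r * (n - 1) * n" "G / n = r * (n - 1)" "a * b = m * n"
      using n by (simp_all add: r_def m_def)
    have "a * b * (r * (n - 1) + (a - 1) * ((b - 1) * r)) - 2 * m * (a * b * (r * (n - 1))) + G * m\<^sup>2
        = r * m * n * (n - a - b + m)" using e(1,3) by algebra
    moreover have "G * (a * b) * (n - a) * (n - b) = r * m * n * (n - a - b + m) * (n\<^sup>2 * (n - 1))"
      using e(1,3) by algebra
    ultimately show ?thesis unfolding N1 N2 e(2) r_def[symmetric] using n by simp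
  qed
  finally have "real (card B) * (a * b / n)\<^sup>2 \<le> G * (a * b) * (n - a) * (n - b) / (n\<^sup>2 * (n - 1))" unfolding m_def .
  then have le: "real (card B) * (a * b / n)\<^sup>2 * (n\<^sup>2 * (n - 1)) \<le> G * (a * b) * (n - a) * (n - b)"
    using n by (subst (asm) pos_le_divide_eq) auto
  have "(real (card B) * a * b * (n - 1)) * (a * b) = real (card B) * (a * b / n)\<^sup>2 * (n\<^sup>2 * (n - 1))"
    using n by (simp add: power2_eq_square)
  also note le
  also have "G * (a * b) * (n - a) * (n - b) = (G * (n - a) * (n - b)) * (a * b)" by (simp only: mult_ac)
  finally have main: "(real (card B) * a * b * (n - 1)) * (a * b) \<le> (G * (n - a) * (n - b)) * (a * b)" .
  show ?thesis
  proof (cases "a * b = 0")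
    case True
    have "0 \<le> G * (n - a) * (n - b)" using an by (simp add: G_def)
    then show ?thesis using True by (auto simp: a_def b_def G_def)
  next
    case False
    then have "a * b > 0" by (simp add: a_def b_def zero_less_mult_iff)
    then have "real (card B) * a * b * (n - 1) \<le> G * (n - a) * (n - b)"
      using main by (rule mult_right_le_imp_le[rotated])
    then show ?thesis by (simp only: a_def b_def G_def)
  qed
qed

text \<open>\<open>B\<close> never sends \<open>X\<close> into the complement of the image, and this
  complement has at least half of the points.\<close>

lemma image_expands:
  assumes X: "X \<subseteq> \<Omega>" and half: "2 * card {act g x |g x. g \<in> B \<and> x \<in> X} \<le> card \<Omega>"
  shows "real (card B) * card X * (n - 1) \<le> 2 * CARD('g) * card {act g x |g x. g \<in> B \<and> x \<in> X}"
proof -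
  define Z where "Z = {act g x |g x. g \<in> B \<and> x \<in> X}"
  have Z: "Z \<subseteq> \<Omega>" using X act_closed by (auto simp: Z_def)
  have finZ: "finite Z" using Z finite_points finite_subset by blast
  have cZ: "real (card (\<Omega> - Z)) = n - card Z"
    using card_Diff_subset[OF finZ Z] card_mono[OF finite_points Z] by (simp add: n_def of_nat_diff)
  have half': "2 * card Z \<le> n" using half by (simp add: Z_def n_def)
  have xn: "card X \<le> n" using card_mono[OF finite_points X] by (simp add: n_def)
  have "real (card B) * card X * (n - card Z) * (n - 1) \<le> CARD('g) * (n - card X) * (n - (n - card Z))"
    unfolding cZ[symmetric] by (rule avoiding_bound[OF X]) (auto simp: Z_def)
  also have "\<dots> \<le> CARD('g) * n * (n - (n - card Z))"
    using xn by (intro mult_right_mono mult_left_mono) auto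
  finally have 1: "real (card B) * card X * (n - card Z) * (n - 1) \<le> CARD('g) * n * card Z" by simp
  have "real (card B) * card X * (n / 2) * (n - 1) \<le> real (card B) * card X * (n - card Z) * (n - 1)"
    using half' n by (intro mult_right_mono mult_left_mono) auto
  then have "(real (card B) * card X * (n - 1)) * n \<le> (2 * CARD('g) * card Z) * n" using 1 by (simp add: mult_ac)
  then show ?thesis using n by (simp add: Z_def)
qed

end

section \<open>The action on the projective line\<close>

definition mv :: "'a::comm_ring_1 m2 \<Rightarrow> 'a \<times> 'a \<Rightarrow> 'a \<times> 'a" where
  "mv x w = (e11 x * fst w + e12 x * snd w, e21 x * fst w + e22 x * snd w)"

definition line :: "'a::comm_ring_1 \<times> 'a \<Rightarrow> ('a \<times> 'a) set" where
  "line w = range (\<lambda>c. (c * fst w, c * snd w))"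

definition lines :: "('a::comm_ring_1 \<times> 'a) set set" where
  "lines = line ` (UNIV - {(0, 0)})"

definition act_line :: "'a::comm_ring_1 sl2 \<Rightarrow> ('a \<times> 'a) set \<Rightarrow> ('a \<times> 'a) set" where
  "act_line g L = mv (mat g) ` L"

lemma mv_mult: "mv (x * y) w = mv x (mv y w)"
  by (simp add: mv_def algebra_simps)

lemma mv_one: "mv 1 w = w"
  by (simp add: mv_def)

lemma act_line_line: "act_line g (line w) = line (mv (mat g) w)"
  by (simp add: act_line_def line_def image_image mv_def algebra_simps)

lemma act_line_zero: "act_line 0 L = L"
  by (simp add: act_line_def mv_one)

lemma act_line_add: "act_line (g + h) L = act_line g (act_line h L)"
  by (simp add: act_line_def image_image mv_mult)

lemma line_scale:
  fixes a b c :: "'a::field"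
  assumes "c \<noteq> 0" shows "line (c * a, c * b) = line (a, b)"
proof -
  have "(d * a, d * b) \<in> line (c * a, c * b)" for d
    unfolding line_def using assms by (intro image_eqI[of _ _ "d / c"]) simp_all
  then have "line (a, b) \<subseteq> line (c * a, c * b)" by (auto simp: line_def)
  moreover have "line (c * a, c * b) \<subseteq> line (a, b)" unfolding line_def by (auto simp: mult.assoc[symmetric])
  ultimately show ?thesis by blast
qed

lemma lines_eq: "lines = insert (line (1, 0)) (range (\<lambda>a :: 'a::field. line (a, 1)))"
proof
  show "lines \<subseteq> insert (line (1, 0)) (range (\<lambda>a :: 'a. line (a, 1)))"
  proof
    fix L :: "('a \<times> 'a) set" assume "L \<in> lines"
    then obtain a b where L: "L = line (a, b)" "(a, b) \<noteq> (0, 0)" by (auto simp: lines_def)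
    show "L \<in> insert (line (1, 0)) (range (\<lambda>a :: 'a. line (a, 1)))"
    proof (cases "b = 0")
      case True
      then show ?thesis using L line_scale[of a 1 0] by simp
    next
      case False
      then have "L = line (a / b, 1)" using L line_scale[of b "a / b" 1] by simp
      then show ?thesis by auto
    qed
  qed
  have "line (1 :: 'a, 0) \<in> lines" "line (a :: 'a, 1) \<in> lines" for a unfolding lines_def by (rule imageI, simp)+
  then show "insert (line (1, 0)) (range (\<lambda>a :: 'a. line (a, 1))) \<subseteq> lines" by blast
qed

lemma line_unit_iff [simp]: "line (a, 1) = line (b, 1 :: 'a::field) \<longleftrightarrow> a = b" "line (1, 0) \<noteq> line (a, 1 :: 'a)"
proof -
  have m: "(a, 1) \<in> line (a, 1)" for a :: 'a unfolding line_def by (auto intro!: image_eqI[of _ _ 1])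
  have "a = b" if "line (a, 1) = line (b, 1)" for a b :: 'a
  proof -
    have "(a, 1) \<in> line (b, 1)" using m[of a] that by simp
    then show ?thesis by (auto simp: line_def)
  qed
  then show "line (a, 1) = line (b, 1) \<longleftrightarrow> a = b" by blast
  show "line (1, 0) \<noteq> line (a, 1 :: 'a)"
  proof
    assume "line (1, 0) = line (a, 1 :: 'a)"
    then have "(a, 1) \<in> line (1, 0 :: 'a)" using m[of a] by simp
    then show False by (auto simp: line_def)
  qed
qed

lemma card_lines: "card (lines :: ('a::{field,finite} \<times> 'a) set set) = Suc CARD('a)"
proof -
  have "card (range (\<lambda>a :: 'a. line (a, 1))) = CARD('a)" by (intro card_image) (auto simp: inj_on_def)
  moreover have "line (1, 0) \<notin> range (\<lambda>a :: 'a. line (a, 1))" by auto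
  ultimately show ?thesis unfolding lines_eq by (subst card_insert_disjoint) auto
qed

text \<open>The lines are spanned by the columns of a matrix. Dividing the second column by the
  determinant keeps its line and puts the matrix into SL2.\<close>

lemma line_frame:
  fixes L L' :: "('a::field \<times> 'a) set"
  assumes "L \<in> lines" "L' \<in> lines" "L \<noteq> L'"
  obtains h where "act_line h (line (1, 0)) = L" "act_line h (line (0, 1)) = L'"
proof -
  have frame: "\<exists>h. act_line h (line (1, 0)) = line (a, b) \<and> act_line h (line (0, 1)) = line (c, d)"
    if D: "a * d - b * c \<noteq> 0" for a b c d :: 'a
  proof -
    define D where "D = a * d - b * c"
    define h where "h = Abs_sl2 (M2 a (inverse D * c) b (inverse D * d))"
    have "inverse D * (a * d - b * c) = 1" using D by (simp only: D_def left_inverse not_False_eq_True)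
    then have "det2 (M2 a (inverse D * c) b (inverse D * d)) = 1" by (simp add: det2_def algebra_simps)
    then have mh: "mat h = M2 a (inverse D * c) b (inverse D * d)" by (simp add: h_def Abs_sl2_inverse)
    have "act_line h (line (1, 0)) = line (a, b)" "act_line h (line (0, 1)) = line (inverse D * c, inverse D * d)"
      unfolding act_line_line mh by (simp_all add: mv_def)
    moreover have "line (inverse D * c, inverse D * d) = line (c, d)" using D by (intro line_scale) (simp add: D_def)
    ultimately show ?thesis by auto
  qed
  from assms consider a where "L = line (1, 0)" "L' = line (a, 1)" | a where "L = line (a, 1)" "L' = line (1, 0)"
    | a b where "L = line (a, 1)" "L' = line (b, 1)" "a \<noteq> b" unfolding lines_eq by auto
  then have "\<exists>h. act_line h (line (1, 0)) = L \<and> act_line h (line (0, 1)) = L'"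
  proof cases
    case (1 a)
    then show ?thesis using frame[of 1 1 0 a] by simp
  next
    case (2 a)
    then show ?thesis using frame[of a 0 1 1] by simp
  next
    case (3 a b)
    then show ?thesis using frame[of a 1 1 b] by simp
  qed
  then show ?thesis using that by blast
qed

interpretation proj: doubly_transitive "act_line :: 'a::{field,finite} sl2 \<Rightarrow> _" lines
proof
  show "finite (lines :: ('a \<times> 'a) set set)" by simp
  show "card (lines :: ('a \<times> 'a) set set) \<ge> 2" using card_lines[where 'a = 'a] card_field_ge_2[where 'a = 'a] by simp
  show "act_line g L \<in> lines" if L: "L \<in> lines" for g and L :: "('a \<times> 'a) set"
  proof -
    obtain w where w: "w \<noteq> (0, 0)" "L = line w" using L by (auto simp: lines_def)
    have "mv (mat g) w \<noteq> (0, 0)"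
    proof
      assume "mv (mat g) w = (0, 0)"
      then have "mv (adj2 (mat g) * mat g) w = (0, 0)" unfolding mv_mult by (simp add: mv_def)
      then show False using w by (simp add: mv_one)
    qed
    then show ?thesis by (auto simp: lines_def w act_line_line)
  qed
  show "\<exists>g. act_line g L = M \<and> act_line g L' = M'"
    if "L \<in> lines" "L' \<in> lines" "L \<noteq> L'" "M \<in> lines" "M' \<in> lines" "M \<noteq> M'" for L L' M M' :: "('a \<times> 'a) set"
  proof -
    note d = that
    obtain h where h: "act_line h (line (1, 0)) = L" "act_line h (line (0, 1)) = L'"
      by (rule line_frame[OF d(1-3)])
    obtain k where k: "act_line k (line (1, 0)) = M" "act_line k (line (0, 1)) = M'"
      by (rule line_frame[OF d(4-6)])
    have "act_line (k + - h) L = M" "act_line (k + - h) L' = M'"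
      unfolding h[symmetric] act_line_add[symmetric] by (simp_all add: k)
    then show ?thesis by blast
  qed
qed (simp_all add: act_line_zero act_line_add)

section \<open>Expansion and transitivity on lines\<close>

definition orbit_step :: "'a::comm_ring_1 sl2 set \<Rightarrow> nat \<Rightarrow> ('a \<times> 'a) set \<Rightarrow> ('a \<times> 'a) set set" where
  "orbit_step B s L = (\<lambda>g. act_line g L) ` set_pow B s"

text \<open>A step gains the factor |B| p / (2 |SL2|) >= k / 4, because |B| >= p^2 k and |SL2| <= 2
  p^3.\<close>

lemma orbit_grows:
  fixes B :: "'a::{field,finite} sl2 set" and k :: real
  assumes B: "real CARD('a) ^ 2 * k \<le> card B" and k: "k \<ge> 32" and L: "L \<in> lines"
  shows "Suc CARD('a) < 2 * card (orbit_step B s L) \<or> (k / 4) ^ s \<le> card (orbit_step B s L)"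
proof (induction s)
  case (Suc s)
  define p where "p = real CARD('a)"
  have p: "p > 0" by (simp add: p_def)
  have bne: "B \<noteq> {}" using B k p by (auto simp: p_def mult_le_0_iff)
  then obtain b where b: "b \<in> B" by auto
  have sub: "orbit_step B s L \<subseteq> lines" using L proj.act_closed by (auto simp: orbit_step_def)
  have im: "orbit_step B (Suc s) L = {act_line g x |g x. g \<in> B \<and> x \<in> orbit_step B s L}"
    by (force simp: orbit_step_def set_plus_def act_line_add)
  show ?case
  proof (cases "Suc CARD('a) < 2 * card (orbit_step B (Suc s) L)")
    case False
    have "act_line b ` orbit_step B s L \<subseteq> orbit_step B (Suc s) L" using b im by blast
    then have "card (act_line b ` orbit_step B s L) \<le> card (orbit_step B (Suc s) L)" by (intro card_mono) auto
    moreover have "inj_on (act_line b) (orbit_step B s L)"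
      using sub proj.act_inj unfolding inj_on_def by blast
    ultimately have "card (orbit_step B s L) \<le> card (orbit_step B (Suc s) L)" by (simp add: card_image)
    then have IH: "(k / 4) ^ s \<le> card (orbit_step B s L)" using Suc False by auto
    have n: "proj.n TYPE('a) = p + 1"
      by (simp add: proj.n_def card_lines p_def)
    have "real (card B) * card (orbit_step B s L) * p \<le> 2 * CARD('a sl2) * card (orbit_step B (Suc s) L)"
      using proj.image_expands[OF sub, of B] False unfolding im[symmetric] n by (simp add: card_lines)
    also have "\<dots> \<le> (4 * p ^ 3) * card (orbit_step B (Suc s) L)"
    proof -
      have "2 * CARD('a sl2) \<le> 4 * CARD('a) ^ 3" using card_sl2_le[where 'a = 'a] by simp
      then have "real (2 * CARD('a sl2)) \<le> real (4 * CARD('a) ^ 3)" by (simp only: of_nat_le_iff)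
      then have "2 * real CARD('a sl2) \<le> 4 * p ^ 3" by (simp add: p_def)
      then show ?thesis unfolding of_nat_mult by (intro mult_right_mono) auto
    qed
    finally have 1: "real (card B) * card (orbit_step B s L) * p \<le> (4 * p ^ 3) * card (orbit_step B (Suc s) L)" .
    have "p ^ 2 * k * (k / 4) ^ s * p \<le> real (card B) * card (orbit_step B s L) * p"
      using B IH p k by (intro mult_right_mono mult_mono) (auto simp: p_def)
    then have "(4 * p ^ 3) * (k / 4) ^ Suc s \<le> (4 * p ^ 3) * card (orbit_step B (Suc s) L)"
      using 1 by (simp add: eval_nat_numeral mult_ac)
    then show ?thesis using p by simp
  qed simp
qed (simp add: orbit_step_def)

text \<open>The threshold 32 makes (k / 4)^2 >= 2 k. So \<open>2 * M\<close> steps that never pass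
  half of the lines would produce (2 k)^M >= 2 p of them, which is too many.\<close>

lemma orbit_large:
  fixes B :: "'a::{field,finite} sl2 set" and k :: real
  assumes "real CARD('a) ^ 2 * k \<le> card B" and k: "k \<ge> 32" and "L \<in> lines"
    and M: "real CARD('a) \<le> k ^ M" "M \<ge> 1"
  shows "Suc CARD('a) < 2 * card (orbit_step B (2 * M) L)"
proof (rule ccontr)
  assume no: "\<not> ?thesis"
  then have "(k / 4) ^ (2 * M) \<le> card (orbit_step B (2 * M) L)" using orbit_grows[OF assms(1-3)] by blast
  moreover have "(2 * k) ^ M \<le> (k / 4) ^ (2 * M)"
  proof -
    have "2 * k \<le> (k / 4)\<^sup>2" using k by (simp add: power2_eq_square)
    then show ?thesis unfolding power_mult using k by (intro power_mono) auto
  qed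
  moreover have "2 * real CARD('a) \<le> (2 * k) ^ M"
  proof -
    have "(2 :: real) \<le> 2 ^ M" using M(2) power_increasing[of 1 M "2 :: real"] by simp
    then show ?thesis unfolding power_mult_distrib using M(1) by (intro mult_mono) auto
  qed
  ultimately have "2 * CARD('a) \<le> card (orbit_step B (2 * M) L)" by linarith
  then show False using no card_field_ge_2[where 'a = 'a] by linarith
qed

text \<open>The orbit of \<open>L\<close> under \<open>B\<close> and that of \<open>L'\<close> under
  the inverses each fill more than half of the lines, so they meet.\<close>

lemma large_set_transitive:
  fixes B :: "'a::{field,finite} sl2 set" and k :: real
  assumes B: "real CARD('a) ^ 2 * k \<le> card B" and k: "k \<ge> 32"
    and M: "real CARD('a) \<le> k ^ M" "M \<ge> 1" and L: "L \<in> lines" "L' \<in> lines"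
  shows "\<exists>g\<in>set_pow B (4 * M). act_line g L = L'"
proof -
  define X Y where "X = orbit_step B (2 * M) L" and "Y = orbit_step (uminus ` B) (2 * M) L'"
  have "Suc CARD('a) < 2 * card X" unfolding X_def by (rule orbit_large[OF B k L(1) M])
  moreover have "Suc CARD('a) < 2 * card Y" unfolding Y_def
    by (rule orbit_large[OF _ k L(2) M]) (use B in simp)
  moreover have "X \<union> Y \<subseteq> lines" using L proj.act_closed by (auto simp: X_def Y_def orbit_step_def)
  then have "card (X \<union> Y) \<le> Suc CARD('a)" using card_mono[of lines "X \<union> Y"] by (simp add: card_lines)
  moreover have "card (X \<union> Y) + card (X \<inter> Y) = card X + card Y" using card_Un_Int[of X Y] by simp
  ultimately have "card (X \<inter> Y) > 0" by linarith
  then obtain z where "z \<in> X" "z \<in> Y" by (auto simp: card_gt_0_iff)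
  then obtain g h where g: "g \<in> set_pow B (2 * M)" "act_line g L = z"
    and h: "h \<in> set_pow (uminus ` B) (2 * M)" "act_line h L' = z" by (auto simp: X_def Y_def orbit_step_def)
  have "- h \<in> uminus ` set_pow (uminus ` B) (2 * M)" using h(1) by blast
  then have "- h \<in> set_pow B (2 * M)" by (simp add: uminus_set_pow)
  then have "- h + g \<in> set_pow B (2 * M + 2 * M)" using g(1) by (intro set_pow_addI)
  moreover have "act_line (- h + g) L = L'" using g(2) h(2) L proj.act_minus[of L' h] by (simp add: act_line_add)
  ultimately show ?thesis by (auto intro!: bexI[of _ "- h + g"])
qed

text \<open>The tripling alternative is applied to \<open>set_pow B (3 ^ r)\<close>. If every step
  gained a factor \<open>k\<close>, then \<open>4 * M + 1\<close> steps would overflow the group,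
  whose order is at most 2 p^3 <= p^4 <= k^(4 M). So some step reaches p^2 k elements, and products
  of \<open>4 * M\<close> of these are transitive on lines.\<close>

lemma transitive_power:
  fixes B :: "'a::{field,finite} sl2 set" and k :: real
  assumes k: "k \<ge> 32" and B: "k ^ 9433 \<le> card B"
    and u: "mat u = M2 1 t 0 1" "x \<in> B" "y \<in> B" "u = - x + y"
    and v: "mat v = M2 1 0 t 1" "x' \<in> B" "y' \<in> B" "v = x' + - y'"
    and ne: "t \<noteq> 0" "t * t + 4 \<noteq> 0" "(2 :: 'a) \<noteq> 0"
    and prime_field: "range (of_nat :: nat \<Rightarrow> 'a) = UNIV"
    and M: "real CARD('a) \<le> k ^ M" "M \<ge> 1"
  shows "\<exists>l \<le> 3 ^ (4 * M + 1) * (4 * M). \<forall>L\<in>lines. \<forall>L'\<in>lines. \<exists>g\<in>set_pow B l. act_line g L = L'"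
proof -
  define p where "p = real CARD('a)"
  have p2: "p \<ge> 2" using card_field_ge_2[where 'a = 'a] by (simp add: p_def)
  have Bne: "B \<noteq> {}" using u by auto
  have mono: "card B \<le> card (set_pow B (3 ^ R))" for R
  proof -
    have "set_pow B (3 ^ R) = B + set_pow B (3 ^ R - 1)" by (metis set_pow.simps(2) Suc_pred' zero_less_power zero_less_numeral diff_Suc_1)
    moreover have "set_pow B n \<noteq> {}" for n using Bne by (induction n) (auto simp: set_plus_def)
    ultimately show ?thesis by (simp add: card_set_plus_left)
  qed
  have "(\<exists>r\<le>R. p ^ 2 * k \<le> card (set_pow B (3 ^ r))) \<or> k ^ R * card B \<le> card (set_pow B (3 ^ R))" for R
  proof (induction R)
    case (Suc R)
    show ?case
    proof (cases "\<exists>r\<le>Suc R. p ^ 2 * k \<le> card (set_pow B (3 ^ r))")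
      case False
      then have IH: "k ^ R * card B \<le> card (set_pow B (3 ^ R))" using Suc by (meson le_SucI)
      \<comment> \<open>Padding by \<open>z\<close> keeps the unipotents available as quotients of
        two elements of the power: placed on the left it cancels in \<open>u\<close>, placed on the
        right it cancels in \<open>v\<close>.\<close>
      obtain z where z: "z \<in> set_pow B (3 ^ R - 1)"
      proof -
        have "set_pow B n \<noteq> {}" for n using Bne by (induction n) (auto simp: set_plus_def)
        then show ?thesis using that by blast
      qed
      have e: "3 ^ R - 1 + 1 = (3 ^ R :: nat)" "1 + (3 ^ R - 1) = (3 ^ R :: nat)" by simp_all
      have m: "z + g \<in> set_pow B (3 ^ R)" "g + z \<in> set_pow B (3 ^ R)" if "g \<in> B" for g
        using set_pow_addI[OF z, of g 1] set_pow_addI[of g B 1 z, OF _ z] that e by auto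
      have "k * card (set_pow B (3 ^ R)) \<le> card (set_pow (set_pow B (3 ^ R)) 3) \<or>
          real CARD('a) ^ 2 * k \<le> card (set_pow B (3 ^ R))"
      proof (rule tripling_or_large[OF k _ u(1) m(1)[OF u(2)] m(1)[OF u(3)] _ v(1) m(2)[OF v(2)] m(2)[OF v(3)] _ ne prime_field])
        show "k ^ 9433 \<le> card (set_pow B (3 ^ R))" using B mono[of R] by linarith
        show "u = - (z + x) + (z + y)" by (simp add: u(4) minus_add add.assoc del: add_uminus_conv_diff)
        show "v = x' + z + - (y' + z)" by (simp add: v(4) minus_add add.assoc del: add_uminus_conv_diff)
      qed
      moreover have "\<not> real CARD('a) ^ 2 * k \<le> card (set_pow B (3 ^ R))" using False by (auto simp: p_def)
      ultimately have "k * card (set_pow B (3 ^ R)) \<le> card (set_pow (set_pow B (3 ^ R)) 3)" by blast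
      also have "set_pow (set_pow B (3 ^ R)) 3 = set_pow B (3 ^ Suc R)"
        unfolding set_pow_mult[symmetric] by (simp add: mult.commute)
      finally have "k * card (set_pow B (3 ^ R)) \<le> card (set_pow B (3 ^ Suc R))" .
      moreover have "k * (k ^ R * card B) \<le> k * card (set_pow B (3 ^ R))" using IH k by (intro mult_left_mono) auto
      ultimately have "k ^ Suc R * card B \<le> card (set_pow B (3 ^ Suc R))" by (simp add: mult.assoc)
      then show ?thesis by blast
    qed simp
  qed simp
  then have "(\<exists>r\<le>4 * M + 1. p ^ 2 * k \<le> card (set_pow B (3 ^ r))) \<or>
      k ^ (4 * M + 1) * card B \<le> card (set_pow B (3 ^ (4 * M + 1)))" by blast
  moreover have "\<not> k ^ (4 * M + 1) * card B \<le> card (set_pow B (3 ^ (4 * M + 1)))"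
  proof
    assume a: "k ^ (4 * M + 1) * card B \<le> card (set_pow B (3 ^ (4 * M + 1)))"
    have "real (card (set_pow B (3 ^ (4 * M + 1)))) \<le> real CARD('a sl2)" by (simp add: card_mono)
    also have "\<dots> \<le> real (2 * CARD('a) ^ 3)" by (simp only: of_nat_le_iff card_sl2_le)
    also have "\<dots> = 2 * p ^ 3" by (simp add: p_def)
    also have "\<dots> \<le> p * p ^ 3" using p2 by (intro mult_right_mono) auto
    also have "\<dots> = p ^ 4" by (simp add: eval_nat_numeral)
    also have "\<dots> \<le> (k ^ M) ^ 4" using M by (intro power_mono) (auto simp: p_def)
    also have "\<dots> = k ^ (4 * M)" by (simp add: mult.commute flip: power_mult)
    also have "\<dots> < k ^ (4 * M + 1)" using k by (intro power_strict_increasing) auto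
    also have "\<dots> \<le> k ^ (4 * M + 1) * card B" using Bne k by (simp add: Suc_le_eq card_gt_0_iff)
    finally show False using a by linarith
  qed
  ultimately obtain r where r: "r \<le> 4 * M + 1" "p ^ 2 * k \<le> card (set_pow B (3 ^ r))" by blast
  have "\<forall>L\<in>lines. \<forall>L'\<in>lines. \<exists>g\<in>set_pow B (3 ^ r * (4 * M)). act_line g L = L'"
    unfolding set_pow_mult[of B "3 ^ r" "4 * M"] using r(2)[unfolded p_def] by (intro ballI large_set_transitive[OF _ k M])
  moreover have "(3 :: nat) ^ r * (4 * M) \<le> 3 ^ (4 * M + 1) * (4 * M)"
    using r(1) by (intro mult_right_mono power_increasing) auto
  ultimately show ?thesis by blast
qed

section \<open>Continuants\<close>

definition cfmat :: "nat \<Rightarrow> 'a::comm_ring_1 m2" where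
  "cfmat b = M2 0 1 1 (of_nat b)"

fun wmat :: "nat list \<Rightarrow> 'a::comm_ring_1 m2" where
  "wmat [] = 1"
| "wmat (b # ws) = cfmat b * wmat ws"

text \<open>Numerator and denominator of [0; b1, ..., bs], built from the inside out; the empty word
  stands for 0/1.\<close>

fun cf_frac :: "nat list \<Rightarrow> nat \<times> nat" where
  "cf_frac [] = (0, 1)"
| "cf_frac (b # ws) = (snd (cf_frac ws), fst (cf_frac ws) + b * snd (cf_frac ws))"

lemma cfmat_entries [simp]:
  "e11 (cfmat b) = 0" "e12 (cfmat b) = 1" "e21 (cfmat b) = 1" "e22 (cfmat b) = of_nat b"
  by (simp_all add: cfmat_def)

lemma wmat_append: "wmat (us @ ws) = wmat us * wmat ws"
  by (induction us) (simp_all add: mult.assoc)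

lemma wmat_replicate: "wmat (replicate m b) = cfmat b ^ m"
  by (induction m) simp_all

lemma det2_wmat: "det2 (wmat ws) = (- 1) ^ length ws"
  by (induction ws) (simp_all add: det2_mult, simp add: det2_def)

lemma wmat_of_int:
  "e11 (wmat ws :: 'a::comm_ring_1 m2) = of_int (e11 (wmat ws))" "e12 (wmat ws :: 'a m2) = of_int (e12 (wmat ws))"
  "e21 (wmat ws :: 'a m2) = of_int (e21 (wmat ws))" "e22 (wmat ws :: 'a m2) = of_int (e22 (wmat ws))"
  by (induction ws) simp_all

lemma cf_frac_mv: "mv (wmat ws) (0, 1 :: 'a::comm_ring_1) = (of_nat (fst (cf_frac ws)), of_nat (snd (cf_frac ws)))"
proof (induction ws)
  case (Cons b ws)
  show ?case unfolding wmat.simps mv_mult Cons by (simp add: mv_def)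
qed (simp add: mv_def)

text \<open>Prefixing a letter reverses a step of the Euclidean algorithm as long as the numerator
  stays below the denominator. A positive numerator ensures this for the next fraction; only at the
  innermost letter is the numerator 0, and there the letter has to be at least 2.\<close>

lemma continuant_cf_quotients:
  assumes "\<forall>b\<in>set ws. 1 \<le> b" "ws = [] \<or> 2 \<le> last ws"
  shows "cf_quotients (fst (cf_frac ws)) (snd (cf_frac ws)) = ws \<and>
    fst (cf_frac ws) < snd (cf_frac ws) \<and> coprime (fst (cf_frac ws)) (snd (cf_frac ws)) \<and>
    (ws \<noteq> [] \<longrightarrow> 0 < fst (cf_frac ws))"
  using assms
proof (induction ws)
  case Nil
  show ?case by (simp add: cf_quotients.simps)
next
  case (Cons b ws)
  define a q where "a = fst (cf_frac ws)" and "q = snd (cf_frac ws)"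
  have IH: "cf_quotients a q = ws" "a < q" "coprime a q" "ws \<noteq> [] \<Longrightarrow> 0 < a"
    using Cons by (auto simp: a_def q_def split: if_splits)
  have b: "1 \<le> b" "ws = [] \<Longrightarrow> 2 \<le> b" using Cons.prems by auto
  have "(a + b * q) div q = b" "(a + b * q) mod q = a" using IH(2) by auto
  then have "cf_quotients q (a + b * q) = b # ws"
    using IH by (subst cf_quotients.simps) simp
  moreover have "q < a + b * q"
  proof (cases "ws = []")
    case True
    then have "2 * q \<le> b * q" using b by (intro mult_right_mono) auto
    then show ?thesis using IH(2) by linarith
  next
    case False
    have "1 * q \<le> b * q" using b by (intro mult_right_mono) auto
    then show ?thesis using IH(4)[OF False] by linarith
  qed
  moreover have "coprime q (a + b * q)" using IH(3) gcd_add_mult[of q b a]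
    by (simp add: coprime_iff_gcd_eq_1 gcd.commute add.commute)
  ultimately show ?case using IH(2) by (simp add: a_def[symmetric] q_def[symmetric])
qed

lemma cf_frac_bound:
  assumes "\<forall>b\<in>set ws. b \<le> \<beta>"
  shows "fst (cf_frac ws) \<le> (\<beta> + 1) ^ length ws \<and> snd (cf_frac ws) \<le> (\<beta> + 1) ^ length ws"
  using assms
proof (induction ws)
  case (Cons b ws)
  have IH: "fst (cf_frac ws) \<le> (\<beta> + 1) ^ length ws" "snd (cf_frac ws) \<le> (\<beta> + 1) ^ length ws"
    using Cons by auto
  have "b * snd (cf_frac ws) \<le> \<beta> * (\<beta> + 1) ^ length ws" using IH(2) Cons.prems by (intro mult_mono) auto
  then show ?case using IH by simp
qed simp

lemma wmat_bounds:
  assumes "\<forall>b\<in>set ws. 1 \<le> b \<and> b \<le> \<beta>"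
  shows "0 \<le> e11 (wmat ws :: int m2) \<and> e11 (wmat ws :: int m2) \<le> (int \<beta> + 1) ^ length ws \<and>
    0 \<le> e12 (wmat ws :: int m2) \<and> e12 (wmat ws :: int m2) \<le> (int \<beta> + 1) ^ length ws \<and>
    0 \<le> e21 (wmat ws :: int m2) \<and> e21 (wmat ws :: int m2) \<le> (int \<beta> + 1) ^ length ws \<and>
    1 \<le> e22 (wmat ws :: int m2) \<and> e22 (wmat ws :: int m2) \<le> (int \<beta> + 1) ^ length ws \<and>
    (ws \<noteq> [] \<longrightarrow> e11 (wmat ws :: int m2) \<le> e21 (wmat ws) \<and> e12 (wmat ws :: int m2) \<le> e22 (wmat ws))"
  using assms
proof (induction ws)
  case (Cons b ws)
  define N P where "N = (wmat ws :: int m2)" and "P = (int \<beta> + 1) ^ length ws"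
  have IH: "0 \<le> e11 N" "e11 N \<le> P" "0 \<le> e12 N" "e12 N \<le> P" "0 \<le> e21 N" "e21 N \<le> P" "1 \<le> e22 N" "e22 N \<le> P"
    using Cons by (auto simp: N_def P_def)
  have b: "1 \<le> int b" "int b \<le> int \<beta>" using Cons.prems by auto
  have "int b * e21 N \<le> int \<beta> * P" "int b * e22 N \<le> int \<beta> * P" using IH b by (auto intro!: mult_mono)
  moreover have "1 * e21 N \<le> int b * e21 N" "1 * e22 N \<le> int b * e22 N"
    by (rule mult_right_mono; use IH b in linarith)+
  moreover have "P \<le> P + int \<beta> * P" using IH by simp
  moreover have len: "(int \<beta> + 1) ^ length (b # ws) = P + int \<beta> * P" by (simp add: P_def algebra_simps)
  ultimately show ?case
    using IH unfolding len wmat.simps N_def[symmetric] m2_entries cfmat_entries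
    by (intro conjI impI; linarith)
qed simp

text \<open>If two products agree but start with different letters, the letters differ by one and the
  rows of the remaining product coincide, contradicting that its determinant is a unit.\<close>

lemma wmat_inj:
  assumes "length ws = length ws'" "\<forall>b\<in>set ws. 1 \<le> b" "\<forall>b\<in>set ws'. 1 \<le> b" "(wmat ws :: int m2) = wmat ws'"
  shows "ws = ws'"
  using assms
proof (induction ws ws' rule: list_induct2)
  case (Cons b ws b' ws')
  have less: False
    if lt: "c < c'" and eq: "cfmat c * (wmat vs :: int m2) = cfmat c' * wmat vs'" and len: "length vs = length vs'"
      and one: "\<forall>b\<in>set vs. 1 \<le> b" "\<forall>b\<in>set vs'. 1 \<le> b" for c c' vs vs'
  proof -
    define N N' where "N = (wmat vs :: int m2)" and "N' = (wmat vs' :: int m2)"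
    have e: "e21 N = e21 N'" "e22 N = e22 N'" "e11 N + int c * e21 N = e11 N' + int c' * e21 N'"
      "e12 N + int c * e22 N = e12 N' + int c' * e22 N'"
      using eq by (auto simp: m2_eq_iff N_def N'_def)
    show False
    proof (cases "vs = []")
      case True
      then have "N = 1" "N' = 1" using len by (auto simp: N_def N'_def)
      then show False using e(4) lt by simp
    next
      case False
      have bd: "\<exists>\<beta>. \<forall>b\<in>set vs. 1 \<le> b \<and> b \<le> \<beta>" "\<exists>\<beta>. \<forall>b\<in>set vs'. 1 \<le> b \<and> b \<le> \<beta>"
        using one by (meson List.finite_set finite_nat_set_iff_bounded_le)+
      have n: "0 \<le> e21 N" "1 \<le> e22 N" "e11 N \<le> e21 N" "e12 N \<le> e22 N" "0 \<le> e11 N'" "0 \<le> e12 N'"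
        using bd wmat_bounds False unfolding N_def N'_def by blast+
      define d where "d = int c' - int c"
      have d: "d \<ge> 1" using lt by (simp add: d_def)
      have e': "e11 N = e11 N' + d * e21 N" "e12 N = e12 N' + d * e22 N"
        using e by (auto simp: d_def algebra_simps)
      have "1 * e21 N \<le> d * e21 N" "1 * e22 N \<le> d * e22 N"
        by (rule mult_right_mono; use d n in linarith)+
      then have "e11 N = e21 N" "e12 N = e22 N" using e' n by linarith+
      then have "det2 N = 0" by (simp add: det2_def)
      then show False using det2_wmat[of vs, where 'a = int] by (simp add: N_def)
    qed
  qed
  have "b = b'"
    using less[of b b' ws ws'] less[of b' b ws' ws] Cons by (metis linorder_neqE_nat list.set_intros(2) wmat.simps(2))
  moreover from this have "wmat ws = (wmat ws' :: int m2)"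
    using Cons.prems(3) by (auto simp: m2_eq_iff)
  ultimately show ?case using Cons by auto
qed simp

section \<open>Short words with continuant divisible by a prime\<close>

lemma of_int_zero_iff:
  assumes ch: "\<And>m. of_nat m = (0 :: 'a::comm_ring_1) \<longleftrightarrow> p dvd m"
  shows "of_int z = (0 :: 'a) \<longleftrightarrow> int p dvd z"
  by (cases z rule: int_cases2) (simp_all add: ch)

lemma of_nat_surj:
  assumes ch: "\<And>m. of_nat m = (0 :: 'a::{field,finite}) \<longleftrightarrow> CARD('a) dvd m"
  shows "range (of_nat :: nat \<Rightarrow> 'a) = UNIV"
proof -
  have "m = m'" if lt: "m < CARD('a)" "m' \<le> m" and eq: "(of_nat m :: 'a) = of_nat m'" for m m'
  proof -
    have "(of_nat (m - m') :: 'a) = 0" using lt eq by (simp add: of_nat_diff)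
    then have "CARD('a) dvd m - m'" using ch by blast
    then show ?thesis using lt by (metis diff_is_0_eq diff_le_self dvd_imp_le le_antisym le_trans neq0_conv not_le)
  qed
  then have "inj_on (of_nat :: nat \<Rightarrow> 'a) {..<CARD('a)}"
    by (intro inj_onI) (metis lessThan_iff linorder_le_cases)
  then have "card ((of_nat :: nat \<Rightarrow> 'a) ` {..<CARD('a)}) = CARD('a)" by (simp add: card_image)
  then have "(of_nat :: nat \<Rightarrow> 'a) ` {..<CARD('a)} = UNIV" by (intro card_subset_eq) auto
  then show ?thesis by blast
qed

lemma card_words: "card {ws. set ws \<subseteq> {\<alpha>, \<beta> :: nat} \<and> length ws = n} = 2 ^ n" if "\<alpha> \<noteq> \<beta>"
  using card_lists_length_eq[of "{\<alpha>, \<beta>}" n] that by (simp add: numeral_2_eq_2)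

text \<open>The word length is the even number next to 9433 * j, so that the products have determinant 1.\<close>

lemma short_word:
  fixes \<alpha> \<beta> j M :: nat
  assumes ab: "1 \<le> \<alpha>" "\<alpha> < \<beta>" and j: "j \<ge> 5" "(\<beta> + 1) ^ (9434 * j) < CARD('a::{field,finite})"
    and M: "CARD('a) \<le> 2 ^ (j * M)" "M \<ge> 1" and p: "\<beta> * \<beta> + 4 < CARD('a)"
    and ch: "\<And>m. of_nat m = (0 :: 'a) \<longleftrightarrow> CARD('a) dvd m"
  shows "\<exists>ws. set ws \<subseteq> {\<alpha>, \<beta>} \<and> length ws \<le> 9434 * j * (3 ^ (4 * M + 1) * (4 * M)) \<and>
    CARD('a) dvd snd (cf_frac (ws @ [\<beta>]))"
proof -
  define n where "n = 9434 * j"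
  define W where "W = {ws. set ws \<subseteq> {\<alpha>, \<beta>} \<and> length ws = n}"
  define B where "B = (\<lambda>ws. Abs_sl2 (wmat ws) :: 'a sl2) ` W"
  \<comment> \<open>Since p <= 2^(j M), this is at least p^(1/M). It is nevertheless small against
    \<open>B\<close>, which will have 2^n = k^9434 elements.\<close>
  define k where "k = (2 :: real) ^ j"
  define t where "t = (of_nat \<alpha> - of_nat \<beta> :: 'a)"
  have n: "even n" "n > 0" using j by (auto simp: n_def)
  have mB: "mat (Abs_sl2 (wmat ws) :: 'a sl2) = wmat ws" if "even (length ws)" for ws
    using that by (simp add: Abs_sl2_inverse det2_wmat)
  have bound: "\<forall>b\<in>set ws. 1 \<le> b \<and> b \<le> \<beta>" if "ws \<in> W" for ws using that ab by (auto simp: W_def)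
  have small: "(int \<beta> + 1) ^ n < int CARD('a)"
  proof -
    have "int ((\<beta> + 1) ^ n) < int CARD('a)" using j(2) by (simp only: n_def of_nat_less_iff)
    then show ?thesis by (simp add: add.commute)
  qed
  \<comment> \<open>Matrix entries of words in \<open>W\<close> lie between 0 and this bound, which
    is below \<open>CARD('a)\<close>; so reduction to the field loses nothing.\<close>
  have red: "x = y" if "(of_int x :: 'a) = of_int y" "0 \<le> x" "x \<le> (int \<beta> + 1) ^ n" "0 \<le> y" "y \<le> (int \<beta> + 1) ^ n" for x y
  proof -
    have "int CARD('a) dvd x - y" using of_int_zero_iff[OF ch, of "x - y"] that(1) by simp
    moreover have "\<bar>x - y\<bar> < int CARD('a)" using that small by linarith
    ultimately show ?thesis using zdvd_not_zless[of "\<bar>x - y\<bar>" "int CARD('a)"] by force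
  qed
  have "inj_on (\<lambda>ws. Abs_sl2 (wmat ws) :: 'a sl2) W"
  proof (rule inj_onI)
    fix ws ws' assume ws: "ws \<in> W" "ws' \<in> W" and "(Abs_sl2 (wmat ws) :: 'a sl2) = Abs_sl2 (wmat ws')"
    then have "mat (Abs_sl2 (wmat ws) :: 'a sl2) = mat (Abs_sl2 (wmat ws') :: 'a sl2)" by simp
    then have "(wmat ws :: 'a m2) = wmat ws'" using mB[of ws] mB[of ws'] ws n by (simp add: W_def)
    then have e: "(of_int (e11 (wmat ws)) :: 'a) = of_int (e11 (wmat ws'))" "(of_int (e12 (wmat ws)) :: 'a) = of_int (e12 (wmat ws'))"
      "(of_int (e21 (wmat ws)) :: 'a) = of_int (e21 (wmat ws'))" "(of_int (e22 (wmat ws)) :: 'a) = of_int (e22 (wmat ws'))"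
      by (simp_all flip: wmat_of_int)
    have len: "length ws = n" "length ws' = n" using ws by (auto simp: W_def)
    note b = wmat_bounds[OF bound[OF ws(1)], unfolded len] wmat_bounds[OF bound[OF ws(2)], unfolded len]
    have "(wmat ws :: int m2) = wmat ws'"
      unfolding m2_eq_iff using b by (intro conjI red e) auto
    then show "ws = ws'" using len bound ws by (intro wmat_inj) auto
  qed
  then have cB: "card B = 2 ^ n" using card_words[of \<alpha> \<beta> n] ab by (simp add: B_def card_image W_def)
  define z where "z = replicate (n - 1) \<alpha>"
  have z: "z @ [\<alpha>] \<in> W" "z @ [\<beta>] \<in> W" "\<alpha> # z \<in> W" "\<beta> # z \<in> W" using n by (auto simp: z_def W_def)
  have lz: "odd (length z)" using n by (simp add: z_def)
  have cong: "adj2 (wmat z) * (wmat z :: 'a m2) = - 1" "(wmat z :: 'a m2) * adj2 (wmat z) = - 1"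
    using lz by (simp_all add: mult_adj2 det2_wmat m2_eq_iff)
  \<comment> \<open>Words that differ only in the last letter have an upper unipotent quotient on
    one side; words that differ only in the first letter have a lower one on the other side.\<close>
  define x y x' y' where "x = (Abs_sl2 (wmat (z @ [\<beta>])) :: 'a sl2)" and "y = (Abs_sl2 (wmat (z @ [\<alpha>])) :: 'a sl2)"
    and "x' = (Abs_sl2 (wmat (\<alpha> # z)) :: 'a sl2)" and "y' = (Abs_sl2 (wmat (\<beta> # z)) :: 'a sl2)"
  have xyB: "x \<in> B" "y \<in> B" "x' \<in> B" "y' \<in> B" unfolding B_def x_def y_def x'_def y'_def using z by blast+
  have mxy: "mat x = wmat z * cfmat \<beta>" "mat y = wmat z * cfmat \<alpha>" "mat x' = cfmat \<alpha> * wmat z" "mat y' = cfmat \<beta> * wmat z"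
    unfolding x_def y_def x'_def y'_def using lz by (subst mB; simp add: wmat_append)+
  have u: "mat (- x + y) = M2 1 t 0 1"
  proof -
    have "mat (- x + y) = adj2 (cfmat \<beta>) * (adj2 (wmat z) * wmat z) * cfmat \<alpha>"
      by (simp add: mxy adj2_mult mult.assoc)
    also have "\<dots> = M2 1 t 0 1" unfolding cong by (simp add: m2_eq_iff t_def)
    finally show ?thesis .
  qed
  have v: "mat (x' + - y') = M2 1 0 t 1"
  proof -
    have "mat (x' + - y') = cfmat \<alpha> * (wmat z * adj2 (wmat z)) * adj2 (cfmat \<beta>)"
      by (simp add: mxy adj2_mult mult.assoc)
    also have "\<dots> = M2 1 0 t 1" unfolding cong by (simp add: m2_eq_iff t_def)
    finally show ?thesis .
  qed
  have tt: "t = - of_nat (\<beta> - \<alpha>)" using ab by (simp add: t_def of_nat_diff)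
  \<comment> \<open>The quantities required to be nonzero, t, t^2 + 4 and 2, are up to sign images
    of positive integers of at most this size.\<close>
  have nz: "(of_nat m :: 'a) \<noteq> 0" if "0 < m" "m \<le> \<beta> * \<beta> + 4" for m
    using ch[of m] that p by (auto dest: dvd_imp_le)
  have bb: "\<beta> - \<alpha> \<le> \<beta> * \<beta>" "(\<beta> - \<alpha>) * (\<beta> - \<alpha>) \<le> \<beta> * \<beta>" by (simp add: le_square le_trans[OF diff_le_self], intro mult_le_mono) auto
  have "t \<noteq> 0" using nz[of "\<beta> - \<alpha>"] ab bb by (simp add: tt)
  moreover have "t * t + 4 \<noteq> 0" using nz[of "(\<beta> - \<alpha>) * (\<beta> - \<alpha>) + 4"] bb by (simp add: tt)
  moreover have "(2 :: 'a) \<noteq> 0" using nz[of 2] by simp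
  ultimately have ne: "t \<noteq> 0" "t * t + 4 \<noteq> 0" "(2 :: 'a) \<noteq> 0" .
  have k32: "k \<ge> 32" using power_increasing[of 5 j "2 :: real"] j by (simp add: k_def)
  have kB: "k ^ 9433 \<le> card B"
  proof -
    have "k ^ 9433 = 2 ^ (9433 * j)" by (simp add: k_def mult.commute flip: power_mult)
    also have "\<dots> \<le> 2 ^ n" unfolding n_def by (intro power_increasing) auto
    finally show ?thesis by (simp add: cB)
  qed
  have kM: "real CARD('a) \<le> k ^ M"
  proof -
    have "real CARD('a) \<le> real (2 ^ (j * M))" using M(1) by (simp only: of_nat_le_iff)
    then show ?thesis by (simp add: k_def power_mult)
  qed
  obtain l where l: "l \<le> 3 ^ (4 * M + 1) * (4 * M)"
    "\<forall>L\<in>lines. \<forall>L'\<in>lines. \<exists>g\<in>set_pow B l. act_line g L = L'"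
    using transitive_power[OF k32 kB u xyB(1,2) refl v xyB(3,4) refl ne of_nat_surj[OF ch] kM M(2)] by blast
  have "line (1, of_nat \<beta> :: 'a) \<in> lines" "line (1 :: 'a, 0) \<in> lines" unfolding lines_def by (rule imageI, simp)+
  then obtain g where g: "g \<in> set_pow B l" "act_line g (line (1, of_nat \<beta>)) = line (1, 0)" using l(2) by blast
  have words: "\<exists>ws. set ws \<subseteq> {\<alpha>, \<beta>} \<and> length ws = n * l \<and> mat g = wmat ws" if "g \<in> set_pow B l" for g l
    using that
  proof (induction l arbitrary: g)
    case 0
    then show ?case by (auto intro!: exI[of _ "[]"])
  next
    case (Suc l)
    then obtain b h where g: "g = b + h" "b \<in> B" "h \<in> set_pow B l" by (auto simp: set_plus_def)
    obtain ws where "set ws \<subseteq> {\<alpha>, \<beta>}" "length ws = n * l" "mat h = wmat ws" using Suc.IH[OF g(3)] by blast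
    moreover obtain vs where "vs \<in> W" "b = Abs_sl2 (wmat vs)" using g(2) by (auto simp: B_def)
    ultimately show ?case using g(1) mB[of vs] n
      by (intro exI[of _ "vs @ ws"]) (auto simp: W_def wmat_append)
  qed
  obtain ws where ws: "set ws \<subseteq> {\<alpha>, \<beta>}" "length ws = n * l" "mat g = wmat ws" using words[OF g(1)] by blast
  \<comment> \<open>The vector (1, \<beta>) is the last column of \<open>cfmat \<beta>\<close>, so
    the source line accounts for the final letter. On the target line the second coordinate, the
    denominator in the field, is 0.\<close>
  have "mv (wmat ws) (1, of_nat \<beta> :: 'a) = mv (wmat (ws @ [\<beta>])) (0, 1)"
    unfolding wmat_append mv_mult by (simp add: mv_def)
  also have "\<dots> = (of_nat (fst (cf_frac (ws @ [\<beta>]))), of_nat (snd (cf_frac (ws @ [\<beta>]))))" by (rule cf_frac_mv)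
  finally have "line (of_nat (fst (cf_frac (ws @ [\<beta>]))), of_nat (snd (cf_frac (ws @ [\<beta>])))) = line (1, 0 :: 'a)"
    using g(2) unfolding act_line_line ws(3) by simp
  moreover have "w \<in> line w" for w :: "'a \<times> 'a" unfolding line_def by (rule image_eqI[of _ _ 1]) auto
  ultimately have "(of_nat (fst (cf_frac (ws @ [\<beta>]))), of_nat (snd (cf_frac (ws @ [\<beta>])))) \<in> line (1, 0 :: 'a)" by metis
  then have "of_nat (snd (cf_frac (ws @ [\<beta>]))) = (0 :: 'a)" by (auto simp: line_def)
  then have "CARD('a) dvd snd (cf_frac (ws @ [\<beta>]))" using ch by blast
  moreover have "length ws \<le> 9434 * j * (3 ^ (4 * M + 1) * (4 * M))"
    unfolding ws(2) n_def using l(1) by (intro mult_left_mono) auto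
  ultimately show ?thesis using ws(1) by blast
qed

text \<open>Over a finite field some power \<open>g ^ d\<close> with d >= 2 of the invertible matrix
  \<open>cfmat \<beta>\<close> is 1. Then \<open>g ^ (d - 1)\<close> is its inverse
  \<open>h\<close>, whose lower right entry, the denominator, is 0.\<close>

lemma periodic_word:
  assumes ch: "\<And>m. of_nat m = (0 :: 'a::{field,finite}) \<longleftrightarrow> CARD('a) dvd m"
  shows "\<exists>m\<ge>1. CARD('a) dvd snd (cf_frac (replicate m \<beta>))"
proof -
  define g h where "g = (cfmat \<beta> :: 'a m2)" and "h = (M2 (- of_nat \<beta>) 1 1 0 :: 'a m2)"
  have hg: "h * g = 1" "g * h = 1" by (simp_all add: g_def h_def m2_eq_iff)
  have "\<not> inj (\<lambda>i :: nat. g ^ i)" using finite_imageD[of "\<lambda>i. g ^ i" UNIV] by auto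
  then obtain i i' where ii: "g ^ i = g ^ i'" "i < i'" unfolding inj_def by (metis linorder_neqE_nat)
  define d where "d = i' - i"
  have "h ^ i * g ^ i = 1" using left_right_inverse_power[OF hg(1)] .
  moreover have "g ^ i' = g ^ i * g ^ d" using ii(2) unfolding power_add[symmetric] d_def by simp
  ultimately have gd: "g ^ d = 1" using ii(1) by (metis mult.assoc mult_1)
  have "d \<noteq> 1"
  proof
    assume "d = 1"
    then have "g = 1" using gd by simp
    then show False by (simp add: g_def m2_eq_iff)
  qed
  then have d: "d \<ge> 2" using ii(2) by (simp add: d_def)
  then have "g ^ (d - 1) * g = 1" using gd power_Suc2[of g "d - 1"] by simp
  moreover have "g ^ (d - 1) = g ^ (d - 1) * g * h" by (simp add: mult.assoc hg)
  ultimately have "g ^ (d - 1) = h" by simp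
  then have "wmat (replicate (d - 1) \<beta>) = h" by (simp add: wmat_replicate g_def)
  then have "mv h (0, 1) = (of_nat (fst (cf_frac (replicate (d - 1) \<beta>))), of_nat (snd (cf_frac (replicate (d - 1) \<beta>))))"
    using cf_frac_mv[of "replicate (d - 1) \<beta>", where 'a = 'a] by simp
  then have "of_nat (snd (cf_frac (replicate (d - 1) \<beta>))) = (0 :: 'a)" by (simp add: mv_def h_def)
  then show ?thesis using ch d by (intro exI[of _ "d - 1"]) auto
qed

section \<open>A prime field for a potential counterexample\<close>

definition cf_divisible :: "nat \<Rightarrow> bool" where
  "cf_divisible p \<longleftrightarrow>
    (\<forall>\<alpha> \<beta> j M. 1 \<le> \<alpha> \<longrightarrow> \<alpha> < \<beta> \<longrightarrow> 5 \<le> j \<longrightarrow> (\<beta> + 1) ^ (9434 * j) < p \<longrightarrow> p \<le> 2 ^ (j * M) \<longrightarrow> 1 \<le> M \<longrightarrow>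
      \<beta> * \<beta> + 4 < p \<longrightarrow>
      (\<exists>ws. set ws \<subseteq> {\<alpha>, \<beta>} \<and> length ws \<le> 9434 * j * (3 ^ (4 * M + 1) * (4 * M)) \<and>
        p dvd snd (cf_frac (ws @ [\<beta>])))) \<and>
    (\<forall>\<beta>. \<exists>m\<ge>1. p dvd snd (cf_frac (replicate m \<beta>)))"

text \<open>A type cannot depend on the prime p of the theorem. But cf_divisible is a closed predicate,
  so it suffices to refute it for one fixed prime: a counterexample, if there is any.\<close>

definition bad_prime :: nat where
  "bad_prime = (if \<exists>p. prime p \<and> \<not> cf_divisible p then SOME p. prime p \<and> \<not> cf_divisible p else 2)"

lemma prime_bad_prime: "prime bad_prime"
  unfolding bad_prime_def by (auto intro: someI2_ex)

lemma bad_prime_gt_1: "1 < int bad_prime" "0 < int bad_prime"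
  using prime_gt_1_nat[OF prime_bad_prime] by auto

typedef fp = "{0..<int bad_prime}"
  using bad_prime_gt_1 by (intro exI[of _ 0]) simp

setup_lifting type_definition_fp

instantiation fp :: comm_ring_1
begin
lift_definition zero_fp :: fp is 0 using bad_prime_gt_1 by simp
lift_definition one_fp :: fp is 1 using bad_prime_gt_1 by simp
lift_definition plus_fp :: "fp \<Rightarrow> fp \<Rightarrow> fp" is "\<lambda>x y. (x + y) mod int bad_prime" using bad_prime_gt_1 by simp
lift_definition minus_fp :: "fp \<Rightarrow> fp \<Rightarrow> fp" is "\<lambda>x y. (x - y) mod int bad_prime" using bad_prime_gt_1 by simp
lift_definition uminus_fp :: "fp \<Rightarrow> fp" is "\<lambda>x. (- x) mod int bad_prime" using bad_prime_gt_1 by simp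
lift_definition times_fp :: "fp \<Rightarrow> fp \<Rightarrow> fp" is "\<lambda>x y. (x * y) mod int bad_prime" using bad_prime_gt_1 by simp
instance
  by standard (transfer; simp add: mod_simps algebra_simps)+
end

instance fp :: finite
proof
  have "inj Rep_fp" by (simp add: inj_def Rep_fp_inject)
  moreover have "Rep_fp ` UNIV \<subseteq> {0..<int bad_prime}" using Rep_fp by blast
  ultimately show "finite (UNIV :: fp set)" using finite_subset finite_imageD by blast
qed

lemma fp_no_zero_divisors: "x * y = (0 :: fp) \<Longrightarrow> x = 0 \<or> y = 0"
proof (transfer)
  fix x y assume xy: "x \<in> {0..<int bad_prime}" "y \<in> {0..<int bad_prime}" "x * y mod int bad_prime = 0"
  then have "int bad_prime dvd x \<or> int bad_prime dvd y"
    using prime_dvd_mult_iff[of "int bad_prime" x y] prime_bad_prime by (simp add: dvd_eq_mod_eq_0)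
  then show "x = 0 \<or> y = 0" using xy by (auto dest: zdvd_imp_le)
qed

instantiation fp :: field
begin
definition inverse_fp :: "fp \<Rightarrow> fp" where "inverse_fp x = (if x = 0 then 0 else SOME y. y * x = 1)"
definition divide_fp :: "fp \<Rightarrow> fp \<Rightarrow> fp" where "divide_fp x y = x * inverse y"
instance
proof
  fix x :: fp assume x: "x \<noteq> 0"
  have "inj (\<lambda>y. y * x)"
  proof (rule injI)
    fix y z assume "y * x = z * x"
    then have "(y - z) * x = 0" by (simp add: left_diff_distrib)
    then show "y = z" using x fp_no_zero_divisors[of "y - z" x] by simp
  qed
  then have "surj (\<lambda>y. y * x)" by (simp add: finite_UNIV_inj_surj)
  then obtain y where "1 = y * x" by (rule surjE)
  then have "\<exists>y. y * x = 1" by (intro exI[of _ y]) (rule sym)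
  then have "(SOME y. y * x = 1) * x = 1" by (rule someI_ex)
  then show "inverse x * x = 1" using x by (simp add: inverse_fp_def)
qed (simp_all add: divide_fp_def inverse_fp_def)
end

lemma card_fp: "CARD(fp) = bad_prime"
proof -
  have "Rep_fp ` UNIV = {0..<int bad_prime}" by (rule type_definition.Rep_range[OF type_definition_fp])
  moreover have "card (Rep_fp ` UNIV) = CARD(fp)" by (rule card_image) (simp add: inj_def Rep_fp_inject)
  ultimately show ?thesis by simp
qed

lemma of_nat_fp: "Rep_fp (of_nat m) = int m mod int bad_prime"
proof (induction m)
  case (Suc m)
  have "Rep_fp (of_nat (Suc m)) = (1 + Rep_fp (of_nat m)) mod int bad_prime"
    by (simp add: plus_fp.rep_eq one_fp.rep_eq)
  also have "\<dots> = (1 + int m) mod int bad_prime" unfolding Suc by (rule mod_add_right_eq)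
  finally show ?case by simp
qed (simp add: zero_fp.rep_eq)

lemma of_nat_fp_zero_iff: "of_nat m = (0 :: fp) \<longleftrightarrow> CARD(fp) dvd m"
proof -
  have "of_nat m = (0 :: fp) \<longleftrightarrow> int m mod int bad_prime = 0"
    using of_nat_fp[of m] by (metis Rep_fp_inject zero_fp.rep_eq)
  then show ?thesis unfolding card_fp by presburger
qed

lemma cf_divisible_prime:
  assumes "prime p" shows "cf_divisible p"
proof (rule ccontr)
  assume "\<not> cf_divisible p"
  then have ex: "\<exists>p. prime p \<and> \<not> cf_divisible p" using assms by blast
  have "\<not> cf_divisible bad_prime"
    using someI_ex[OF ex] ex by (simp add: bad_prime_def)
  moreover have "cf_divisible bad_prime"
    unfolding cf_divisible_def card_fp[symmetric]
    using short_word[where 'a = fp, OF _ _ _ _ _ _ _ of_nat_fp_zero_iff]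
      periodic_word[where 'a = fp, OF of_nat_fp_zero_iff] by blast
  ultimately show False by blast
qed

section \<open>The set F of a digit set with one positive element\<close>

text \<open>The constant cover by the single point has diameters 0, so it is admissible for every
  mesh and its sum is 0.\<close>

lemma hausdorff_dim_subsingleton:
  assumes "E \<subseteq> {x}" "s > 0"
  shows "hausdorff_dim E \<le> ereal s"
proof -
  have nonneg: "0 \<le> hausdorff_pre s d E" for d
    unfolding hausdorff_pre_def by (intro INF_greatest suminf_nonneg summable_ereal_pos) auto
  have "hausdorff_pre s d E \<le> 0" if "d > 0" for d
  proof -
    have "(\<lambda>i :: nat. {x}) \<in> {U. E \<subseteq> (\<Union>i. U i) \<and> (\<forall>i. bounded (U i) \<and> diameter (U i) \<le> d)}"
      using assms(1) that by auto
    then have "hausdorff_pre s d E \<le> (\<Sum>i :: nat. ereal (diameter {x} powr s))"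
      unfolding hausdorff_pre_def by (rule INF_lower)
    then show ?thesis by (simp flip: zero_ereal_def)
  qed
  then have "hausdorff_pre s d E = 0" if "d \<in> {0<..}" for d using nonneg that by (intro antisym) auto
  then have "hausdorff_measure s E = (SUP d\<in>{0 :: real<..}. 0)"
    unfolding hausdorff_measure_def by (intro SUP_cong refl)
  then have "hausdorff_measure s E = 0" by simp
  then show ?thesis unfolding hausdorff_dim_def using assms(2) by (intro Inf_lower) auto
qed

lemma gauss_map_irrational:
  assumes "x \<in> {0<..<1}" "x \<notin> \<rat>"
  shows "gauss_map x \<in> {0<..<1}" "gauss_map x \<notin> \<rat>" "1 / x = of_int \<lfloor>1 / x\<rfloor> + gauss_map x" "1 \<le> \<lfloor>1 / x\<rfloor>"
proof -
  have ir: "1 / x \<notin> \<rat>" using assms(2) Rats_inverse[of "1 / x"] by (auto simp: inverse_eq_divide)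
  show e: "1 / x = of_int \<lfloor>1 / x\<rfloor> + gauss_map x" by (simp add: gauss_map_def frac_def)
  have "gauss_map x \<noteq> 0"
  proof
    assume "gauss_map x = 0"
    then show False using e ir by (metis Rats_of_int add.right_neutral)
  qed
  then show "gauss_map x \<in> {0<..<1}" using frac_lt_1[of "1 / x"] frac_ge_0[of "1 / x"] by (auto simp: gauss_map_def)
  show "gauss_map x \<notin> \<rat>"
  proof
    assume "gauss_map x \<in> \<rat>"
    then have "of_int \<lfloor>1 / x\<rfloor> + gauss_map x \<in> \<rat>" by (intro Rats_add) auto
    then show False using e ir by simp
  qed
  show "1 \<le> \<lfloor>1 / x\<rfloor>" using assms(1) by (simp add: le_floor_iff)
qed

text \<open>A partial quotient of an irrational number in (0, 1) is never 0, so both orbits satisfy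
  x_n (b + x_(n+1)) = 1. Subtraction gives |x_n - y_n| = x_n y_n |x_(n+1) - y_(n+1)|, and over two
  steps the coefficient is at most 1/4.\<close>

lemma F_set_one_digit:
  assumes A: "\<And>d. d \<in> A \<Longrightarrow> d = 0 \<or> d = b" and xy: "x \<in> F_set A" "y \<in> F_set A"
  shows "x = y"
proof -
  have orbit: "\<exists>X. X 0 = x \<and> (\<forall>n. X n \<in> {0<..<1} \<and> 1 \<le> b \<and> X n * (real b + X (Suc n)) = 1)"
    if x: "x \<in> F_set A" for x
  proof -
    define X where "X n = (gauss_map ^^ n) x" for n
    have x01: "x \<in> {0<..<1}" "x \<notin> \<rat>"
    proof -
      have "x \<noteq> 0" "x \<noteq> 1" "x \<in> {0..1}" "x \<notin> \<rat>" using x by (auto simp: F_set_def)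
      then show "x \<in> {0<..<1}" "x \<notin> \<rat>" by auto
    qed
    have X: "X n \<in> {0<..<1} \<and> X n \<notin> \<rat>" for n
    proof (induction n)
      case (Suc n)
      then show ?case using gauss_map_irrational[of "X n"] by (simp add: X_def)
    qed (use x01 in \<open>simp add: X_def\<close>)
    have "1 \<le> b \<and> X n * (real b + X (Suc n)) = 1" for n
    proof -
      note g = gauss_map_irrational[OF conjunct1[OF X] conjunct2[OF X], of n]
      have "nat (cf_digit x n) \<in> A" using x by (auto simp: F_set_def)
      then have "nat \<lfloor>1 / X n\<rfloor> \<in> A" unfolding cf_digit_def X_def .
      then have "nat \<lfloor>1 / X n\<rfloor> = 0 \<or> nat \<lfloor>1 / X n\<rfloor> = b" by (rule A)
      then have "\<lfloor>1 / X n\<rfloor> = int b" "1 \<le> b" using g(4) by linarith+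
      moreover have "X (Suc n) = gauss_map (X n)" by (simp add: X_def)
      ultimately have "1 / X n = real b + X (Suc n)" using g(3) by simp
      moreover have "X n \<noteq> 0" using X[of n] by auto
      ultimately have "X n * (real b + X (Suc n)) = 1" by (metis nonzero_mult_div_cancel_left times_divide_eq_right mult.right_neutral)
      then show ?thesis using \<open>1 \<le> b\<close> by simp
    qed
    then show ?thesis using X by (intro exI[of _ X]) (auto simp: X_def)
  qed
  obtain X where X: "X 0 = x" "\<And>n. X n \<in> {0<..<1}" "1 \<le> b" "\<And>n. X n * (real b + X (Suc n)) = 1"
    using orbit[OF xy(1)] by blast
  obtain Y where Y: "Y 0 = y" "\<And>n. Y n \<in> {0<..<1}" "\<And>n. Y n * (real b + Y (Suc n)) = 1"
    using orbit[OF xy(2)] by blast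
  have step: "\<bar>X n - Y n\<bar> = X n * Y n * \<bar>X (Suc n) - Y (Suc n)\<bar>" for n
  proof -
    have "X n - Y n = X n * Y n * (Y (Suc n) - X (Suc n))" using X(4)[of n] Y(3)[of n] by algebra
    then show ?thesis using X(2)[of n] Y(2)[of n] by (simp add: abs_mult abs_minus_commute)
  qed
  \<comment> \<open>\<open>Z n * real b\<close> and \<open>Z n * Z (Suc n)\<close> add up to 1, and
    the second is the smaller because Z (Suc n) < 1 <= b.\<close>
  have half: "Z n * Z (Suc n) \<le> 1 / 2"
    if Z: "\<And>n. Z n \<in> {0<..<1}" "\<And>n. Z n * (real b + Z (Suc n)) = 1" for Z :: "nat \<Rightarrow> real" and n
  proof -
    have "Z n * Z (Suc n) \<le> Z n * real b" using Z(1)[of n] Z(1)[of "Suc n"] X(3) by (intro mult_left_mono) auto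
    then show ?thesis using Z(2)[of n] by (simp add: distrib_left)
  qed
  have step2: "\<bar>X n - Y n\<bar> \<le> 1 / 4 * \<bar>X (n + 2) - Y (n + 2)\<bar>" for n
  proof -
    have "\<bar>X n - Y n\<bar> = ((X n * X (Suc n)) * (Y n * Y (Suc n))) * \<bar>X (n + 2) - Y (n + 2)\<bar>"
      using step[of n] step[of "Suc n"] by simp
    also have "\<dots> \<le> ((1 / 2) * (1 / 2)) * \<bar>X (n + 2) - Y (n + 2)\<bar>"
      using half[of X n, OF X(2,4)] half[of Y n, OF Y(2,3)] X(2) Y(2)
      by (intro mult_right_mono mult_mono) (auto simp: less_imp_le)
    finally show ?thesis by simp
  qed
  have "\<bar>x - y\<bar> \<le> (1 / 4) ^ m" for m
  proof -
    have "\<bar>X 0 - Y 0\<bar> \<le> (1 / 4) ^ m * \<bar>X (2 * m) - Y (2 * m)\<bar>"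
    proof (induction m)
      case (Suc m)
      have "(1 / 4) ^ m * \<bar>X (2 * m) - Y (2 * m)\<bar> \<le> (1 / 4) ^ m * (1 / 4 * \<bar>X (2 * m + 2) - Y (2 * m + 2)\<bar>)"
        by (intro mult_left_mono step2) auto
      with Suc have "\<bar>X 0 - Y 0\<bar> \<le> (1 / 4) ^ m * (1 / 4 * \<bar>X (2 * m + 2) - Y (2 * m + 2)\<bar>)" by (rule order.trans)
      then show ?case by simp
    qed simp
    also have "\<dots> \<le> (1 / 4) ^ m * 1" using X(2)[of "2 * m"] Y(2)[of "2 * m"] by (intro mult_left_mono) auto
    finally show ?thesis using X(1) Y(1) by simp
  qed
  moreover have "(\<lambda>m. (1 / 4 :: real) ^ m) \<longlonglongrightarrow> 0" by (rule LIMSEQ_realpow_zero) auto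
  ultimately have "\<bar>x - y\<bar> \<le> 0" by (intro LIMSEQ_le_const[where X = "\<lambda>m. (1 / 4) ^ m"]) auto
  then show ?thesis by simp
qed

section \<open>Two letters from the dimension hypothesis, and the choice of constants\<close>

lemma two_positive_digits:
  assumes A: "finite A" "card A \<ge> 2" and dim: "hausdorff_dim (F_set A) > ereal (1 / 2)"
  obtains \<alpha> \<beta> where "\<alpha> \<in> A" "\<beta> \<in> A" "1 \<le> \<alpha>" "\<alpha> < \<beta>"
proof -
  have "\<exists>\<alpha>\<in>A. \<exists>\<beta>\<in>A. 1 \<le> \<alpha> \<and> \<alpha> < \<beta>"
  proof (rule ccontr)
    assume no: "\<not> ?thesis"
    have "d = 0 \<or> d = Max A" if "d \<in> A" for d
      using no that Max_ge[OF A(1) that] Max_in[OF A(1)] by (metis empty_iff less_one not_less le_neq_implies_less)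
    then have "F_set A \<subseteq> {SOME x. x \<in> F_set A}" using F_set_one_digit[of A "Max A"] by (metis singletonI someI subsetI)
    then have "hausdorff_dim (F_set A) \<le> ereal (1 / 2)" by (rule hausdorff_dim_subsingleton) simp
    then show False using dim by simp
  qed
  then show ?thesis using that by blast
qed

theorem theorem19:
  fixes A :: "nat set" and \<delta> :: real
  assumes "finite A" and "card A \<ge> 2"
    and "\<delta> > 0"
    and "hausdorff_dim (F_set A) > ereal (1/2 + \<delta>)"
  shows "\<exists>(C::nat) (K::real). \<forall>p::nat. prime p \<longrightarrow>
           (\<exists>q a :: nat. 0 < a \<and> a < q \<and> coprime a q \<and>
              real q \<le> K * real p ^ C \<and> p dvd q \<and>
              set (cf_quotients a q) \<subseteq> A)"
proof -
  have "ereal (1 / 2) \<le> ereal (1 / 2 + \<delta>)" using assms(3) by simp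
  then have "hausdorff_dim (F_set A) > ereal (1 / 2)" using assms(4) by (rule le_less_trans)
  then obtain \<alpha> \<beta> where ab: "\<alpha> \<in> A" "\<beta> \<in> A" "1 \<le> \<alpha>" "\<alpha> < \<beta>" using two_positive_digits assms(1,2) by blast
  \<comment> \<open>Above \<open>P0\<close> the number \<open>j\<close> chosen below is at least 5,
    which makes 2^j >= 32, and \<open>\<beta> * \<beta> + 4\<close> is less than the prime.\<close>
  define P0 where "P0 = (\<beta> + 1) ^ (9434 * 5) + (\<beta> * \<beta> + 4)"
  have "\<forall>p. \<exists>m. prime p \<longrightarrow> 1 \<le> m \<and> p dvd snd (cf_frac (replicate m \<beta>))"
    using cf_divisible_prime unfolding cf_divisible_def by blast
  then obtain m where m: "\<And>p. prime p \<Longrightarrow> 1 \<le> m p \<and> p dvd snd (cf_frac (replicate (m p) \<beta>))" by metis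
  \<comment> \<open>18868 = 2 * 9434: with i = j + 1 <= 2 j, the bound (\<beta> + 1)^(9434 i) for p
    is at most 2^(j M). \<open>L\<close> bounds the number of blocks of \<open>9434 * j\<close>
    letters in \<open>short_word\<close>, and it becomes the exponent of p.\<close>
  define M L where "M = (\<beta> + 1) * 18868" and "L = 3 ^ (4 * M + 1) * (4 * M)"
  \<comment> \<open>The summand \<open>\<beta> + 1\<close> pays for the appended letter, the sum for
    the denominators belonging to primes up to \<open>P0\<close>.\<close>
  define K where "K = (\<beta> + 1) + (\<Sum>p\<le>P0. snd (cf_frac (replicate (m p) \<beta>)))"
  have fraction: "\<exists>q a. 0 < a \<and> a < q \<and> coprime a q \<and> real q \<le> real K * real p ^ L \<and> p dvd q \<and> set (cf_quotients a q) \<subseteq> A"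
    if ws: "set ws \<subseteq> {\<alpha>, \<beta>}" "ws \<noteq> []" "last ws = \<beta>" and d: "p dvd snd (cf_frac ws)" and le: "snd (cf_frac ws) \<le> K * p ^ L"
    for ws p
  proof -
    have "\<forall>b\<in>set ws. 1 \<le> b" "ws = [] \<or> 2 \<le> last ws" using ws ab by auto
    from continuant_cf_quotients[OF this] show ?thesis using ws ab d le
      by (intro exI[of _ "snd (cf_frac ws)"] exI[of _ "fst (cf_frac ws)"]) (auto simp flip: of_nat_power of_nat_mult)
  qed
  have "\<exists>q a. 0 < a \<and> a < q \<and> coprime a q \<and> real q \<le> real K * real p ^ L \<and> p dvd q \<and> set (cf_quotients a q) \<subseteq> A"
    if p: "prime p" for p
  proof (cases "p \<le> P0")
    case True
    show ?thesis
    proof (rule fraction[of "replicate (m p) \<beta>"])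
      have "snd (cf_frac (replicate (m p) \<beta>)) \<le> (\<Sum>p\<le>P0. snd (cf_frac (replicate (m p) \<beta>)))"
        using True by (intro member_le_sum) auto
      then have "snd (cf_frac (replicate (m p) \<beta>)) \<le> K * 1" by (simp add: K_def)
      also have "\<dots> \<le> K * p ^ L" using prime_gt_0_nat[OF p] by (intro mult_left_mono) auto
      finally show "snd (cf_frac (replicate (m p) \<beta>)) \<le> K * p ^ L" .
    qed (use m[OF p] in auto)
  next
    case False
    \<comment> \<open>By minimality \<open>j = i - 1\<close> is the largest number with (\<beta> +
      1)^(9434 j) < p, so that entries of words of \<open>9434 * j\<close> letters stay below p;
      since p does not exceed the next such power, \<open>j\<close> is comparable to log p.\<close>
    define i where "i = (LEAST i. p \<le> (\<beta> + 1) ^ (9434 * i))"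
    have "\<exists>i. p \<le> (\<beta> + 1) ^ (9434 * i)"
    proof
      have "p < 2 ^ p" by (rule less_exp)
      also have "\<dots> \<le> (2 :: nat) ^ (9434 * p)" by (intro power_increasing) auto
      also have "\<dots> \<le> (\<beta> + 1) ^ (9434 * p)" using ab by (intro power_mono) auto
      finally show "p \<le> (\<beta> + 1) ^ (9434 * p)" by simp
    qed
    then have i: "p \<le> (\<beta> + 1) ^ (9434 * i)" unfolding i_def by (rule LeastI_ex)
    have i5: "i > 5"
    proof (rule ccontr)
      assume "\<not> i > 5"
      then have "(\<beta> + 1) ^ (9434 * i) \<le> (\<beta> + 1) ^ (9434 * 5)" by (intro power_increasing) auto
      then show False using i False by (simp add: P0_def)
    qed
    define j where "j = i - 1"
    have j: "j \<ge> 5" "i = j + 1" using i5 by (auto simp: j_def)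
    have jp: "(\<beta> + 1) ^ (9434 * j) < p"
      using not_less_Least[of j "\<lambda>i. p \<le> (\<beta> + 1) ^ (9434 * i)"] j unfolding i_def[symmetric] by simp
    have "p \<le> (2 ^ (\<beta> + 1)) ^ (9434 * i)"
    proof -
      have "(\<beta> + 1) ^ (9434 * i) \<le> (2 ^ (\<beta> + 1)) ^ (9434 * i)" using less_exp[of "\<beta> + 1"] by (intro power_mono) auto
      then show ?thesis using i by linarith
    qed
    also have "\<dots> = 2 ^ ((\<beta> + 1) * (9434 * i))" by (simp only: power_mult)
    also have "\<dots> \<le> 2 ^ (j * M)"
    proof (intro power_increasing)
      have "9434 * i \<le> j * 18868" using j by simp
      then have "(\<beta> + 1) * (9434 * i) \<le> (\<beta> + 1) * (j * 18868)" by (rule mult_left_mono) simp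
      then show "(\<beta> + 1) * (9434 * i) \<le> j * M" by (simp only: M_def mult_ac)
    qed simp
    finally have pM: "p \<le> 2 ^ (j * M)" .
    have M1: "1 \<le> M" "\<beta> * \<beta> + 4 < p" using False by (auto simp: M_def P0_def)
    obtain ws where ws: "set ws \<subseteq> {\<alpha>, \<beta>}" "length ws \<le> 9434 * j * L" "p dvd snd (cf_frac (ws @ [\<beta>]))"
      using cf_divisible_prime[OF p] ab j(1) jp pM M1 unfolding cf_divisible_def L_def by blast
    show ?thesis
    proof (rule fraction[of "ws @ [\<beta>]"])
      have "snd (cf_frac (ws @ [\<beta>])) \<le> (\<beta> + 1) ^ length (ws @ [\<beta>])"
      proof -
        have "\<forall>b\<in>set (ws @ [\<beta>]). b \<le> \<beta>" using ws ab by auto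
        then show ?thesis using cf_frac_bound by blast
      qed
      also have "\<dots> \<le> (\<beta> + 1) ^ (9434 * j * L + 1)" using ws(2) by (intro power_increasing) auto
      also have "\<dots> = (\<beta> + 1) * ((\<beta> + 1) ^ (9434 * j)) ^ L" by (simp add: power_mult)
      also have "\<dots> \<le> K * p ^ L" using jp by (intro mult_mono power_mono) (auto simp: K_def)
      finally show "snd (cf_frac (ws @ [\<beta>])) \<le> K * p ^ L" .
    qed (use ws in auto)
  qed
  then show ?thesis by blast
qed

end
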